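(* Let $K$ be a Cantor set and let $\mathrm{Homeo}(K)$ be the group of all homeomorphisms $K\to K$. Then $\mathrm{Homeo}(K)$ is boundedly acyclic, i.e. $H_b^n(\mathrm{Homeo}(K);\mathbb{R})\cong 0$ for all $n\geq 1$.
   Context: A Cantor set is a metric space which is compact, totally disconnected and perfect (has no isolated points). All groups are discrete. Bounded cohomology with trivial real coefficients: for a group $\Gamma$ and $n\ge 0$ let $C_b^n(\Gamma;\mathbb{R})$ be the space of bounded functions $f:\Gamma^{n+1}\to\mathbb{R}$, with $\Gamma$-action $(g\cdot f)(g_0,\dots,g_n)=f(g^{-1}g_0,\dots,g^{-1}g_n)$ and coboundary $\delta^n f(g_0,\dots,g_{n+1})=\sum_{i=0}^{n+1}(-1)^i f(g_0,\dots,\widehat{g_i},\dots,g_{n+1})$. Then $H_b^n(\Gamma;\mathbb{R})$ is the $n$-th cohomology of the complex $(C_b^\bullet(\Gamma;\mathbb{R})^\Gamma,\delta^\bullet)$ of $\Gamma$-invariants. *)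

theory Defs
  imports "HOL-Analysis.Analysis" "HOL-Algebra.Bij" "HOL-Algebra.Elementary_Groups"
begin

section \<open>Cantor sets and their homeomorphism groups\<close>

text \<open>A Cantor set is given as a subset of an ambient metric space, with the induced metric.
  The empty set is not excluded.\<close>

definition totally_disconnected :: "'a::topological_space set \<Rightarrow> bool" where
  "totally_disconnected S \<longleftrightarrow> (\<forall>x\<in>S. connected_component_set S x = {x})"

definition cantor_set :: "'a::metric_space set \<Rightarrow> bool" where
  "cantor_set K \<longleftrightarrow> compact K \<and> totally_disconnected K \<and> (\<forall>x\<in>K. \<not> x isolated_in K)"

text \<open>As in \<^const>\<open>BijGroup\<close>, self-maps of \<open>K\<close> are represented by extensional functions, so that
  each homeomorphism of \<open>K\<close> is represented exactly once.\<close>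

definition Homeo :: "'a::topological_space set \<Rightarrow> ('a \<Rightarrow> 'a) monoid" where
  "Homeo K = (BijGroup K)\<lparr>carrier := {f \<in> Bij K. \<exists>g. homeomorphism K K f g}\<rparr>"

lemma group_Homeo: "group (Homeo K)"
proof -
  interpret B: group "BijGroup K"
    by (rule group_BijGroup)
  have "subgroup {f \<in> Bij K. \<exists>g. homeomorphism K K f g} (BijGroup K)"
  proof (rule B.subgroupI)
    show "{f \<in> Bij K. \<exists>g. homeomorphism K K f g} \<subseteq> carrier (BijGroup K)"
      by (auto simp: BijGroup_def)
    have "homeomorphism K K (\<lambda>x\<in>K. x) (\<lambda>x. x)"
      by (rule homeomorphism_cong[OF homeomorphism_ident]) auto
    then show "{f \<in> Bij K. \<exists>g. homeomorphism K K f g} \<noteq> {}"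
      using id_Bij by blast
  next
    fix f assume "f \<in> {f \<in> Bij K. \<exists>g. homeomorphism K K f g}"
    then obtain g where f: "f \<in> Bij K" and g: "homeomorphism K K f g" by blast
    have eq: "inv\<^bsub>BijGroup K\<^esub> f = (\<lambda>x\<in>K. inv_into K f x)"
      using f by (rule inv_BijGroup)
    have "inj_on f K" using f by (auto simp: Bij_def bij_betw_def)
    then have "inv_into K f y = g y" if "y \<in> K" for y
      using g that unfolding homeomorphism_def by (metis image_eqI inv_into_f_eq)
    then have "homeomorphism K K (inv\<^bsub>BijGroup K\<^esub> f) f"
      by (intro homeomorphism_cong[OF homeomorphism_symD[OF g]]) (auto simp: eq)
    then show "inv\<^bsub>BijGroup K\<^esub> f \<in> {f \<in> Bij K. \<exists>g. homeomorphism K K f g}"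
      using f by (auto simp: eq restrict_inv_into_Bij)
  next
    fix f f'
    assume "f \<in> {f \<in> Bij K. \<exists>g. homeomorphism K K f g}"
      and "f' \<in> {f \<in> Bij K. \<exists>g. homeomorphism K K f g}"
    then obtain g g' where f: "f \<in> Bij K" "homeomorphism K K f g"
      and f': "f' \<in> Bij K" "homeomorphism K K f' g'" by blast
    have "homeomorphism K K (compose K f f') (g' \<circ> g)"
      by (rule homeomorphism_cong[OF homeomorphism_compose[OF f'(2) f(2)]])
        (auto simp: compose_def)
    then show "f \<otimes>\<^bsub>BijGroup K\<^esub> f' \<in> {f \<in> Bij K. \<exists>g. homeomorphism K K f g}"
      using f f' by (auto simp: BijGroup_def compose_Bij)
  qed
  then show ?thesis
    unfolding Homeo_def by (rule B.subgroup_imp_group)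
qed

section \<open>Bounded cohomology with trivial real coefficients\<close>

text \<open>An \<open>(n+1)\<close>-tuple of group elements is a list of length \<open>n+1\<close>.
  Cochains are extensional functions on the set of tuples.\<close>

definition tuples :: "('a, 'b) monoid_scheme \<Rightarrow> nat \<Rightarrow> 'a list set" where
  "tuples G n = {xs. length xs = Suc n \<and> set xs \<subseteq> carrier G}"

definition bounded_cochains :: "('a, 'b) monoid_scheme \<Rightarrow> nat \<Rightarrow> ('a list \<Rightarrow> real) set" where
  "bounded_cochains G n = {f \<in> extensional (tuples G n). bounded (f ` tuples G n)}"

definition cochain_act ::
  "('a, 'b) monoid_scheme \<Rightarrow> nat \<Rightarrow> 'a \<Rightarrow> ('a list \<Rightarrow> real) \<Rightarrow> 'a list \<Rightarrow> real" where
  "cochain_act G n g f = (\<lambda>xs \<in> tuples G n. f (map (\<lambda>x. inv\<^bsub>G\<^esub> g \<otimes>\<^bsub>G\<^esub> x) xs))"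

definition coboundary ::
  "('a, 'b) monoid_scheme \<Rightarrow> nat \<Rightarrow> ('a list \<Rightarrow> real) \<Rightarrow> 'a list \<Rightarrow> real" where
  "coboundary G n f =
    (\<lambda>xs \<in> tuples G (Suc n). \<Sum>i\<le>Suc n. (-1) ^ i * f (take i xs @ drop (Suc i) xs))"

text \<open>The real vector spaces of the complex are represented by their underlying additive groups,
  written multiplicatively as usual for \<^typ>\<open>'a monoid\<close>. The coboundaries form a linear subspace,
  so the quotient group below is the additive group of the quotient vector space.\<close>

definition invariant_cochain_group ::
  "('a, 'b) monoid_scheme \<Rightarrow> nat \<Rightarrow> ('a list \<Rightarrow> real) monoid" where
  "invariant_cochain_group G n =
    \<lparr>carrier = {f \<in> bounded_cochains G n. \<forall>g \<in> carrier G. cochain_act G n g f = f},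
     mult = (\<lambda>f h. \<lambda>xs \<in> tuples G n. f xs + h xs),
     one = (\<lambda>xs \<in> tuples G n. 0)\<rparr>"

definition bounded_cocycles :: "('a, 'b) monoid_scheme \<Rightarrow> nat \<Rightarrow> ('a list \<Rightarrow> real) set" where
  "bounded_cocycles G n =
    kernel (invariant_cochain_group G n) (invariant_cochain_group G (Suc n)) (coboundary G n)"

fun bounded_coboundaries :: "('a, 'b) monoid_scheme \<Rightarrow> nat \<Rightarrow> ('a list \<Rightarrow> real) set" where
  "bounded_coboundaries G 0 = {\<one>\<^bsub>invariant_cochain_group G 0\<^esub>}"
| "bounded_coboundaries G (Suc n) = coboundary G n ` carrier (invariant_cochain_group G n)"

definition bounded_cohomology ::
  "('a, 'b) monoid_scheme \<Rightarrow> nat \<Rightarrow> ('a list \<Rightarrow> real) set monoid" where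
  "bounded_cohomology G n =
    (invariant_cochain_group G n)\<lparr>carrier := bounded_cocycles G n\<rparr> Mod bounded_coboundaries G n"

definition boundedly_acyclic :: "('a, 'b) monoid_scheme \<Rightarrow> bool" where
  "boundedly_acyclic G \<longleftrightarrow> (\<forall>n\<ge>1. trivial_group (bounded_cohomology G n))"

end

theory Submission
  imports Defs
begin

text \<open>Write \<open>G\<close> for the group of homeomorphisms of a nonempty Cantor set \<open>K\<close>, and \<open>D\<close> for its subgroup
  of homeomorphisms with trivial germs along a nonempty finite set \<open>F\<close>. The proof is by induction
  on the degree \<open>n\<close>, for all Cantor sets simultaneously.

  The group \<open>D\<close> is exhausted by groups \<open>H\<close> of homeomorphisms supported in a clopen set \<open>A\<close>. Infinitely
  many disjoint copies of \<open>A\<close>, accumulating at a single point, fit into a slightly larger clopen set,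
  and the shift of these copies makes the restriction of degree \<open>n\<close> classes from \<open>D\<close> to \<open>H\<close> vanish
  (the mitosis argument), given the induction hypothesis for \<open>A\<close>. Uniformly bounded primitives
  on the groups \<open>H\<close> have an ultralimit on \<open>D\<close>.

  Then \<open>G\<close> acts on the tuples of germs of homeomorphisms at a base point with distinct image points.
  This complex is boundedly contractible, the action is transitive on simplices of each dimension,
  and the stabilisers are groups \<open>D\<close>, whose acyclicity up to degree \<open>n\<close> is already known. Hence the
  degree \<open>n\<close> bounded cohomology of \<open>G\<close> is that of the complex of invariant functions, which are the
  constants.\<close>

section \<open>Augmented cochains, ultralimits and exactness\<close>

text \<open>A homeomorphism of all of \<open>K\<close> leaves no room in \<open>K\<close> for
  disjoint copies of its support, so the shift argument cannot be applied to \<open>G\<close>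
  directly; the germ complex reduces the question to groups whose elements are supported in proper
  clopen subsets. Germs replace points because the stabiliser of a point still acts on the germs
  there, and its elements need not be supported in a clopen set missing that point. Brouwer's
  theorem, that nonempty Cantor sets are homeomorphic, supplies both the disjoint copies and the
  extension of germs behind transitivity.

  No spectral sequence is used. Mitosis and the germ action are both run by hand in one augmented
  double complex: a cocycle is spread over the total complex column by column
  (\<open>staircase\<close>) and then integrated row by row (\<open>collapse\<close>). Every
  primitive thereby gets a bound that depends only on the degree and on the bound of the cocycle,
  which is why exactness is quantified by a pair of constants throughout.\<close>

text \<open>Cochains of degree \<open>n\<close> are functions on lists of length \<open>n + 1\<close>; the empty list carries the
  augmentation.\<close>

primrec cobd :: "('a list \<Rightarrow> real) \<Rightarrow> 'a list \<Rightarrow> real" where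
  "cobd f [] = 0"
| "cobd f (x # xs) = f xs - cobd (\<lambda>ys. f (x # ys)) xs"

text \<open>These are the lists at which \<open>cobd f xs\<close> evaluates \<open>f\<close>.
  Cochains are total functions that are controlled only on certain tuples, so congruence, bounds and
  limits of \<open>cobd\<close> are stated relative to this set.\<close>

primrec faces :: "'a list \<Rightarrow> 'a list set" where
  "faces [] = {}"
| "faces (x # xs) = insert xs ((#) x ` faces xs)"

lemma length_faces: "ys \<in> faces xs \<Longrightarrow> Suc (length ys) = length xs"
  by (induction xs arbitrary: ys) auto

lemma set_faces: "ys \<in> faces xs \<Longrightarrow> set ys \<subseteq> set xs"
proof (induction xs arbitrary: ys)
  case (Cons x xs)
  then consider "ys = xs" | zs where "ys = x # zs" "zs \<in> faces xs" by auto
  then show ?case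
    by cases (use Cons.IH in auto)
qed simp

lemma faces_map: "faces (map f xs) = map f ` faces xs"
  by (induction xs) (simp_all add: image_image)

lemma distinct_faces: "ys \<in> faces xs \<Longrightarrow> distinct xs \<Longrightarrow> distinct ys"
proof (induction xs arbitrary: ys)
  case (Cons x xs)
  then consider "ys = xs" | zs where "ys = x # zs" "zs \<in> faces xs" by auto
  then show ?case
    by cases (use Cons set_faces in auto)
qed simp

lemma cobd_cong: "(\<And>ys. ys \<in> faces xs \<Longrightarrow> f ys = g ys) \<Longrightarrow> cobd f xs = cobd g xs"
proof (induction xs arbitrary: f g)
  case (Cons x xs)
  have "cobd (\<lambda>ys. f (x # ys)) xs = cobd (\<lambda>ys. g (x # ys)) xs"
    by (rule Cons.IH) (use Cons.prems in auto)
  then show ?case using Cons.prems by simp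
qed simp

lemma cobd_0 [simp]: "cobd (\<lambda>_. 0) xs = 0"
  by (induction xs) auto

lemma cobd_add: "cobd (\<lambda>ys. f ys + g ys) xs = cobd f xs + cobd g xs"
  by (induction xs arbitrary: f g) auto

lemma cobd_diff: "cobd (\<lambda>ys. f ys - g ys) xs = cobd f xs - cobd g xs"
  by (induction xs arbitrary: f g) auto

lemma cobd_cmult: "cobd (\<lambda>ys. c * f ys) xs = c * cobd f xs"
  by (induction xs arbitrary: f) (auto simp: algebra_simps)

lemma cobd_minus: "cobd (\<lambda>ys. - f ys) xs = - cobd f xs"
  using cobd_cmult[of "-1" f xs] by simp

lemma cobd_const: "cobd (\<lambda>_. c) xs = (if even (length xs) then 0 else c)"
  by (induction xs) auto

lemma cobd_cobd: "cobd (cobd f) xs = 0"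
proof (induction xs arbitrary: f)
  case (Cons x xs)
  have "cobd (\<lambda>ys. cobd f (x # ys)) xs = cobd f xs - cobd (cobd (\<lambda>ys. f (x # ys))) xs"
    by (simp add: cobd_diff)
  then show ?case using Cons.IH by simp
qed simp

lemma cobd_map: "cobd f (map h xs) = cobd (\<lambda>ys. f (map h ys)) xs"
  by (induction xs arbitrary: f) auto

lemma cobd_commute:
  "cobd (\<lambda>xs. cobd (\<lambda>ys. B xs ys) ys) xs = cobd (\<lambda>ys. cobd (\<lambda>xs. B xs ys) xs) ys"
proof (induction xs arbitrary: B)
  case (Cons x xs)
  have "cobd (\<lambda>ys. cobd (\<lambda>xs. B xs ys) (x # xs)) ys
      = cobd (B xs) ys - cobd (\<lambda>ys. cobd (\<lambda>zs. B (x # zs) ys) xs) ys"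
    by (simp add: cobd_diff)
  then show ?case by (simp add: Cons.IH[symmetric])
qed simp

lemma abs_cobd_le:
  "(\<And>ys. ys \<in> faces xs \<Longrightarrow> \<bar>f ys\<bar> \<le> M) \<Longrightarrow> \<bar>cobd f xs\<bar> \<le> real (length xs) * M"
proof (induction xs arbitrary: f)
  case (Cons x xs)
  have "\<bar>cobd (\<lambda>ys. f (x # ys)) xs\<bar> \<le> real (length xs) * M"
    by (rule Cons.IH) (use Cons.prems in auto)
  moreover have "\<bar>f xs\<bar> \<le> M" by (rule Cons.prems) auto
  ultimately show ?case by (simp add: algebra_simps)
qed simp

lemma tendsto_cobd:
  "(\<And>ys. ys \<in> faces xs \<Longrightarrow> ((\<lambda>k. F k ys) \<longlongrightarrow> f ys) U) \<Longrightarrow> ((\<lambda>k. cobd (F k) xs) \<longlongrightarrow> cobd f xs) U"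
proof (induction xs arbitrary: f F)
  case (Cons x xs)
  have "((\<lambda>k. cobd (\<lambda>ys. F k (x # ys)) xs) \<longlongrightarrow> cobd (\<lambda>ys. f (x # ys)) xs) U"
    by (rule Cons.IH) (use Cons.prems in auto)
  moreover have "((\<lambda>k. F k xs) \<longlongrightarrow> f xs) U" by (rule Cons.prems) auto
  ultimately show ?case by (auto intro: tendsto_diff)
qed simp

lemma cobd_eq_sum:
  "cobd f xs = (\<Sum>i<length xs. (-1) ^ i * f (take i xs @ drop (Suc i) xs))"
proof (induction xs arbitrary: f)
  case (Cons x xs)
  show ?case
    by (simp add: Cons.IH sum.lessThan_Suc_shift sum_negf[symmetric] del: sum.lessThan_Suc)
qed simp

section \<open>Prism operators and tuples over a set\<close>

text \<open>The prism operator: on [x0,...,xk] it is the alternating sum over i of f(x0,...,xi,h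
  xi,...,h xk). It is the homotopy between the identity and \<open>h\<close>; the recursion peels
  off the term with i = 0.\<close>

primrec prism :: "('a \<Rightarrow> 'a) \<Rightarrow> ('a list \<Rightarrow> real) \<Rightarrow> 'a list \<Rightarrow> real" where
  "prism h f [] = 0"
| "prism h f (x # xs) = f (x # h x # map h xs) - prism h (\<lambda>ys. f (x # ys)) xs"

lemma prism_diff: "prism h (\<lambda>ys. f ys - g ys) xs = prism h f xs - prism h g xs"
  by (induction xs arbitrary: f g) auto

lemma cobd_prism: "cobd (prism h f) xs + prism h (cobd f) xs = f (map h xs) - f xs"
proof (induction xs arbitrary: f)
  case (Cons x xs)
  let ?fx = "\<lambda>ys. f (x # ys)"
  have 1: "cobd (\<lambda>ys. prism h f (x # ys)) xs
      = cobd (\<lambda>ys. f (x # map h (x # ys))) xs - cobd (prism h ?fx) xs"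
    by (simp add: cobd_diff)
  have 2: "prism h (\<lambda>ys. cobd f (x # ys)) xs = prism h f xs - prism h (cobd ?fx) xs"
    by (simp add: prism_diff)
  have 3: "cobd f (x # h x # map h xs)
      = f (h x # map h xs) - f (x # map h xs) + cobd (\<lambda>ys. f (x # map h (x # ys))) xs"
    by (simp add: cobd_map)
  show ?case using Cons.IH[of ?fx] 1 2 3 by (simp add: algebra_simps)
qed simp

definition tups :: "'a set \<Rightarrow> nat \<Rightarrow> 'a list set" where
  "tups S n = {xs. length xs = n \<and> set xs \<subseteq> S}"

lemma faces_tups: "xs \<in> tups S (Suc n) \<Longrightarrow> ys \<in> faces xs \<Longrightarrow> ys \<in> tups S n"
  using length_faces[of ys xs] set_faces[of ys xs] by (auto simp: tups_def)

lemma map_tups: "xs \<in> tups S n \<Longrightarrow> (\<And>x. x \<in> S \<Longrightarrow> h x \<in> T) \<Longrightarrow> map h xs \<in> tups T n"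
  by (auto simp: tups_def)

lemma Nil_tups [simp]: "[] \<in> tups S n \<longleftrightarrow> n = 0"
  by (auto simp: tups_def)

lemma tups_0 [simp]: "tups S 0 = {[]}"
  by (auto simp: tups_def)

lemma Cons_tups [simp]: "x # xs \<in> tups S (Suc n) \<longleftrightarrow> x \<in> S \<and> xs \<in> tups S n"
  by (auto simp: tups_def)

lemma tups_length: "xs \<in> tups S n \<Longrightarrow> length xs = n"
  by (simp add: tups_def)

lemma tups_mono: "S \<subseteq> T \<Longrightarrow> xs \<in> tups S n \<Longrightarrow> xs \<in> tups T n"
  by (auto simp: tups_def)

lemma abs_prism_le:
  assumes "xs \<in> tups S n" "\<And>x. x \<in> S \<Longrightarrow> h x \<in> S"
    and "\<And>ys. ys \<in> tups S (Suc n) \<Longrightarrow> \<bar>f ys\<bar> \<le> M"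
  shows "\<bar>prism h f xs\<bar> \<le> real n * M"
  using assms
proof (induction n arbitrary: f xs)
  case (Suc n)
  then obtain x ys where xs: "xs = x # ys" "x \<in> S" "ys \<in> tups S n"
    by (cases xs) auto
  have "\<bar>prism h (\<lambda>ys. f (x # ys)) ys\<bar> \<le> real n * M"
    by (rule Suc.IH) (use Suc.prems xs in auto)
  moreover have "\<bar>f (x # h x # map h ys)\<bar> \<le> M"
    by (rule Suc.prems) (use Suc.prems xs map_tups[of ys S n h S] in auto)
  ultimately show ?case using xs by (simp add: algebra_simps)
qed auto

lemma prism_cong:
  assumes "xs \<in> tups S n" "\<And>x. x \<in> S \<Longrightarrow> h x \<in> S"
    and "\<And>ys. ys \<in> tups S (Suc n) \<Longrightarrow> f ys = g ys"
  shows "prism h f xs = prism h g xs"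
proof -
  \<comment> \<open>The bound with \<open>M = 0\<close> for the difference of \<open>f\<close> and
    \<open>g\<close> replaces a second induction.\<close>
  have "\<bar>prism h (\<lambda>ys. f ys - g ys) xs\<bar> \<le> real n * 0"
    by (rule abs_prism_le[OF assms(1,2)]) (use assms(3) in auto)
  then show ?thesis by (simp add: prism_diff)
qed

lemma prism_map:
  assumes "\<And>x. x \<in> set xs \<Longrightarrow> h (k x) = k (h x)"
  shows "prism h f (map k xs) = prism h (\<lambda>ys. f (map k ys)) xs"
  using assms by (induction xs arbitrary: f) (auto simp: comp_def cong: map_cong)

text \<open>Groups are written additively, but are not assumed to be commutative.\<close>

definition subgrp :: "'g::group_add set \<Rightarrow> bool" where
  "subgrp S \<longleftrightarrow> 0 \<in> S \<and> (\<forall>x\<in>S. \<forall>y\<in>S. x + y \<in> S) \<and> (\<forall>x\<in>S. - x \<in> S)"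

lemma subgrpI:
  "0 \<in> S \<Longrightarrow> (\<And>x y. x \<in> S \<Longrightarrow> y \<in> S \<Longrightarrow> x + y \<in> S) \<Longrightarrow> (\<And>x. x \<in> S \<Longrightarrow> - x \<in> S) \<Longrightarrow> subgrp S"
  by (simp add: subgrp_def)

lemma subgrp_0: "subgrp S \<Longrightarrow> 0 \<in> S"
  and subgrp_add: "subgrp S \<Longrightarrow> x \<in> S \<Longrightarrow> y \<in> S \<Longrightarrow> x + y \<in> S"
  and subgrp_minus: "subgrp S \<Longrightarrow> x \<in> S \<Longrightarrow> - x \<in> S"
  by (simp_all add: subgrp_def)

abbreviation translate :: "'g::plus \<Rightarrow> 'g list \<Rightarrow> 'g list" where
  "translate g \<equiv> map ((+) g)"

lemma translate_tups: "subgrp S \<Longrightarrow> g \<in> S \<Longrightarrow> xs \<in> tups S n \<Longrightarrow> translate g xs \<in> tups S n"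
  by (erule map_tups) (rule subgrp_add)

lemma translate_translate: "translate (g::'g::group_add) (translate h xs) = translate (g + h) xs"
  by (simp add: comp_def add.assoc)

lemma map_translate:
  assumes "\<And>g x. g \<in> A \<Longrightarrow> x \<in> A \<Longrightarrow> h (g + x) = h g + h x" "g \<in> A" "xs \<in> tups A k"
  shows "map h (translate g xs) = translate (h g) (map h xs)"
  using assms by (auto simp: tups_def)

lemma translate_0 [simp]: "translate (0::'g::group_add) xs = xs"
  by (induction xs) auto

section \<open>Invariant bounded cochains and quantitative exactness\<close>

text \<open>\<open>n\<close> is the length of the tuples, one more than the degree. Tuples run over
  \<open>G\<close> while invariance is under \<open>S\<close> only: for a subgroup \<open>S\<close>,
  the set \<open>G\<close> is a free \<open>S\<close>-set, so this complex still computes the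
  bounded cohomology of \<open>S\<close>. Stabilisers enter the double complex in this form.\<close>

definition cochain :: "'g::group_add set \<Rightarrow> 'g set \<Rightarrow> nat \<Rightarrow> real \<Rightarrow> ('g list \<Rightarrow> real) \<Rightarrow> bool" where
  "cochain G S n M f \<longleftrightarrow>
    (\<forall>xs\<in>tups G n. \<bar>f xs\<bar> \<le> M \<and> (\<forall>g\<in>S. f (translate g xs) = f xs))"

definition cocycle :: "'a set \<Rightarrow> nat \<Rightarrow> ('a list \<Rightarrow> real) \<Rightarrow> bool" where
  "cocycle G n f \<longleftrightarrow> (\<forall>xs\<in>tups G (Suc n). cobd f xs = 0)"

definition primitive :: "'a set \<Rightarrow> nat \<Rightarrow> ('a list \<Rightarrow> real) \<Rightarrow> ('a list \<Rightarrow> real) \<Rightarrow> bool" where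
  "primitive G p f b \<longleftrightarrow> (\<forall>xs\<in>tups G (Suc p). cobd b xs = f xs)"

lemma primitiveI: "(\<And>xs. xs \<in> tups G (Suc p) \<Longrightarrow> cobd b xs = f xs) \<Longrightarrow> primitive G p f b"
  and primitiveD: "primitive G p f b \<Longrightarrow> xs \<in> tups G (Suc p) \<Longrightarrow> cobd b xs = f xs"
  by (simp_all add: primitive_def)

text \<open>Here \<open>p\<close> is the degree in the usual indexing, so that cocycles live on tuples of length \<open>p + 1\<close>.\<close>

definition exact_at :: "'g::group_add set \<Rightarrow> 'g set \<Rightarrow> nat \<Rightarrow> real \<Rightarrow> real \<Rightarrow> bool" where
  "exact_at G S p M R \<longleftrightarrow> (\<forall>f. cochain G S (Suc p) M f \<longrightarrow> cocycle G (Suc p) f \<longrightarrow>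
    (\<exists>b. cochain G S p R b \<and> primitive G p f b))"

lemma cochainI:
  assumes "\<And>xs. xs \<in> tups G n \<Longrightarrow> \<bar>f xs\<bar> \<le> M"
    and "\<And>g xs. g \<in> S \<Longrightarrow> xs \<in> tups G n \<Longrightarrow> f (translate g xs) = f xs"
  shows "cochain G S n M f"
  using assms by (simp add: cochain_def)

lemma cochain_le: "cochain G S n M f \<Longrightarrow> xs \<in> tups G n \<Longrightarrow> \<bar>f xs\<bar> \<le> M"
  and cochain_inv: "cochain G S n M f \<Longrightarrow> g \<in> S \<Longrightarrow> xs \<in> tups G n \<Longrightarrow> f (translate g xs) = f xs"
  by (simp_all add: cochain_def)

lemma cocycleD: "cocycle G n f \<Longrightarrow> xs \<in> tups G (Suc n) \<Longrightarrow> cobd f xs = 0"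
  by (simp add: cocycle_def)

lemma exact_atE:
  assumes "exact_at G S p M R" "cochain G S (Suc p) M f" "cocycle G (Suc p) f"
  obtains b where "cochain G S p R b" "primitive G p f b"
  using assms unfolding exact_at_def by blast

text \<open>A cocycle of degree 0 is constant, by the cocycle condition on \<open>[0, x]\<close>; in
  the augmented complex its value, placed at \<open>[]\<close>, is a primitive with the same
  bound.\<close>

lemma exact_at_0:
  assumes "subgrp G"
  shows "exact_at G S 0 M M"
  unfolding exact_at_def
proof (intro allI impI)
  fix f assume f: "cochain G S (Suc 0) M f" and c: "cocycle G (Suc 0) f"
  have G0: "0 \<in> G" using assms by (rule subgrp_0)
  have "f [x] = f [0]" if "x \<in> G" for x
    using cocycleD[OF c, of "[0,x]"] that G0 by simp
  then have "primitive G 0 f (\<lambda>_. f [0])"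
    by (auto simp: primitive_def tups_def length_Suc_conv)
  moreover have "cochain G S 0 M (\<lambda>_. f [0])"
    using cochain_le[OF f, of "[0]"] G0 by (intro cochainI) auto
  ultimately show "\<exists>b. cochain G S 0 M b \<and> primitive G 0 f b" by blast
qed

text \<open>\<open>G\<close> is a free \<open>S\<close>-set, hence retracts equivariantly onto \<open>S\<close>.\<close>

lemma equivariant_retraction:
  assumes S: "subgrp S" and "subgrp G" and SG: "S \<subseteq> G"
  obtains \<rho> where "\<And>x. x \<in> G \<Longrightarrow> \<rho> x \<in> S" "\<And>s x. s \<in> S \<Longrightarrow> x \<in> G \<Longrightarrow> \<rho> (s + x) = s + \<rho> x"
proof -
  \<comment> \<open>\<open>rep\<close> is constant on cosets because the predicate under the choice
    operator is; \<open>x - rep x\<close> is then equivariant.\<close>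
  define rep where "rep x = (SOME y. x - y \<in> S)" for x
  have rep: "x - rep x \<in> S" for x
    unfolding rep_def by (rule someI[of _ x]) (use S in \<open>simp add: subgrp_0\<close>)
  have "s + x - y \<in> S \<longleftrightarrow> x - y \<in> S" if "s \<in> S" for s x y
  proof
    assume "s + x - y \<in> S"
    then have "- s + (s + x - y) \<in> S" using S that by (simp add: subgrp_add subgrp_minus)
    moreover have "- s + (s + x - y) = x - y" by (metis add_diff_eq minus_add_cancel)
    ultimately show "x - y \<in> S" by simp
  next
    assume "x - y \<in> S"
    then have "s + (x - y) \<in> S" using S that by (simp add: subgrp_add)
    then show "s + x - y \<in> S" by (simp add: add_diff_eq)
  qed
  then have "rep (s + x) = rep x" if "s \<in> S" for s x
    using that by (simp add: rep_def)
  then show ?thesis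
    using rep by (intro that[of "\<lambda>x. x - rep x"]) (auto simp: add_diff_eq)
qed

text \<open>Pulling \<open>b\<close> back along the equivariant retraction gives a primitive of the
  pullback of \<open>f\<close>; the prism between the identity and the retraction corrects the
  difference and costs \<open>real p * M\<close>.\<close>

lemma primitive_extend:
  assumes S: "subgrp S" and G: "subgrp G" and SG: "S \<subseteq> G"
    and f: "cochain G S (Suc p) M f" "cocycle G (Suc p) f"
    and b: "cochain S S p R b" "primitive S p f b"
  obtains b' where "cochain G S p (R + real p * M) b'"
    "primitive G p f b'"
proof -
  obtain \<rho> where \<rho>: "\<And>x. x \<in> G \<Longrightarrow> \<rho> x \<in> S" "\<And>s x. s \<in> S \<Longrightarrow> x \<in> G \<Longrightarrow> \<rho> (s + x) = s + \<rho> x"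
    using equivariant_retraction[OF S G SG] by blast
  have \<rho>G: "\<rho> x \<in> G" if "x \<in> G" for x using \<rho>(1)[OF that] SG by blast
  define b' where "b' xs = b (map \<rho> xs) - prism \<rho> f xs" for xs
  show ?thesis
  proof (rule that[of b'])
    show "cochain G S p (R + real p * M) b'"
    proof (rule cochainI)
      fix xs assume xs: "xs \<in> tups G p"
      have "\<bar>b (map \<rho> xs)\<bar> \<le> R" by (rule cochain_le[OF b(1)]) (rule map_tups[OF xs \<rho>(1)])
      moreover have "\<bar>prism \<rho> f xs\<bar> \<le> real p * M"
        by (rule abs_prism_le[OF xs \<rho>G cochain_le[OF f(1)]])
      ultimately show "\<bar>b' xs\<bar> \<le> R + real p * M" by (simp add: b'_def)
      fix g assume g: "g \<in> S"
      have eq: "map \<rho> (translate g xs) = translate g (map \<rho> xs)"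
        using xs \<rho>(2)[OF g] by (auto simp: tups_def)
      have "prism \<rho> f (translate g xs) = prism \<rho> (\<lambda>ys. f (translate g ys)) xs"
        by (rule prism_map) (use xs \<rho>(2)[OF g] in \<open>auto simp: tups_def\<close>)
      also have "\<dots> = prism \<rho> f xs"
        by (rule prism_cong[OF xs \<rho>G]) (auto simp: cochain_inv[OF f(1) g])
      finally show "b' (translate g xs) = b' xs"
        using cochain_inv[OF b(1) g map_tups[OF xs \<rho>(1)]] unfolding b'_def eq by simp
    qed
  next
    show "primitive G p f b'"
    proof (rule primitiveI)
      fix xs assume xs: "xs \<in> tups G (Suc p)"
      have "cobd (\<lambda>ys. b (map \<rho> ys)) xs = f (map \<rho> xs)"
        by (simp add: cobd_map[symmetric] primitiveD[OF b(2)] map_tups[OF xs \<rho>(1)])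
      moreover have "prism \<rho> (cobd f) xs = prism \<rho> (\<lambda>_. 0) xs"
        by (rule prism_cong[OF xs \<rho>G]) (auto simp: cocycleD[OF f(2)])
      moreover have "prism \<rho> (\<lambda>_. 0) xs = 0" by (induction xs) auto
      ultimately show "cobd b' xs = f xs"
        using cobd_prism[of \<rho> f xs] unfolding b'_def[abs_def] by (simp add: cobd_diff)
    qed
  qed
qed

lemma cochain_subset:
  "cochain G S n M f \<Longrightarrow> H \<subseteq> G \<Longrightarrow> T \<subseteq> S \<Longrightarrow> cochain H T n M f"
  by (auto simp: cochain_def dest: tups_mono)

lemma cochain_mono: "cochain G S n M f \<Longrightarrow> M \<le> M' \<Longrightarrow> cochain G S n M' f"
  by (force simp: cochain_def)

lemma cocycle_subset: "cocycle G n f \<Longrightarrow> H \<subseteq> G \<Longrightarrow> cocycle H n f"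
  by (auto simp: cocycle_def dest: tups_mono)

lemma exact_at_extend:
  assumes S: "subgrp S" and G: "subgrp G" and SG: "S \<subseteq> G" and ex: "exact_at S S p M R"
  shows "exact_at G S p M (R + real p * M)"
  unfolding exact_at_def
proof (intro allI impI)
  fix f assume f: "cochain G S (Suc p) M f" "cocycle G (Suc p) f"
  obtain b where b: "cochain S S p R b" "primitive S p f b"
    by (rule exact_atE[OF ex cochain_subset[OF f(1) SG order_refl] cocycle_subset[OF f(2) SG]])
  show "\<exists>b. cochain G S p (R + real p * M) b \<and> primitive G p f b"
    by (rule primitive_extend[OF S G SG f b]) blast
qed

section \<open>Ultrafilters and limits of bounded functions\<close>

definition ultra :: "'a filter \<Rightarrow> bool" where
  "ultra U \<longleftrightarrow> U \<noteq> bot \<and> (\<forall>P. eventually P U \<or> eventually (\<lambda>x. \<not> P x) U)"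

lemma ex_ultra:
  fixes F :: "'a filter"
  assumes "F \<noteq> bot"
  obtains U where "U \<le> F" "ultra U"
proof -
  \<comment> \<open>A finer filter is a smaller one, so ultrafilters are the minimal proper filters
    and Zorn's lemma is applied to the reversed order.\<close>
  define A where "A = {U. U \<le> F \<and> U \<noteq> bot}"
  have "\<exists>m\<in>A. \<forall>a\<in>A. a \<le> m \<longrightarrow> a = m"
  proof (rule predicate_Zorn)
    show "partial_order_on A (relation_of (\<lambda>x y. y \<le> x) A)"
      by (auto simp: partial_order_on_def preorder_on_def refl_on_def relation_of_def
          trans_def antisym_def)
  next
    fix C assume C: "C \<in> Chains (relation_of (\<lambda>x y. y \<le> x) A)"
    then have CA: "C \<subseteq> A" and chain: "\<And>x y. x \<in> C \<Longrightarrow> y \<in> C \<Longrightarrow> x \<le> y \<or> y \<le> x"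
      by (auto simp: Chains_def relation_of_def)
    show "\<exists>u\<in>A. \<forall>a\<in>C. u \<le> a"
    proof (cases "C = {}")
      case True
      then show ?thesis using assms by (auto simp: A_def)
    next
      case False
      \<comment> \<open>Over a nonempty chain the infimum has no events beyond those of its members,
        hence it stays proper.\<close>
      have "eventually P (Inf C) \<longleftrightarrow> (\<exists>b\<in>C. eventually P b)" for P
        by (rule eventually_Inf_base[OF False]) (metis chain inf.absorb1 inf.absorb2)
      then have "Inf C \<noteq> bot"
        using CA by (auto simp: trivial_limit_def A_def)
      moreover obtain V where "V \<in> C" using False by blast
      then have "Inf C \<le> F" using CA by (intro Inf_lower2[of V]) (auto simp: A_def)
      ultimately show ?thesis by (auto simp: A_def intro!: bexI[of _ "Inf C"] Inf_lower)
    qed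
  qed
  then obtain U where U: "U \<le> F" "U \<noteq> bot" and min: "\<And>V. V \<le> F \<Longrightarrow> V \<noteq> bot \<Longrightarrow> V \<le> U \<Longrightarrow> V = U"
    by (auto simp: A_def)
  have "eventually P U \<or> eventually (\<lambda>x. \<not> P x) U" for P
  proof (cases "inf U (principal {x. P x}) = bot")
    case True
    then show ?thesis by (simp add: trivial_limit_def eventually_inf_principal)
  next
    case False
    then have "inf U (principal {x. P x}) = U" by (intro min) (use U in \<open>auto intro: le_infI1\<close>)
    moreover have "eventually P (inf U (principal {x. P x}))"
      by (simp add: eventually_inf_principal)
    ultimately show ?thesis by simp
  qed
  then show ?thesis using that U by (auto simp: ultra_def)
qed

text \<open>Compactness of the interval yields a cluster point, and along an ultrafilter a cluster
  point is a limit.\<close>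

lemma ultra_convergent:
  fixes a :: "'a \<Rightarrow> real"
  assumes U: "ultra U" and bnd: "eventually (\<lambda>k. \<bar>a k\<bar> \<le> M) U"
  obtains l where "(a \<longlongrightarrow> l) U" "\<bar>l\<bar> \<le> M"
proof -
  have nb: "filtermap a U \<noteq> bot" using U by (simp add: ultra_def filtermap_bot_iff)
  have "eventually (\<lambda>y. y \<in> {-M..M}) (filtermap a U)"
    using bnd by (simp add: eventually_filtermap abs_le_iff minus_le_iff conj_commute)
  then obtain l where l: "l \<in> {-M..M}" "inf (nhds l) (filtermap a U) \<noteq> bot"
    using nb compact_filter[of "{-M..M}"] compact_Icc by blast
  have "(a \<longlongrightarrow> l) U"
  proof (rule topological_tendstoI)
    fix S assume S: "open S" "l \<in> S"
    show "eventually (\<lambda>x. a x \<in> S) U"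
    proof (rule ccontr)
      assume "\<not> ?thesis"
      then have "eventually (\<lambda>x. a x \<notin> S) U" using U by (auto simp: ultra_def)
      then have "eventually (\<lambda>y. y \<notin> S) (filtermap a U)" by (simp add: eventually_filtermap)
      moreover have "eventually (\<lambda>y. y \<in> S) (nhds l)" using S by (simp add: eventually_nhds_in_open)
      ultimately have "eventually (\<lambda>_. False) (inf (nhds l) (filtermap a U))"
        unfolding eventually_inf by blast
      then show False using l(2) by (simp add: trivial_limit_def)
    qed
  qed
  then show ?thesis using l by (intro that) auto
qed

section \<open>The double complex of a group action\<close>

text \<open>Total differential of the double complex, augmented in both directions; since tuples are
  lists, the augmentations are the values at \<^term>\<open>[]\<close>.\<close>

definition dtot :: "('a list \<Rightarrow> 'b list \<Rightarrow> real) \<Rightarrow> 'a list \<Rightarrow> 'b list \<Rightarrow> real" where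
  "dtot B xs ys = cobd (\<lambda>zs. B zs ys) xs + (-1) ^ length xs * cobd (B xs) ys"

text \<open>The last argument counts the columns already treated. A value in the next column is a
  primitive, in degree \<open>n - j\<close>, of a coboundary with \<open>Suc j\<close> terms; only
  the first column has its own bound \<open>R\<close>.\<close>

primrec stair_bound :: "(nat \<Rightarrow> real \<Rightarrow> real) \<Rightarrow> nat \<Rightarrow> real \<Rightarrow> real \<Rightarrow> nat \<Rightarrow> real" where
  "stair_bound \<rho> n M R 0 = M"
| "stair_bound \<rho> n M R (Suc j) = max (stair_bound \<rho> n M R j)
    (if j = 0 then R else \<rho> (n - j) (real (Suc j) * stair_bound \<rho> n M R j))"

text \<open>The constant for rows: a new row is a limit of values of the total cocycle, bounded by
  \<open>M\<close>, minus a coboundary with \<open>Suc j\<close> terms. \<open>M'\<close> bounds the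
  row \<open>xs = []\<close>.\<close>

primrec collapse_bound :: "real \<Rightarrow> real \<Rightarrow> nat \<Rightarrow> real" where
  "collapse_bound M M' 0 = M'"
| "collapse_bound M M' (Suc j) =
    max (collapse_bound M M' j) (M + real (Suc j) * collapse_bound M M' j)"

section \<open>Groups acting on ordered complexes\<close>

text \<open>\<open>X\<close> is the set of ordered simplices, including the empty one. Closure under
  faces is the only combinatorial condition, which allows \<open>X\<close> to consist of tuples in
  general position.\<close>

locale complex_action =
  fixes G :: "'g::group_add set" and X :: "'x list set" and act :: "'g \<Rightarrow> 'x \<Rightarrow> 'x"
  assumes G: "subgrp G"
    and act_0: "act 0 y = y"
    and act_add: "act (g + h) y = act g (act h y)"
    and X_act: "g \<in> G \<Longrightarrow> ys \<in> X \<Longrightarrow> map (act g) ys \<in> X"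
    and X_faces: "ys \<in> X \<Longrightarrow> zs \<in> faces ys \<Longrightarrow> zs \<in> X"
    and X_Nil: "[] \<in> X"
begin

abbreviation acts :: "'g \<Rightarrow> 'x list \<Rightarrow> 'x list" where
  "acts g \<equiv> map (act g)"

lemma acts_0 [simp]: "acts 0 ys = ys"
  by (simp add: act_0 map_idI)

lemma acts_add: "acts g (acts h ys) = acts (g + h) ys"
  by (simp add: act_add comp_def)

definition stab :: "'x list \<Rightarrow> 'g set" where
  "stab ys = {g \<in> G. acts g ys = ys}"

lemma stab_subset: "stab ys \<subseteq> G"
  by (auto simp: stab_def)

text \<open>\<open>N\<close> is the total length of both tuples, and \<open>P\<close> cuts out the
  part of the double complex constructed so far; nothing is required elsewhere.\<close>

definition dcochain :: "nat \<Rightarrow> real \<Rightarrow> ('g list \<Rightarrow> 'x list \<Rightarrow> bool) \<Rightarrow> ('g list \<Rightarrow> 'x list \<Rightarrow> real) \<Rightarrow> bool" where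
  "dcochain N M P B \<longleftrightarrow> (\<forall>xs ys. set xs \<subseteq> G \<longrightarrow> ys \<in> X \<longrightarrow> length xs + length ys = N \<longrightarrow> P xs ys \<longrightarrow>
     \<bar>B xs ys\<bar> \<le> M \<and> (\<forall>g\<in>G. B (translate g xs) (acts g ys) = B xs ys))"

lemma dcochainI:
  assumes "\<And>xs ys. set xs \<subseteq> G \<Longrightarrow> ys \<in> X \<Longrightarrow> length xs + length ys = N \<Longrightarrow> P xs ys \<Longrightarrow> \<bar>B xs ys\<bar> \<le> M"
    and "\<And>xs ys g. set xs \<subseteq> G \<Longrightarrow> ys \<in> X \<Longrightarrow> length xs + length ys = N \<Longrightarrow> P xs ys \<Longrightarrow> g \<in> G
      \<Longrightarrow> B (translate g xs) (acts g ys) = B xs ys"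
  shows "dcochain N M P B"
  using assms by (simp add: dcochain_def)

lemma dcochainD:
  assumes "dcochain N M P B" "set xs \<subseteq> G" "ys \<in> X" "length xs + length ys = N" "P xs ys"
  shows "\<bar>B xs ys\<bar> \<le> M" "g \<in> G \<Longrightarrow> B (translate g xs) (acts g ys) = B xs ys"
  using assms by (simp_all add: dcochain_def)

definition deq :: "nat \<Rightarrow> ('g list \<Rightarrow> 'x list \<Rightarrow> bool) \<Rightarrow> ('g list \<Rightarrow> 'x list \<Rightarrow> real) \<Rightarrow> ('g list \<Rightarrow> 'x list \<Rightarrow> real) \<Rightarrow> bool" where
  "deq N P B B' \<longleftrightarrow> (\<forall>xs ys. set xs \<subseteq> G \<longrightarrow> ys \<in> X \<longrightarrow> length xs + length ys = N \<longrightarrow> P xs ys \<longrightarrow> dtot B xs ys = B' xs ys)"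

lemma deqI:
  assumes "\<And>xs ys. set xs \<subseteq> G \<Longrightarrow> ys \<in> X \<Longrightarrow> length xs + length ys = N \<Longrightarrow> P xs ys \<Longrightarrow> dtot B xs ys = B' xs ys"
  shows "deq N P B B'"
  using assms by (simp add: deq_def)

lemma deqD:
  assumes "deq N P B B'" "set xs \<subseteq> G" "ys \<in> X" "length xs + length ys = N" "P xs ys"
  shows "dtot B xs ys = B' xs ys"
  using assms by (simp add: deq_def)

text \<open>A primitive is taken at one representative of each orbit and transported along the
  orbit. This is consistent because it is invariant under the stabiliser of the
  representative.\<close>

lemma equivariant_primitives:
  assumes Y: "Y \<subseteq> X" "\<And>g ys. g \<in> G \<Longrightarrow> ys \<in> Y \<Longrightarrow> acts g ys \<in> Y"
    and ex: "\<And>ys. ys \<in> Y \<Longrightarrow> \<exists>b. cochain G (stab ys) p R b \<and> primitive G p (f ys) b"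
    and f: "\<And>g ys xs. g \<in> G \<Longrightarrow> ys \<in> Y \<Longrightarrow> xs \<in> tups G (Suc p) \<Longrightarrow> f (acts g ys) (translate g xs) = f ys xs"
  obtains B where
    "\<And>ys. ys \<in> Y \<Longrightarrow> primitive G p (f ys) (\<lambda>xs. B xs ys)"
    "\<And>ys xs. ys \<in> Y \<Longrightarrow> xs \<in> tups G p \<Longrightarrow> \<bar>B xs ys\<bar> \<le> R"
    "\<And>ys xs g. ys \<in> Y \<Longrightarrow> xs \<in> tups G p \<Longrightarrow> g \<in> G \<Longrightarrow> B (translate g xs) (acts g ys) = B xs ys"
proof -
  define rep where "rep ys = (SOME zs. \<exists>g\<in>G. zs = acts g ys)" for ys
  have rep: "\<exists>g\<in>G. rep ys = acts g ys" for ys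
    unfolding rep_def by (rule someI[of _ ys]) (auto intro!: bexI[of _ 0] simp: subgrp_0[OF G])
  have "(\<exists>h\<in>G. zs = acts h (acts g ys)) \<longleftrightarrow> (\<exists>h\<in>G. zs = acts h ys)" if "g \<in> G" for g ys zs
  proof
    assume "\<exists>h\<in>G. zs = acts h ys"
    then obtain h where "h \<in> G" "zs = acts h ys" by blast
    moreover have "acts (h - g) (acts g ys) = acts h ys" by (simp only: acts_add) simp
    moreover have "h - g \<in> G" using \<open>h \<in> G\<close> that G by (metis diff_conv_add_uminus subgrp_add subgrp_minus)
    ultimately show "\<exists>h\<in>G. zs = acts h (acts g ys)" by metis
  qed (use G that in \<open>auto simp: acts_add subgrp_add simp del: map_map\<close>)
  then have rep_act: "rep (acts g ys) = rep ys" if "g \<in> G" for g ys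
    using that by (simp add: rep_def)
  obtain k where k: "\<And>ys. k ys \<in> G" "\<And>ys. rep ys = acts (k ys) ys"
    using rep by metis
  obtain b where b: "\<And>ys. ys \<in> Y \<Longrightarrow> cochain G (stab ys) p R (b ys)"
      "\<And>ys. ys \<in> Y \<Longrightarrow> primitive G p (f ys) (b ys)"
    using ex by metis
  define B where "B xs ys = b (rep ys) (translate (k ys) xs)" for xs ys
  have repY: "rep ys \<in> Y" if "ys \<in> Y" for ys using k Y(2) that by simp
  show ?thesis
  proof (rule that[of B])
    fix ys assume ys: "ys \<in> Y"
    show "primitive G p (f ys) (\<lambda>xs. B xs ys)"
    proof (rule primitiveI)
      fix xs assume xs: "xs \<in> tups G (Suc p)"
      have "cobd (\<lambda>xs. B xs ys) xs = cobd (b (rep ys)) (translate (k ys) xs)"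
        by (simp add: B_def cobd_map)
      also have "\<dots> = f (rep ys) (translate (k ys) xs)"
        by (rule primitiveD[OF b(2)[OF repY[OF ys]] translate_tups[OF G k(1) xs]])
      also have "\<dots> = f ys xs" by (simp only: k(2) f[OF k(1) ys xs])
      finally show "cobd (\<lambda>xs. B xs ys) xs = f ys xs" .
    qed
    fix xs assume xs: "xs \<in> tups G p"
    show "\<bar>B xs ys\<bar> \<le> R" unfolding B_def
      by (rule cochain_le[OF b(1)[OF repY[OF ys]] translate_tups[OF G k(1) xs]])
    fix g assume g: "g \<in> G"
    \<comment> \<open>The two transports to the representative, from \<open>ys\<close> and from its
      translate, differ by this element of the stabiliser.\<close>
    let ?s = "k (acts g ys) + g - k ys"
    have "acts (k (acts g ys) + g) ys = rep ys"
      using k(2)[of "acts g ys"] by (simp only: acts_add rep_act[OF g])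
    moreover have "acts ?s (rep ys) = acts (k (acts g ys) + g) ys"
      by (simp only: k(2)[of ys] acts_add) simp
    moreover have "?s \<in> G"
      unfolding diff_conv_add_uminus by (intro subgrp_add subgrp_minus G k(1) g)
    ultimately have s: "?s \<in> stab (rep ys)" by (simp add: stab_def)
    have "translate (k (acts g ys)) (translate g xs) = translate ?s (translate (k ys) xs)"
      by (simp only: translate_translate) simp
    then show "B (translate g xs) (acts g ys) = B xs ys"
      using cochain_inv[OF b(1)[OF repY[OF ys]] s translate_tups[OF G k(1) xs]]
      by (simp only: B_def rep_act[OF g])
  qed
qed

text \<open>The cocycle \<open>c\<close> in the column \<open>ys = []\<close> is extended column by column to a cocycle of the
  total complex.\<close>

lemma staircase:
  assumes c: "cochain G G (Suc n) M c" "cocycle G (Suc n) c"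
    and first: "\<And>y. [y] \<in> X \<Longrightarrow> \<exists>b. cochain G (stab [y]) n R b \<and> primitive G n c b"
    and exact: "\<And>ys p M. ys \<in> X \<Longrightarrow> 2 \<le> length ys \<Longrightarrow> p + length ys = Suc n
      \<Longrightarrow> exact_at G (stab ys) p M (\<rho> p M)"
  obtains B where "dcochain (Suc n) (stair_bound \<rho> n M R (Suc n)) (\<lambda>_ _. True) B"
    "deq (Suc (Suc n)) (\<lambda>_ _. True) B (\<lambda>_ _. 0)"
    "\<And>xs. xs \<in> tups G (Suc n) \<Longrightarrow> B xs [] = c xs"
proof -
  let ?S = "stair_bound \<rho> n M R"
  have "\<exists>B. dcochain (Suc n) (?S j) (\<lambda>xs ys. length ys \<le> j) B
      \<and> deq (Suc (Suc n)) (\<lambda>xs ys. length ys \<le> j) B (\<lambda>_ _. 0)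
      \<and> (\<forall>xs\<in>tups G (Suc n). B xs [] = c xs)" if "j \<le> Suc n" for j
    using that
  proof (induction j)
    case 0
    have "dcochain (Suc n) M (\<lambda>xs ys. length ys \<le> 0) (\<lambda>xs ys. c xs)"
      by (rule dcochainI) (use c in \<open>auto simp: cochain_def tups_def\<close>)
    moreover have "deq (Suc (Suc n)) (\<lambda>xs ys. length ys \<le> 0) (\<lambda>xs ys. c xs) (\<lambda>_ _. 0)"
      by (rule deqI) (use c(2) in \<open>auto simp: cocycle_def tups_def dtot_def\<close>)
    ultimately show ?case by auto
  next
    case (Suc j)
    then obtain B where B: "dcochain (Suc n) (?S j) (\<lambda>xs ys. length ys \<le> j) B"
      "deq (Suc (Suc n)) (\<lambda>xs ys. length ys \<le> j) B (\<lambda>_ _. 0)"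
      "\<And>xs. xs \<in> tups G (Suc n) \<Longrightarrow> B xs [] = c xs"
      by auto
    define p where "p = n - j"
    have p: "p + j = n" using Suc.prems by (simp add: p_def)
    define Y where "Y = {ys \<in> X. length ys = Suc j}"
    have Y_face: "zs \<in> X \<and> length zs = j" if "ys \<in> Y" "zs \<in> faces ys" for ys zs
      using that length_faces[of zs ys] X_faces by (auto simp: Y_def)
    define f where "f ys xs = cobd (B xs) ys" for xs ys
    have f_inv: "f (acts g ys) (translate g xs) = f ys xs"
      if "g \<in> G" "ys \<in> Y" "xs \<in> tups G (Suc p)" for g ys xs
      unfolding f_def cobd_map
    proof (rule cobd_cong)
      fix zs assume "zs \<in> faces ys"
      then show "B (translate g xs) (acts g zs) = B xs zs"
        using Y_face[OF that(2)] that p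
        by (intro dcochainD(2)[OF B(1)]) (auto simp: tups_def)
    qed
    have "\<exists>b. cochain G (stab ys) p (?S (Suc j)) b \<and> primitive G p (f ys) b" if ys: "ys \<in> Y" for ys
    \<comment> \<open>In the first column \<open>f ys\<close> is \<open>c\<close> itself, whose
      primitive is given by \<open>first\<close>; the later columns lie in degrees below
      \<open>n\<close>, where exactness for the stabilisers applies.\<close>
    proof (cases "j = 0")
      case True
      then obtain y where y: "ys = [y]" "[y] \<in> X" using ys by (auto simp: Y_def length_Suc_conv)
      then obtain b where b: "cochain G (stab ys) n R b" "primitive G n c b"
        using first by blast
      have "primitive G p (f ys) b"
        using b(2) p True y B(3) by (auto simp: primitive_def f_def)
      moreover have "cochain G (stab ys) p (?S (Suc j)) b"
        using b(1) p True by (auto simp: cochain_def)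
      ultimately show ?thesis by blast
    next
      case False
      have *: "exact_at G (stab ys) p (real (Suc j) * ?S j) (\<rho> p (real (Suc j) * ?S j))"
        using False ys p by (intro exact) (auto simp: Y_def)
      have f1: "cochain G (stab ys) (Suc p) (real (Suc j) * ?S j) (f ys)"
      proof (rule cochainI)
        fix xs assume xs: "xs \<in> tups G (Suc p)"
        have "\<bar>f ys xs\<bar> \<le> real (length ys) * ?S j"
          unfolding f_def
          by (rule abs_cobd_le, rule dcochainD(1)[OF B(1)]) (use Y_face[OF ys] xs p in \<open>auto simp: tups_def\<close>)
        then show "\<bar>f ys xs\<bar> \<le> real (Suc j) * ?S j" using ys by (simp add: Y_def)
        fix g assume "g \<in> stab ys"
        then show "f ys (translate g xs) = f ys xs"
          using f_inv[OF _ ys xs, of g] by (auto simp: stab_def)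
      qed
      have f2: "cocycle G (Suc p) (f ys)"
        unfolding cocycle_def
      proof
        fix xs assume xs: "xs \<in> tups G (Suc (Suc p))"
        \<comment> \<open>The two differentials commute, and the total equation in the previous
          column turns the inner one into a multiple of \<open>cobd (B xs)\<close>, which the outer
          one kills.\<close>
        have "cobd (f ys) xs = cobd (\<lambda>zs. cobd (\<lambda>xs. B xs zs) xs) ys"
          unfolding f_def by (rule cobd_commute)
        also have "\<dots> = cobd (\<lambda>zs. - ((-1) ^ length xs) * cobd (B xs) zs) ys"
        proof (rule cobd_cong)
          fix zs assume "zs \<in> faces ys"
          then have "dtot B xs zs = 0"
            using Y_face[OF ys] xs p by (intro deqD[OF B(2)]) (auto simp: tups_def)
          then show "cobd (\<lambda>xs. B xs zs) xs = - ((-1) ^ length xs) * cobd (B xs) zs"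
            by (simp add: dtot_def)
        qed
        also have "\<dots> = 0" by (simp only: cobd_cmult cobd_cobd mult_zero_right)
        finally show "cobd (f ys) xs = 0" .
      qed
      obtain b where b: "cochain G (stab ys) p (\<rho> p (real (Suc j) * ?S j)) b" "primitive G p (f ys) b"
        by (rule exact_atE[OF * f1 f2])
      moreover have "\<rho> p (real (Suc j) * ?S j) \<le> ?S (Suc j)" using False by (simp add: p_def)
      ultimately show ?thesis by (blast intro: cochain_mono)
    qed
    then obtain b where b: "\<And>ys. ys \<in> Y \<Longrightarrow> primitive G p (f ys) (\<lambda>xs. b xs ys)"
      "\<And>ys xs. ys \<in> Y \<Longrightarrow> xs \<in> tups G p \<Longrightarrow> \<bar>b xs ys\<bar> \<le> ?S (Suc j)"
      "\<And>ys xs g. ys \<in> Y \<Longrightarrow> xs \<in> tups G p \<Longrightarrow> g \<in> G \<Longrightarrow> b (translate g xs) (acts g ys) = b xs ys"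
      using equivariant_primitives[of Y p "?S (Suc j)" f] f_inv X_act by (auto simp: Y_def)
    \<comment> \<open>In the total equation \<open>f ys\<close> appears with the sign (-1)^(p+1), as
      \<open>xs\<close> there has length p + 1; the factor makes the new column cancel it.\<close>
    define B' where "B' xs ys = (if length ys \<le> j then B xs ys else (-1) ^ p * b xs ys)" for xs ys
    have "dcochain (Suc n) (?S (Suc j)) (\<lambda>xs ys. length ys \<le> Suc j) B'"
    proof (rule dcochainI)
      fix xs ys assume *: "set xs \<subseteq> G" "ys \<in> X" "length xs + length ys = Suc n" "length ys \<le> Suc j"
      have Y: "ys \<in> Y" "xs \<in> tups G p" if "\<not> length ys \<le> j" using that * p by (auto simp: Y_def tups_def)
      show "\<bar>B' xs ys\<bar> \<le> ?S (Suc j)"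
        using dcochainD(1)[OF B(1) *(1-3)] b(2)[OF Y]
        by (auto simp: B'_def abs_mult le_max_iff_disj)
      fix g assume "g \<in> G"
      then show "B' (translate g xs) (acts g ys) = B' xs ys"
        using dcochainD(2)[OF B(1) *(1-3)] b(3)[OF Y] by (auto simp: B'_def)
    qed
    moreover have "deq (Suc (Suc n)) (\<lambda>xs ys. length ys \<le> Suc j) B' (\<lambda>_ _. 0)"
    proof (rule deqI)
      fix xs ys assume *: "set xs \<subseteq> G" "ys \<in> X" "length xs + length ys = Suc (Suc n)" "length ys \<le> Suc j"
      have 1: "cobd (B' xs) ys = cobd (B xs) ys"
        by (rule cobd_cong) (use *(4) length_faces in \<open>fastforce simp: B'_def\<close>)
      show "dtot B' xs ys = 0"
      proof (cases "length ys \<le> j")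
        case True
        then show ?thesis using 1 deqD[OF B(2) *(1-3)] by (simp add: dtot_def B'_def)
      next
        case False
        then have ys: "ys \<in> Y" "xs \<in> tups G (Suc p)" using * p by (auto simp: Y_def tups_def)
        have "cobd (\<lambda>xs. B' xs ys) xs = (-1) ^ p * f ys xs"
          using False primitiveD[OF b(1)[OF ys(1)] ys(2)] by (simp add: B'_def cobd_cmult)
        then show ?thesis using 1 tups_length[OF ys(2)] by (simp add: dtot_def f_def)
      qed
    qed
    moreover have "\<forall>xs\<in>tups G (Suc n). B' xs [] = c xs" using B(3) by (simp add: B'_def)
    ultimately show ?case by blast
  qed
  from this[of "Suc n"] obtain B where B: "dcochain (Suc n) (?S (Suc n)) (\<lambda>xs ys. length ys \<le> Suc n) B"
    "deq (Suc (Suc n)) (\<lambda>xs ys. length ys \<le> Suc n) B (\<lambda>_ _. 0)"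
    "\<And>xs. xs \<in> tups G (Suc n) \<Longrightarrow> B xs [] = c xs"
    by auto
  \<comment> \<open>The corner \<open>xs = []\<close> with n + 2 vertices lies beyond the
    constructed columns. There \<open>B []\<close> is itself a coboundary, by the total equation at
    the one-entry tuple \<open>[0]\<close>.\<close>
  have last: "dtot B [] ys = 0" if ys: "ys \<in> X" "length ys = Suc (Suc n)" for ys
  proof -
    have "cobd (B []) ys = cobd (cobd (B [0])) ys"
    proof (rule cobd_cong)
      fix zs assume zs: "zs \<in> faces ys"
      have "dtot B [0] zs = 0"
        using zs length_faces[OF zs] X_faces[OF ys(1) zs] ys(2) subgrp_0[OF G]
        by (intro deqD[OF B(2)]) auto
      then show "B [] zs = cobd (B [0]) zs" by (simp add: dtot_def)
    qed
    then show ?thesis by (simp add: dtot_def cobd_cobd)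
  qed
  show ?thesis
  proof (rule that[of B])
    show "dcochain (Suc n) (?S (Suc n)) (\<lambda>_ _. True) B"
      by (rule dcochainI) (use B(1) in \<open>auto simp: dcochain_def simp del: stair_bound.simps\<close>)
    show "deq (Suc (Suc n)) (\<lambda>_ _. True) B (\<lambda>_ _. 0)"
    proof (rule deqI)
      fix xs ys assume *: "set xs \<subseteq> G" "ys \<in> X" "length xs + length ys = Suc (Suc n)"
      show "dtot B xs ys = 0"
      proof (cases "length ys \<le> Suc n")
        case True
        then show ?thesis using deqD[OF B(2) *] by simp
      next
        case False
        then have "length xs = 0" "length ys = Suc (Suc n)" using *(3) by linarith+
        then show ?thesis using last[of ys] * by simp
      qed
    qed
  qed (rule B(3))
qed

text \<open>If the row \<open>xs = []\<close> of a total cocycle is a coboundary, then so is its column \<open>ys = []\<close>: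
  the rows are exact, as a cone over \<open>ys\<close> is formed with the vertices \<open>v k\<close>, which are eventually
  in general position to \<open>ys\<close>. The apex is moved along with the first entry of \<open>xs\<close> to make the
  construction equivariant.\<close>

lemma collapse:
  assumes B: "dcochain (Suc n) M (\<lambda>_ _. True) B" "deq (Suc (Suc n)) (\<lambda>_ _. True) B (\<lambda>_ _. 0)"
    and w: "\<And>ys. ys \<in> X \<Longrightarrow> length ys = n \<Longrightarrow> \<bar>w ys\<bar> \<le> M'"
      "\<And>ys g. ys \<in> X \<Longrightarrow> length ys = n \<Longrightarrow> g \<in> G \<Longrightarrow> w (acts g ys) = w ys"
      "\<And>ys. ys \<in> X \<Longrightarrow> length ys = Suc n \<Longrightarrow> B [] ys = cobd w ys"
    and U: "ultra U"
    and v: "\<And>ys g. ys \<in> X \<Longrightarrow> g \<in> G \<Longrightarrow> eventually (\<lambda>k. act g (v k) # ys \<in> X) U"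
  obtains b where "cochain G G n (collapse_bound M M' (Suc n)) b" "primitive G n (\<lambda>xs. B xs []) b"
proof -
  let ?S = "collapse_bound M M'"
  have Unb: "U \<noteq> bot" using U by (simp add: ultra_def)
  have "\<exists>A. dcochain n (?S j) (\<lambda>xs ys. length xs \<le> j) A
      \<and> deq (Suc n) (\<lambda>xs ys. length xs \<le> j) A B" for j
  proof (induction j)
    case 0
    have "dcochain n M' (\<lambda>xs ys. length xs \<le> 0) (\<lambda>xs ys. w ys)"
      by (rule dcochainI) (use w in auto)
    moreover have "deq (Suc n) (\<lambda>xs ys. length xs \<le> 0) (\<lambda>xs ys. w ys) B"
      by (rule deqI) (use w(3) in \<open>auto simp: dtot_def\<close>)
    ultimately show ?case by (intro exI[of _ "\<lambda>xs ys. w ys"]) simp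
  next
    case (Suc j)
    then obtain A where A: "dcochain n (?S j) (\<lambda>xs ys. length xs \<le> j) A"
      "deq (Suc n) (\<lambda>xs ys. length xs \<le> j) A B"
      by blast
    \<comment> \<open>\<open>E\<close> is what the rows built so far leave of \<open>B\<close>. It
      is closed in \<open>ys\<close>, and up to sign the next row has to be a primitive of it in
      that direction.\<close>
    define E where "E xs ys = B xs ys - cobd (\<lambda>xs. A xs ys) xs" for xs ys
    have xs_face: "set zs \<subseteq> G \<and> length zs = j"
      if "set xs \<subseteq> G" "length xs = Suc j" "zs \<in> faces xs" for xs zs
      using length_faces[OF that(3)] set_faces[OF that(3)] that by auto
    have E_bound: "\<bar>E xs ys\<bar> \<le> M + real (Suc j) * ?S j"
      if *: "set xs \<subseteq> G" "ys \<in> X" "length xs = Suc j" "length xs + length ys = Suc n" for xs ys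
    proof -
      have "\<bar>cobd (\<lambda>xs. A xs ys) xs\<bar> \<le> real (length xs) * ?S j"
        by (rule abs_cobd_le, rule dcochainD(1)[OF A(1)]) (use * xs_face[OF *(1,3)] in auto)
      then show ?thesis using dcochainD(1)[OF B(1) *(1,2,4)] *(3) by (simp add: E_def)
    qed
    have E_inv: "E (translate g xs) (acts g ys) = E xs ys"
      if *: "set xs \<subseteq> G" "ys \<in> X" "length xs = Suc j" "length xs + length ys = Suc n" "g \<in> G" for xs ys g
    proof -
      have "cobd (\<lambda>xs. A xs (acts g ys)) (translate g xs) = cobd (\<lambda>xs. A xs ys) xs"
        unfolding cobd_map
        by (rule cobd_cong, rule dcochainD(2)[OF A(1)]) (use * xs_face[OF *(1,3)] in auto)
      then show ?thesis using dcochainD(2)[OF B(1) *(1,2,4)] *(5) by (simp add: E_def)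
    qed
    have E_closed: "cobd (E xs) ys = 0"
      if *: "set xs \<subseteq> G" "ys \<in> X" "length xs = Suc j" "length xs + length ys = Suc (Suc n)" for xs ys
    proof -
      have "cobd (\<lambda>ys. cobd (\<lambda>xs. A xs ys) xs) ys = cobd (\<lambda>xs. cobd (A xs) ys) xs"
        by (rule cobd_commute[symmetric])
      also have "\<dots> = cobd (\<lambda>xs. (-1) ^ j * (B xs ys - cobd (\<lambda>xs. A xs ys) xs)) xs"
      proof (rule cobd_cong)
        fix zs assume zs: "zs \<in> faces xs"
        have "dtot A zs ys = B zs ys"
          by (rule deqD[OF A(2)]) (use * xs_face[OF *(1,3) zs] in auto)
        then show "cobd (A zs) ys = (-1) ^ j * (B zs ys - cobd (\<lambda>xs. A xs ys) zs)"
          using xs_face[OF *(1,3) zs] by (cases "even j") (auto simp: dtot_def)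
      qed
      also have "\<dots> = (-1) ^ j * cobd (\<lambda>xs. B xs ys) xs"
        by (simp only: cobd_cmult cobd_diff cobd_cobd) simp
      finally have "cobd (E xs) ys = cobd (B xs) ys - (-1) ^ j * cobd (\<lambda>xs. B xs ys) xs"
        unfolding E_def[abs_def] cobd_diff by simp
      moreover have "dtot B xs ys = 0" using deqD[OF B(2) *(1,2,4)] by simp
      ultimately show ?thesis using *(3) by (cases "even j") (auto simp: dtot_def)
    qed
    \<comment> \<open>The cone with apex \<open>act (hd xs) (v k)\<close> makes sense only
      eventually in \<open>k\<close>, with a threshold depending on \<open>ys\<close>. The
      ultralimit removes the choice of \<open>k\<close> and keeps the bound and the
      equivariance.\<close>
    define L where "L xs ys = Lim U (\<lambda>k. E xs (act (hd xs) (v k) # ys))" for xs ys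
    have L: "((\<lambda>k. E xs (act (hd xs) (v k) # ys)) \<longlongrightarrow> L xs ys) U \<and> \<bar>L xs ys\<bar> \<le> M + real (Suc j) * ?S j"
      if *: "set xs \<subseteq> G" "ys \<in> X" "length xs = Suc j" "length xs + length ys = n" for xs ys
    proof -
      have hd: "hd xs \<in> G" using *(1,3) by (cases xs) auto
      have "eventually (\<lambda>k. \<bar>E xs (act (hd xs) (v k) # ys)\<bar> \<le> M + real (Suc j) * ?S j) U"
        using v[OF *(2) hd] by eventually_elim (rule E_bound; use * in simp)
      then obtain l where l: "((\<lambda>k. E xs (act (hd xs) (v k) # ys)) \<longlongrightarrow> l) U"
          "\<bar>l\<bar> \<le> M + real (Suc j) * ?S j"
        by (rule ultra_convergent[OF U])
      moreover have "L xs ys = l" unfolding L_def by (rule tendsto_Lim[OF Unb l(1)])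
      ultimately show ?thesis by simp
    qed
    have cobd_L: "cobd (L xs) ys = E xs ys"
      if *: "set xs \<subseteq> G" "ys \<in> X" "length xs = Suc j" "length xs + length ys = Suc n" for xs ys
    proof -
      have hd: "hd xs \<in> G" using *(1,3) by (cases xs) auto
      have 1: "((\<lambda>k. cobd (\<lambda>ys. E xs (act (hd xs) (v k) # ys)) ys) \<longlongrightarrow> cobd (L xs) ys) U"
        by (rule tendsto_cobd, rule conjunct1[OF L])
          (use * X_faces length_faces in \<open>auto dest: length_faces\<close>)
      have 2: "eventually (\<lambda>k. cobd (\<lambda>ys. E xs (act (hd xs) (v k) # ys)) ys = E xs ys) U"
        using v[OF *(2) hd]
      proof eventually_elim
        case (elim k)
        have "cobd (E xs) (act (hd xs) (v k) # ys) = 0"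
          by (rule E_closed) (use * elim in auto)
        then show ?case by simp
      qed
      have "((\<lambda>k. E xs ys) \<longlongrightarrow> cobd (L xs) ys) U"
        by (rule Lim_transform_eventually[OF 1 2])
      then show ?thesis using tendsto_unique[OF Unb tendsto_const] by metis
    qed
    \<comment> \<open>Here \<open>length xs = Suc j\<close>, so the sign cancels the one in
      \<open>dtot\<close> and the new row contributes exactly \<open>E\<close>.\<close>
    define A' where "A' xs ys = (if length xs \<le> j then A xs ys else (-1) ^ Suc j * L xs ys)" for xs ys
    have "dcochain n (?S (Suc j)) (\<lambda>xs ys. length xs \<le> Suc j) A'"
    proof (rule dcochainI)
      fix xs ys assume *: "set xs \<subseteq> G" "ys \<in> X" "length xs + length ys = n" "length xs \<le> Suc j"
      have len: "length xs = Suc j" if "\<not> length xs \<le> j" using that * by simp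
      show "\<bar>A' xs ys\<bar> \<le> ?S (Suc j)"
        using dcochainD(1)[OF A(1) *(1-3)] L[OF *(1,2) len *(3)]
        by (auto simp: A'_def abs_mult le_max_iff_disj)
      fix g assume g: "g \<in> G"
      show "A' (translate g xs) (acts g ys) = A' xs ys"
      proof (cases "length xs \<le> j")
        case True
        then show ?thesis using dcochainD(2)[OF A(1) *(1-3)] g by (simp add: A'_def)
      next
        case False
        then have len: "length xs = Suc j" and "xs \<noteq> []" using * by auto
        have hd: "hd xs \<in> G" using *(1) \<open>xs \<noteq> []\<close> by (cases xs) auto
        have gxs: "set (translate g xs) \<subseteq> G" using * g G by (auto simp: subgrp_add)
        have 1: "((\<lambda>k. E (translate g xs) (act (hd (translate g xs)) (v k) # acts g ys))
            \<longlongrightarrow> L (translate g xs) (acts g ys)) U"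
          by (rule conjunct1[OF L]) (use gxs X_act[OF g *(2)] len * in auto)
        have 2: "eventually (\<lambda>k. E (translate g xs) (act (hd (translate g xs)) (v k) # acts g ys)
            = E xs (act (hd xs) (v k) # ys)) U"
          using v[OF *(2) hd]
        proof eventually_elim
          case (elim k)
          show ?case using E_inv[OF *(1) elim len _ g] * \<open>xs \<noteq> []\<close> by (simp add: hd_map act_add)
        qed
        have "((\<lambda>k. E xs (act (hd xs) (v k) # ys)) \<longlongrightarrow> L (translate g xs) (acts g ys)) U"
          by (rule Lim_transform_eventually[OF 1 2])
        then have "L (translate g xs) (acts g ys) = L xs ys"
          using tendsto_unique[OF Unb] L[OF *(1,2) len *(3)] by blast
        then show ?thesis using False by (simp add: A'_def)
      qed
    qed
    moreover have "deq (Suc n) (\<lambda>xs ys. length xs \<le> Suc j) A' B"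
    proof (rule deqI)
      fix xs ys assume *: "set xs \<subseteq> G" "ys \<in> X" "length xs + length ys = Suc n" "length xs \<le> Suc j"
      have 1: "cobd (\<lambda>xs. A' xs ys) xs = cobd (\<lambda>xs. A xs ys) xs"
        by (rule cobd_cong) (use *(4) length_faces in \<open>fastforce simp: A'_def\<close>)
      show "dtot A' xs ys = B xs ys"
      proof (cases "length xs \<le> j")
        case True
        then have "A' xs = A xs" by (simp add: A'_def fun_eq_iff)
        then show ?thesis using 1 deqD[OF A(2) *(1-3)] True by (simp add: dtot_def)
      next
        case False
        then have len: "length xs = Suc j" using *(4) by simp
        have "cobd (A' xs) ys = (-1) ^ Suc j * E xs ys"
          using False cobd_L[OF *(1,2) len *(3)] unfolding A'_def[abs_def]
          by (simp only: if_False cobd_cmult)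
        then show ?thesis using 1 len by (cases "even j") (auto simp: dtot_def E_def)
      qed
    qed
    ultimately show ?case by blast
  qed
  from this[of "Suc n"] obtain A where A: "dcochain n (?S (Suc n)) (\<lambda>xs ys. length xs \<le> Suc n) A"
      "deq (Suc n) (\<lambda>xs ys. length xs \<le> Suc n) A B"
    by blast
  show ?thesis
  proof (rule that[of "\<lambda>xs. A xs []"])
    show "cochain G G n (?S (Suc n)) (\<lambda>xs. A xs [])"
      by (rule cochainI)
        (use dcochainD[OF A(1) _ X_Nil] in \<open>auto simp: tups_def simp del: collapse_bound.simps\<close>)
    show "primitive G n (\<lambda>xs. B xs []) (\<lambda>xs. A xs [])"
      by (rule primitiveI) (use deqD[OF A(2) _ X_Nil] in \<open>auto simp: tups_def dtot_def\<close>)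
  qed
qed

end

text \<open>Serves to move exactness between isomorphic groups that live in different types.\<close>

lemma exact_at_transfer:
  assumes ex: "exact_at H H p M R"
    and \<phi>: "\<And>x. x \<in> N \<Longrightarrow> \<phi> x \<in> H" "\<And>g x. g \<in> N \<Longrightarrow> x \<in> N \<Longrightarrow> \<phi> (g + x) = \<phi> g + \<phi> x"
    and \<psi>: "\<And>y. y \<in> H \<Longrightarrow> \<psi> y \<in> N" "\<And>h y. h \<in> H \<Longrightarrow> y \<in> H \<Longrightarrow> \<psi> (h + y) = \<psi> h + \<psi> y"
    and inv: "\<And>x. x \<in> N \<Longrightarrow> \<psi> (\<phi> x) = x"
  shows "exact_at N N p M R"
  unfolding exact_at_def
proof (intro allI impI)
  fix f assume f: "cochain N N (Suc p) M f" "cocycle N (Suc p) f"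
  have "cochain H H (Suc p) M (\<lambda>xs. f (map \<psi> xs))"
  proof (rule cochainI)
    fix xs assume xs: "xs \<in> tups H (Suc p)"
    show "\<bar>f (map \<psi> xs)\<bar> \<le> M" by (rule cochain_le[OF f(1) map_tups[OF xs \<psi>(1)]])
    fix g assume g: "g \<in> H"
    show "f (map \<psi> (translate g xs)) = f (map \<psi> xs)"
      by (subst map_translate[where h = \<psi>, OF \<psi>(2) g xs]) (assumption+, rule cochain_inv[OF f(1) \<psi>(1)[OF g] map_tups[OF xs \<psi>(1)]])
  qed
  moreover have "cocycle H (Suc p) (\<lambda>xs. f (map \<psi> xs))"
    by (simp add: cocycle_def cobd_map[symmetric] cocycleD[OF f(2)] map_tups[OF _ \<psi>(1)])
  ultimately obtain b where b: "cochain H H p R b" "primitive H p (\<lambda>xs. f (map \<psi> xs)) b"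
    by (rule exact_atE[OF ex])
  have "cochain N N p R (\<lambda>xs. b (map \<phi> xs))"
  proof (rule cochainI)
    fix xs assume xs: "xs \<in> tups N p"
    show "\<bar>b (map \<phi> xs)\<bar> \<le> R" by (rule cochain_le[OF b(1) map_tups[OF xs \<phi>(1)]])
    fix g assume g: "g \<in> N"
    show "b (map \<phi> (translate g xs)) = b (map \<phi> xs)"
      by (subst map_translate[where h = \<phi>, OF \<phi>(2) g xs]) (assumption+, rule cochain_inv[OF b(1) \<phi>(1)[OF g] map_tups[OF xs \<phi>(1)]])
  qed
  moreover have "primitive N p f (\<lambda>xs. b (map \<phi> xs))"
  proof (rule primitiveI)
    fix xs assume xs: "xs \<in> tups N (Suc p)"
    have "map \<psi> (map \<phi> xs) = xs" using xs inv by (auto simp: tups_def intro!: map_idI)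
    then show "cobd (\<lambda>xs. b (map \<phi> xs)) xs = f xs"
      using primitiveD[OF b(2) map_tups[OF xs \<phi>(1)]] by (simp add: cobd_map)
  qed
  ultimately show "\<exists>b. cochain N N p R b \<and> primitive N p f b" by blast
qed

text \<open>For odd \<open>n\<close> the coboundary on tuples of length n + 2 is \<kappa> itself, so
  the cocycle condition forces it to vanish; for even \<open>n\<close> the constant is its own
  primitive.\<close>

lemma constant_cocycle:
  assumes "G \<noteq> {}" "cocycle G (Suc n) (\<lambda>_. \<kappa>)"
  shows "primitive G n (\<lambda>_. \<kappa>) (\<lambda>_. \<kappa>)"
proof -
  obtain x where "x \<in> G" using assms by blast
  then have "replicate (Suc (Suc n)) x \<in> tups G (Suc (Suc n))" by (auto simp: tups_def)
  from cocycleD[OF assms(2) this] have "odd n \<Longrightarrow> \<kappa> = 0" by (simp add: cobd_const split: if_splits)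
  then show ?thesis by (auto simp: primitive_def cobd_const tups_def)
qed

section \<open>Mitosis\<close>

text \<open>The summands bound the prism for the conjugation by \<open>t\<close>, the constant
  \<open>\<kappa>\<close>, and the primitive from the double complex. There \<open>2 * M\<close>
  bounds a difference of two pullbacks of \<open>c\<close>, \<open>real n * (2 * M)\<close> is the
  cost of extending the zero primitive from the stabiliser, and the factor in front of
  \<open>stair_bound\<close> comes from a second difference.\<close>

definition mitosis_bound :: "(nat \<Rightarrow> real \<Rightarrow> real) \<Rightarrow> nat \<Rightarrow> real \<Rightarrow> real" where
  "mitosis_bound \<rho> n M = real n * M + M + collapse_bound
    (2 * stair_bound (\<lambda>p M. if p = 0 then M else \<rho> p M + real p * M) n (2 * M) (real n * (2 * M)) (Suc n))
    0 (Suc n)"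

text \<open>The homomorphism \<open>h \<mapsto> h + d h\<close> is conjugate to \<open>d\<close>. In low degrees the acyclicity of \<open>H\<close>
  makes pulling back along \<open>(h, k) \<mapsto> h + d k\<close> additive in the two factors, up to coboundaries;
  comparing the diagonal with the second factor shows that the first factor contributes
  nothing.\<close>

lemma mitosis:
  fixes H W :: "'g::group_add set" and d :: "'g \<Rightarrow> 'g"
  assumes H: "subgrp H" and W: "subgrp W" and HW: "H \<subseteq> W"
    and d: "\<And>h. h \<in> H \<Longrightarrow> d h \<in> W" "\<And>h k. h \<in> H \<Longrightarrow> k \<in> H \<Longrightarrow> d (h + k) = d h + d k"
    and comm: "\<And>h k. h \<in> H \<Longrightarrow> k \<in> H \<Longrightarrow> d k + h = h + d k"
    and t: "t \<in> W" "\<And>h. h \<in> H \<Longrightarrow> - t + d h + t = h + d h"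
    and ex: "\<And>p M. 1 \<le> p \<Longrightarrow> p < n \<Longrightarrow> exact_at H H p M (\<rho> p M)"
    and c: "cochain W W (Suc n) M c" "cocycle W (Suc n) c"
  obtains b where "cochain H H n (mitosis_bound \<rho> n M) b" "primitive H n c b"
proof -
  let ?\<rho> = "\<lambda>p M. if p = 0 then M else \<rho> p M + real p * M"
  define HH where "HH = H \<times> H"
  define N :: "('g \<times> 'g) set" where "N = {0} \<times> H"
  have HH: "subgrp HH" using H by (auto simp: HH_def subgrp_def zero_prod_def)
  have N: "subgrp N" using H by (auto simp: N_def subgrp_def zero_prod_def)
  have NHH: "N \<subseteq> HH" using subgrp_0[OF H] by (auto simp: HH_def N_def)
  have d0: "d 0 = 0" using d(2)[of 0 0] subgrp_0[OF H] by (metis add_0_right add_left_cancel)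
  \<comment> \<open>The product acts on tuples over \<open>H\<close> through its first factor, so
    every nonempty tuple has the stabiliser \<open>N\<close>, a copy of \<open>H\<close>.\<close>
  interpret P: complex_action HH "lists H" "\<lambda>p y. fst p + y"
    by standard (use HH H in \<open>auto simp: HH_def subgrp_add add.assoc dest!: set_faces\<close>)
  interpret Q: complex_action H "lists H" "(+)"
    by standard (use H in \<open>auto simp: subgrp_add add.assoc dest!: set_faces\<close>)
  have cancel: "a + b = b \<Longrightarrow> a = 0" for a b :: 'g by (metis add_0_left add_right_cancel)
  have stab: "P.stab ys = N" if "ys \<noteq> []" for ys
  proof
    show "P.stab ys \<subseteq> N" unfolding P.stab_def using that by (cases ys) (auto simp: HH_def N_def dest: cancel)
    show "N \<subseteq> P.stab ys" using NHH by (auto simp: P.stab_def N_def intro!: map_idI)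
  qed
  have exN: "exact_at HH N p M (?\<rho> p M)" if "p < n" for p M
  proof (cases "p = 0")
    case True
    then show ?thesis using exact_at_0[OF HH] by simp
  next
    case False
    have "exact_at N N p M (\<rho> p M)"
      by (rule exact_at_transfer[OF ex, where \<phi> = snd and \<psi> = "Pair 0"])
        (use False that in \<open>auto simp: N_def\<close>)
    from exact_at_extend[OF N HH NHH this] show ?thesis using False by simp
  qed
  define m where "m p = fst p + d (snd p)" for p
  have m: "m p \<in> W" if "p \<in> HH" for p
    using that d(1) HW W by (auto simp: m_def HH_def subgrp_add)
  have dsnd: "d (snd p) \<in> W" if "p \<in> HH" for p using that d(1) by (auto simp: HH_def)
  have m_add: "m (p + q) = m p + m q" if "p \<in> HH" "q \<in> HH" for p q
  proof -
    have "m (p + q) = fst p + (fst q + d (snd p)) + d (snd q)"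
      using that d(2) by (auto simp: m_def HH_def add.assoc)
    also have "\<dots> = fst p + (d (snd p) + fst q) + d (snd q)"
      using that comm by (auto simp: HH_def)
    finally show ?thesis by (simp add: m_def add.assoc)
  qed
  \<comment> \<open>Exactness for \<open>N\<close> is available only below degree \<open>n\<close>.
    Subtracting the pullback through the second factor makes the cocycle vanish identically on
    \<open>N\<close>, so the staircase can start in degree \<open>n\<close> from the primitive
    0.\<close>
  define \<gamma> where "\<gamma> xs = c (map m xs) - c (map (\<lambda>p. d (snd p)) xs)" for xs
  have \<gamma>1: "cochain HH HH (Suc n) (2 * M) \<gamma>"
  proof (rule cochainI)
    fix xs assume xs: "xs \<in> tups HH (Suc n)"
    have mx: "map m xs \<in> tups W (Suc n)" by (rule map_tups[OF xs m])
    have dx: "map (\<lambda>p. d (snd p)) xs \<in> tups W (Suc n)" by (rule map_tups[OF xs dsnd])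
    show "\<bar>\<gamma> xs\<bar> \<le> 2 * M"
      using cochain_le[OF c(1) mx] cochain_le[OF c(1) dx]
      by (simp add: \<gamma>_def)
    fix g assume g: "g \<in> HH"
    have "map m (translate g xs) = translate (m g) (map m xs)"
      by (rule map_translate[where h = m, OF m_add g xs])
    moreover have "map (\<lambda>p. d (snd p)) (translate g xs) = translate (d (snd g)) (map (\<lambda>p. d (snd p)) xs)"
      using xs g d(2) by (force simp: tups_def HH_def)
    ultimately show "\<gamma> (translate g xs) = \<gamma> xs"
      using cochain_inv[OF c(1) m[OF g] mx]
        cochain_inv[OF c(1) dsnd[OF g] dx] by (simp only: \<gamma>_def)
  qed
  have \<gamma>2: "cocycle HH (Suc n) \<gamma>"
    unfolding cocycle_def
  proof
    fix xs assume xs: "xs \<in> tups HH (Suc (Suc n))"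
    have "map m xs \<in> tups W (Suc (Suc n))" by (rule map_tups[OF xs m])
    moreover have "map (\<lambda>p. d (snd p)) xs \<in> tups W (Suc (Suc n))" by (rule map_tups[OF xs dsnd])
    ultimately show "cobd \<gamma> xs = 0"
      unfolding \<gamma>_def[abs_def] cobd_diff cobd_map[symmetric] using cocycleD[OF c(2)] by simp
  qed
  have "cochain N N n 0 (\<lambda>_. 0)" by (rule cochainI) auto
  moreover have "primitive N n \<gamma> (\<lambda>_. 0)"
  proof (rule primitiveI)
    fix xs assume "xs \<in> tups N (Suc n)"
    then have "map m xs = map (\<lambda>p. d (snd p)) xs" by (auto simp: tups_def N_def m_def)
    then show "cobd (\<lambda>_. 0) xs = \<gamma> xs" by (simp only: \<gamma>_def cobd_0 diff_self)
  qed
  ultimately obtain b0 where b0: "cochain HH N n (0 + real n * (2 * M)) b0" "primitive HH n \<gamma> b0"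
    by (rule primitive_extend[OF N HH NHH cochain_subset[OF \<gamma>1 order_refl NHH] \<gamma>2])
  define S where "S = stair_bound ?\<rho> n (2 * M) (real n * (2 * M)) (Suc n)"
  obtain B where B: "P.dcochain (Suc n) S (\<lambda>_ _. True) B"
    "P.deq (Suc (Suc n)) (\<lambda>_ _. True) B (\<lambda>_ _. 0)"
    "\<And>xs. xs \<in> tups HH (Suc n) \<Longrightarrow> B xs [] = \<gamma> xs"
  proof (rule P.staircase[OF \<gamma>1 \<gamma>2, where \<rho> = ?\<rho> and R = "real n * (2 * M)", folded S_def])
    show "\<exists>b. cochain HH (P.stab [y]) n (real n * (2 * M)) b \<and> primitive HH n \<gamma> b" for y
      using b0 by (auto simp: stab)
    show "exact_at HH (P.stab ys) p M (?\<rho> p M)" if "2 \<le> length ys" "p + length ys = Suc n" for ys p M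
    proof -
      have ys: "ys \<noteq> []" and p: "p < n" using that by auto
      show ?thesis unfolding stab[OF ys] by (rule exN[OF p])
    qed
  qed blast
  \<comment> \<open>The diagonal and the inclusion of the first factor have the same first
    coordinate. Both pullbacks therefore live over the same action of \<open>H\<close> on tuples,
    and they coincide in the row \<open>hs = []\<close>.\<close>
  define B' where "B' hs ys = B (map (\<lambda>h. (h, h)) hs) ys - B (map (\<lambda>h. (h, 0)) hs) ys" for hs ys
  have diag: "set (map (\<lambda>h. (h, h)) hs) \<subseteq> HH" "set (map (\<lambda>h. (h, 0)) hs) \<subseteq> HH" if "set hs \<subseteq> H" for hs
    using that subgrp_0[OF H] by (auto simp: HH_def)
  have B'1: "Q.dcochain (Suc n) (2 * S) (\<lambda>_ _. True) B'"
  proof (rule Q.dcochainI)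
    fix hs ys assume *: "set hs \<subseteq> H" "ys \<in> lists H" "length hs + length ys = Suc n"
    show "\<bar>B' hs ys\<bar> \<le> 2 * S"
      using P.dcochainD(1)[OF B(1) diag(1)[OF *(1)] *(2)] P.dcochainD(1)[OF B(1) diag(2)[OF *(1)] *(2)] *(3)
      by (simp add: B'_def)
    fix g assume g: "g \<in> H"
    have "(g, g) \<in> HH" "(g, 0) \<in> HH" using g subgrp_0[OF H] by (auto simp: HH_def)
    then show "B' (translate g hs) (translate g ys) = B' hs ys"
      using P.dcochainD(2)[OF B(1) diag(1)[OF *(1)] *(2), of "(g, g)"]
        P.dcochainD(2)[OF B(1) diag(2)[OF *(1)] *(2), of "(g, 0)"] *(3)
      by (simp add: B'_def comp_def)
  qed
  have B'2: "Q.deq (Suc (Suc n)) (\<lambda>_ _. True) B' (\<lambda>_ _. 0)"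
  proof (rule Q.deqI)
    fix hs ys assume *: "set hs \<subseteq> H" "ys \<in> lists H" "length hs + length ys = Suc (Suc n)"
    have "dtot B' hs ys = dtot B (map (\<lambda>h. (h, h)) hs) ys - dtot B (map (\<lambda>h. (h, 0)) hs) ys"
      by (simp add: dtot_def B'_def[abs_def] cobd_diff cobd_map algebra_simps)
    then show "dtot B' hs ys = 0"
      using P.deqD[OF B(2) diag(1)[OF *(1)] *(2)] P.deqD[OF B(2) diag(2)[OF *(1)] *(2)] *(3) by simp
  qed
  \<comment> \<open>Every tuple over \<open>H\<close> is a simplex, so the constant apex 0 serves
    and any ultrafilter will do.\<close>
  obtain U :: "nat filter" where U: "ultra U"
    using ex_ultra[OF sequentially_bot] by blast
  obtain b1 where b1: "cochain H H n (collapse_bound (2 * S) 0 (Suc n)) b1"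
      "primitive H n (\<lambda>hs. B' hs []) b1"
    by (rule Q.collapse[OF B'1 B'2 _ _ _ U, where w = "\<lambda>_. 0" and v = "\<lambda>_. 0" and M' = 0])
      (use H in \<open>auto simp: B'_def\<close>)
  define \<kappa> where "\<kappa> = c (replicate (Suc n) 0)"
  \<comment> \<open>Along the inclusion \<open>\<gamma>\<close> becomes \<open>c\<close> minus
    \<open>\<kappa>\<close>. Along the diagonal it becomes a difference of two pullbacks of
    \<open>c\<close> that the prism for right translation by \<open>t\<close> integrates.
    \<open>b1\<close> integrates diagonal minus inclusion, so solving for \<open>c\<close> gives
    this combination.\<close>
  define b where "b hs = prism (\<lambda>x. x + t) c (map d hs) - b1 hs + \<kappa>" for hs
  have tW: "x + t \<in> W" if "x \<in> W" for x using that t(1) W by (simp add: subgrp_add)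
  have "cocycle H (Suc n) (\<lambda>_. \<kappa>)"
    unfolding cocycle_def
  proof
    fix xs assume "xs \<in> tups H (Suc (Suc n))"
    then have len: "length xs = Suc (Suc n)" by (rule tups_length)
    have "cobd (\<lambda>_. \<kappa>) xs = cobd (\<lambda>ys. c (map (\<lambda>_. 0) ys)) xs"
      by (rule cobd_cong) (use len in \<open>auto simp: \<kappa>_def map_replicate_const dest!: length_faces\<close>)
    also have "\<dots> = cobd c (map (\<lambda>_. 0) xs)" by (rule cobd_map[symmetric])
    also have "\<dots> = 0" by (rule cocycleD[OF c(2)]) (use len W in \<open>auto simp: tups_def subgrp_0\<close>)
    finally show "cobd (\<lambda>_. \<kappa>) xs = 0" .
  qed
  then have \<kappa>: "primitive H n (\<lambda>_. \<kappa>) (\<lambda>_. \<kappa>)"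
    using subgrp_0[OF H] by (intro constant_cocycle) auto
  show ?thesis
  proof (rule that[of b])
    show "cochain H H n (mitosis_bound \<rho> n M) b"
    proof (rule cochainI)
      fix xs assume xs: "xs \<in> tups H n"
      have "\<bar>prism (\<lambda>x. x + t) c (map d xs)\<bar> \<le> real n * M"
        by (rule abs_prism_le[OF map_tups[OF xs d(1)] tW cochain_le[OF c(1)]])
      moreover have "\<bar>\<kappa>\<bar> \<le> M" unfolding \<kappa>_def
        by (rule cochain_le[OF c(1)]) (use W in \<open>auto simp: tups_def subgrp_0\<close>)
      ultimately show "\<bar>b xs\<bar> \<le> mitosis_bound \<rho> n M"
        using cochain_le[OF b1(1) xs] unfolding b_def mitosis_bound_def S_def[symmetric] by linarith
      fix g assume g: "g \<in> H"
      have "map d (translate g xs) = translate (d g) (map d xs)"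
        by (rule map_translate[where h = d, OF d(2) g xs])
      then have "prism (\<lambda>x. x + t) c (map d (translate g xs))
          = prism (\<lambda>x. x + t) (\<lambda>ys. c (translate (d g) ys)) (map d xs)"
        by (simp only:) (rule prism_map, simp add: add.assoc)
      also have "\<dots> = prism (\<lambda>x. x + t) c (map d xs)"
        by (rule prism_cong[OF map_tups[OF xs d(1)] tW cochain_inv[OF c(1) d(1)[OF g]]])
      finally show "b (translate g xs) = b xs"
        using cochain_inv[OF b1(1) g xs] by (simp add: b_def)
    qed
    show "primitive H n c b"
    proof (rule primitiveI)
      fix hs assume hs: "hs \<in> tups H (Suc n)"
      then have hsH: "set hs \<subseteq> H" by (simp add: tups_def)
      let ?i = "\<lambda>h. (h, 0::'g)" and ?\<Delta> = "\<lambda>h::'g. (h, h)"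
      have zs: "map d hs \<in> tups W (Suc n)" by (rule map_tups[OF hs d(1)])
      have zst: "map (\<lambda>x. x + t) (map d hs) \<in> tups W (Suc n)" by (rule map_tups[OF zs tW])
      have "prism (\<lambda>x. x + t) (cobd c) (map d hs) = prism (\<lambda>x. x + t) (\<lambda>_. 0) (map d hs)"
        by (rule prism_cong[OF zs tW cocycleD[OF c(2)]])
      also have "\<dots> = 0" using prism_diff[of _ c c] by simp
      finally have 1: "cobd (\<lambda>hs. prism (\<lambda>x. x + t) c (map d hs)) hs
          = c (map (\<lambda>x. x + t) (map d hs)) - c (map d hs)"
        using cobd_prism[of "\<lambda>x. x + t" c "map d hs"] by (simp add: cobd_map)
      \<comment> \<open>The conjugation by \<open>t\<close> is split: invariance of \<open>c\<close>
        absorbs the left translation by \<open>- t\<close>, and only the right translation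
        remains.\<close>
      have "map m (map ?\<Delta> hs) = translate (- t) (map (\<lambda>x. x + t) (map d hs))"
        using hsH t(2) by (auto simp: m_def add.assoc)
      then have "c (map m (map ?\<Delta> hs)) = c (map (\<lambda>x. x + t) (map d hs))"
        by (simp only: cochain_inv[OF c(1) subgrp_minus[OF W t(1)] zst])
      then have 2: "\<gamma> (map ?\<Delta> hs) = c (map (\<lambda>x. x + t) (map d hs)) - c (map d hs)"
        by (simp add: \<gamma>_def comp_def)
      have 3: "\<gamma> (map ?i hs) = c hs - \<kappa>"
        using tups_length[OF hs] by (simp add: \<gamma>_def comp_def m_def d0 \<kappa>_def map_replicate_const)
      have "B' hs [] = \<gamma> (map ?\<Delta> hs) - \<gamma> (map ?i hs)"
        unfolding B'_def using diag[OF hsH] tups_length[OF hs] by (subst (1 2) B(3)) (simp_all add: tups_def)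
      then have "cobd b1 hs = \<gamma> (map ?\<Delta> hs) - \<gamma> (map ?i hs)"
        using primitiveD[OF b1(2) hs] by simp
      then show "cobd b hs = c hs"
        unfolding b_def[abs_def] cobd_add cobd_diff 1 2 3 primitiveD[OF \<kappa> hs] by simp
    qed
  qed
qed

section \<open>Exhaustions and transitive actions\<close>

text \<open>Each tuple over \<open>D\<close> lies in \<open>H k\<close> for almost all
  \<open>k\<close>, so the pointwise ultralimit inherits every identity that holds eventually; the
  common bound \<open>R\<close> makes the limit exist.\<close>

lemma primitive_exhaustion:
  fixes H :: "nat \<Rightarrow> 'g::group_add set"
  assumes D: "subgrp D" and ev: "\<And>x. x \<in> D \<Longrightarrow> eventually (\<lambda>k. x \<in> H k) sequentially"
    and b: "\<And>k. \<exists>b. cochain (H k) (H k) n R b \<and> primitive (H k) n c b"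
  obtains b where "cochain D D n R b" "primitive D n c b"
proof -
  obtain U :: "nat filter" where U: "U \<le> sequentially" "ultra U"
    using ex_ultra[OF sequentially_bot] by blast
  have Unb: "U \<noteq> bot" using U by (simp add: ultra_def)
  obtain \<beta> where \<beta>: "\<And>k. cochain (H k) (H k) n R (\<beta> k)" "\<And>k. primitive (H k) n c (\<beta> k)"
    using b by metis
  have evt: "eventually (\<lambda>k. xs \<in> tups (H k) m) U" if "xs \<in> tups D m" for xs m
  proof (rule filter_leD[OF U(1)])
    have "eventually (\<lambda>k. \<forall>x\<in>set xs. x \<in> H k) sequentially"
      using that ev by (intro eventually_ball_finite) (auto simp: tups_def)
    then show "eventually (\<lambda>k. xs \<in> tups (H k) m) sequentially"
      by eventually_elim (use that in \<open>auto simp: tups_def\<close>)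
  qed
  define l where "l xs = Lim U (\<lambda>k. \<beta> k xs)" for xs
  have l: "((\<lambda>k. \<beta> k xs) \<longlongrightarrow> l xs) U \<and> \<bar>l xs\<bar> \<le> R" if xs: "xs \<in> tups D n" for xs
  proof -
    have "eventually (\<lambda>k. \<bar>\<beta> k xs\<bar> \<le> R) U"
      using evt[OF xs] by eventually_elim (rule cochain_le[OF \<beta>(1)])
    then obtain a where a: "((\<lambda>k. \<beta> k xs) \<longlongrightarrow> a) U" "\<bar>a\<bar> \<le> R" by (rule ultra_convergent[OF U(2)])
    moreover have "l xs = a" unfolding l_def by (rule tendsto_Lim[OF Unb a(1)])
    ultimately show ?thesis by simp
  qed
  show ?thesis
  proof (rule that[of l])
    show "cochain D D n R l"
    proof (rule cochainI)
      fix xs assume xs: "xs \<in> tups D n"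
      show "\<bar>l xs\<bar> \<le> R" using l[OF xs] ..
      fix g assume g: "g \<in> D"
      have "eventually (\<lambda>k. \<beta> k xs = \<beta> k (translate g xs)) U"
        using evt[OF xs] filter_leD[OF U(1) ev[OF g]]
        by eventually_elim (simp add: cochain_inv[OF \<beta>(1)])
      then have "((\<lambda>k. \<beta> k (translate g xs)) \<longlongrightarrow> l xs) U"
        using l[OF xs] by (blast intro: Lim_transform_eventually)
      then show "l (translate g xs) = l xs"
        using tendsto_unique[OF Unb] l[OF translate_tups[OF D g xs]] by blast
    qed
    show "primitive D n c l"
    proof (rule primitiveI)
      fix xs assume xs: "xs \<in> tups D (Suc n)"
      have "((\<lambda>k. cobd (\<beta> k) xs) \<longlongrightarrow> cobd l xs) U"
        by (rule tendsto_cobd) (use l faces_tups[OF xs] in blast)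
      moreover have "eventually (\<lambda>k. cobd (\<beta> k) xs = c xs) U"
        using evt[OF xs] by eventually_elim (rule primitiveD[OF \<beta>(2)])
      ultimately have "((\<lambda>k. c xs) \<longlongrightarrow> cobd l xs) U" by (rule Lim_transform_eventually)
      then show "cobd l xs = c xs" using tendsto_unique[OF Unb tendsto_const] by metis
    qed
  qed
qed

text \<open>The second \<open>S\<close> bounds the constant with which the row
  \<open>xs = []\<close> is integrated.\<close>

definition generic_bound :: "(nat \<Rightarrow> real \<Rightarrow> real) \<Rightarrow> nat \<Rightarrow> real \<Rightarrow> real" where
  "generic_bound \<rho> n M = (let S = stair_bound \<rho> n M (\<rho> n M) (Suc n) in collapse_bound S S (Suc n))"

text \<open>By transitivity, the row \<open>xs = []\<close> of the total cocycle consists of constants.\<close>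

lemma (in complex_action) generic_action:
  assumes trans: "\<And>ys zs. ys \<in> X \<Longrightarrow> zs \<in> X \<Longrightarrow> length ys = length zs \<Longrightarrow> \<exists>g\<in>G. zs = acts g ys"
    and exact: "\<And>ys p M. ys \<in> X \<Longrightarrow> ys \<noteq> [] \<Longrightarrow> p + length ys = Suc n \<Longrightarrow> exact_at G (stab ys) p M (\<rho> p M)"
    and v: "\<And>ys g. ys \<in> X \<Longrightarrow> g \<in> G \<Longrightarrow> eventually (\<lambda>k::nat. act g (v k) # ys \<in> X) sequentially"
  shows "exact_at G G n M (generic_bound \<rho> n M)"
  unfolding exact_at_def
proof (intro allI impI)
  fix c assume c: "cochain G G (Suc n) M c" "cocycle G (Suc n) c"
  define S where "S = stair_bound \<rho> n M (\<rho> n M) (Suc n)"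
  obtain B where B: "dcochain (Suc n) S (\<lambda>_ _. True) B"
    "deq (Suc (Suc n)) (\<lambda>_ _. True) B (\<lambda>_ _. 0)"
    "\<And>xs. xs \<in> tups G (Suc n) \<Longrightarrow> B xs [] = c xs"
  proof (rule staircase[OF c, where \<rho> = \<rho> and R = "\<rho> n M", folded S_def])
    show "\<exists>b. cochain G (stab [y]) n (\<rho> n M) b \<and> primitive G n c b" if "[y] \<in> X" for y
    proof -
      have "exact_at G (stab [y]) n M (\<rho> n M)" using that by (intro exact) auto
      then show ?thesis
        using cochain_subset[OF c(1) order_refl stab_subset] c(2) unfolding exact_at_def by blast
    qed
    show "exact_at G (stab ys) p M (\<rho> p M)" if "ys \<in> X" "2 \<le> length ys" "p + length ys = Suc n" for ys p M
      using that by (intro exact) auto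
  qed blast
  have "\<exists>ys\<in>X. length ys = m" for m
  proof (induction m)
    case (Suc m)
    then obtain ys where ys: "ys \<in> X" "length ys = m" by blast
    then obtain k where "act 0 (v k) # ys \<in> X"
      using eventually_happens[OF v[OF ys(1) subgrp_0[OF G]]] by auto
    then show ?case using ys(2) by (intro bexI) auto
  qed (use X_Nil in auto)
  then obtain y1 y2 where y: "y1 \<in> X" "length y1 = Suc n" "y2 \<in> X" "length y2 = Suc (Suc n)" by metis
  define \<kappa> where "\<kappa> = B [] y1"
  have \<kappa>: "B [] ys = \<kappa>" if ys: "ys \<in> X" "length ys = Suc n" for ys
  proof -
    obtain g where "g \<in> G" "ys = acts g y1" using trans[OF y(1) ys(1)] ys(2) y(2) by auto
    then show ?thesis using dcochainD(2)[OF B(1) _ y(1), of "[]" g] y(2) by (simp add: \<kappa>_def)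
  qed
  \<comment> \<open>Testing closedness of the row on a single simplex of length n + 2 forces the
    constant to vanish for odd \<open>n\<close>; for even \<open>n\<close> it is its own
    coboundary.\<close>
  have "cobd (\<lambda>_. \<kappa>) y2 = cobd (B []) y2"
    by (rule cobd_cong, rule sym[OF \<kappa>]) (use y X_faces in \<open>auto dest: length_faces\<close>)
  also have "\<dots> = 0" using deqD[OF B(2) _ y(3), of "[]"] y(4) by (simp add: dtot_def)
  finally have odd: "\<kappa> = 0" if "odd n" using that y(4) by (simp add: cobd_const)
  obtain U :: "nat filter" where U: "U \<le> sequentially" "ultra U"
    using ex_ultra[OF sequentially_bot] by blast
  obtain b where "cochain G G n (collapse_bound S S (Suc n)) b" "primitive G n (\<lambda>xs. B xs []) b"
  proof (rule collapse[OF B(1,2) _ _ _ U(2), where w = "\<lambda>_. \<kappa>" and v = v])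
    show "\<bar>\<kappa>\<bar> \<le> S" using dcochainD(1)[OF B(1) _ y(1), of "[]"] y(2) by (simp add: \<kappa>_def)
    show "B [] ys = cobd (\<lambda>_. \<kappa>) ys" if "ys \<in> X" "length ys = Suc n" for ys
      using \<kappa>[OF that] that(2) odd by (auto simp: cobd_const)
  qed (use filter_leD[OF U(1) v] in auto)
  moreover have "primitive G n c b" if "primitive G n (\<lambda>xs. B xs []) b" for b
    using that B(3) by (simp add: primitive_def)
  ultimately show "\<exists>b. cochain G G n (generic_bound \<rho> n M) b \<and> primitive G n c b"
    by (auto simp: generic_bound_def S_def Let_def)
qed

section \<open>Clopen subsets and Brouwer's theorem\<close>

text \<open>Relatively clopen subsets, encoded by locally constant membership, so that Boolean
  operations reduce to conjunctions of \<open>eventually\<close> statements. The usual form is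
  \<open>clp_iff\<close>.\<close>

definition clp :: "'a::topological_space set \<Rightarrow> 'a set \<Rightarrow> bool" where
  "clp K A \<longleftrightarrow> A \<subseteq> K \<and> (\<forall>x\<in>K. \<forall>\<^sub>F y in at x within K. y \<in> A \<longleftrightarrow> x \<in> A)"

lemma clp_subset: "clp K A \<Longrightarrow> A \<subseteq> K"
  by (simp add: clp_def)

lemma clp_openin: "clp K A \<Longrightarrow> openin (top_of_set K) A"
proof -
  assume A: "clp K A"
  have "\<exists>T. open T \<and> x \<in> T \<and> T \<inter> K \<subseteq> A" if "x \<in> A" for x
  proof -
    have "\<forall>\<^sub>F y in at x within K. y \<in> A \<longleftrightarrow> x \<in> A"
      using A that unfolding clp_def by blast
    then have "\<forall>\<^sub>F y in at x within K. y \<in> A"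
      by (rule eventually_mono) (use that in simp)
    then show ?thesis using that by (auto simp: eventually_at_topological subset_iff)
  qed
  then show ?thesis
    using clp_subset[OF A] by (subst openin_subopen) (metis Int_commute Int_iff openin_open_Int subsetD)
qed

lemma clp_iff: "clp K A \<longleftrightarrow> openin (top_of_set K) A \<and> openin (top_of_set K) (K - A) \<and> A \<subseteq> K"
proof
  assume A: "clp K A"
  then have "clp K (K - A)"
    unfolding clp_def by (auto elim!: eventually_mono[rotated] intro: eventually_mono simp: eventually_at_topological)
  with A show "openin (top_of_set K) A \<and> openin (top_of_set K) (K - A) \<and> A \<subseteq> K"
    by (simp add: clp_openin clp_subset)
next
  assume *: "openin (top_of_set K) A \<and> openin (top_of_set K) (K - A) \<and> A \<subseteq> K"
  then obtain T S where T: "open T" "A = K \<inter> T" and S: "open S" "K - A = K \<inter> S"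
    by (auto simp: openin_open)
  have "\<forall>\<^sub>F y in at x within K. y \<in> A \<longleftrightarrow> x \<in> A" if "x \<in> K" for x
  proof (cases "x \<in> A")
    case True
    then show ?thesis using T unfolding eventually_at_topological by auto
  next
    case False
    then show ?thesis using S that unfolding eventually_at_topological by (intro exI[of _ S]) auto
  qed
  then show "clp K A" using * by (simp add: clp_def)
qed

lemma clp_self [simp]: "clp K K" and clp_empty [simp]: "clp K {}"
  by (simp_all add: clp_iff)

lemma clp_Diff: "clp K A \<Longrightarrow> clp K B \<Longrightarrow> clp K (A - B)"
  and clp_Un: "clp K A \<Longrightarrow> clp K B \<Longrightarrow> clp K (A \<union> B)"
  and clp_Int: "clp K A \<Longrightarrow> clp K B \<Longrightarrow> clp K (A \<inter> B)"
proof -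
  assume A: "clp K A" and B: "clp K B"
  have *: "\<forall>\<^sub>F y in at x within K. (y \<in> A \<longleftrightarrow> x \<in> A) \<and> (y \<in> B \<longleftrightarrow> x \<in> B)" if "x \<in> K" for x
    using A B that by (simp add: clp_def eventually_conj)
  show "clp K (A - B)" "clp K (A \<union> B)" "clp K (A \<inter> B)"
    using clp_subset[OF A] clp_subset[OF B] by (auto simp: clp_def intro!: eventually_mono[OF *])
qed

lemma clp_trans: "clp K A \<Longrightarrow> clp A B \<Longrightarrow> clp K B"
proof -
  assume A: "clp K A" and B: "clp A B"
  have "openin (top_of_set K) B"
    using A B by (meson clp_iff openin_trans)
  moreover have "openin (top_of_set K) ((K - A) \<union> (A - B))"
    using A B by (meson clp_iff openin_trans openin_Un)
  moreover have "(K - A) \<union> (A - B) = K - B"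
    using clp_subset[OF A] clp_subset[OF B] by auto
  ultimately show "clp K B" using A B by (auto simp: clp_iff)
qed

lemma clp_restrict: "clp K B \<Longrightarrow> A \<subseteq> K \<Longrightarrow> clp A (A \<inter> B)"
proof -
  assume B: "clp K B" and AK: "A \<subseteq> K"
  then obtain T S where T: "open T" "B = K \<inter> T" and S: "open S" "K - B = K \<inter> S"
    by (auto simp: clp_iff openin_open)
  have "A \<inter> B = A \<inter> T" "A - A \<inter> B = A \<inter> S" using T(2) S(2) AK by auto
  then show "clp A (A \<inter> B)" using T(1) S(1) by (auto simp: clp_iff openin_open)
qed

lemma clp_closed:
  fixes K :: "'a::metric_space set"
  assumes "compact K" "clp K A"
  shows "closed A" "compact A"
proof -
  have "K - (K - A) = A" using clp_subset[OF assms(2)] by auto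
  then have "closedin (top_of_set K) A"
    using assms(2) by (metis Diff_subset clp_iff closedin_def openin_subset topspace_euclidean_subtopology)
  then show "closed A" using assms(1) closedin_closed_trans compact_imp_closed by blast
  then show "compact A" using assms clp_subset[of K A] by (metis compact_Int_closed inf.absorb2)
qed

lemma clp_cantor:
  fixes K :: "'a::metric_space set"
  assumes K: "cantor_set K" and A: "clp K A"
  shows "cantor_set A"
  unfolding cantor_set_def
proof (intro conjI ballI)
  show "compact A" using K A clp_closed by (auto simp: cantor_set_def)
  show "totally_disconnected A"
    unfolding totally_disconnected_def
  proof
    fix x assume x: "x \<in> A"
    have "connected_component_set A x \<subseteq> connected_component_set K x"
      by (rule connected_component_mono[OF clp_subset[OF A]])
    also have "\<dots> = {x}"
      using K x clp_subset[OF A] by (auto simp: cantor_set_def totally_disconnected_def)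
    finally show "connected_component_set A x = {x}" using x by auto
  qed
  fix x assume x: "x \<in> A"
  show "\<not> x isolated_in A"
  proof
    assume "x isolated_in A"
    then obtain T where T: "open T" "T \<inter> A = {x}" by (auto simp: isolated_in_def)
    obtain S where S: "open S" "A = K \<inter> S" using clp_openin[OF A] by (auto simp: openin_open)
    have "open (T \<inter> S)" "(T \<inter> S) \<inter> K = {x}" using T S by auto
    then have "x isolated_in K" using x clp_subset[OF A] by (auto simp: isolated_in_def)
    then show False using K x clp_subset[OF A] by (auto simp: cantor_set_def)
  qed
qed

section \<open>Separation by clopen sets\<close>

text \<open>In a compact Hausdorff space two closed sets that no connected set meets simultaneously
  are separated by a clopen set; here connected sets have at most one point.\<close>

lemma clp_separate:
  fixes K :: "'a::metric_space set"
  assumes K: "cantor_set K" and S: "closed S" "S \<subseteq> K" and U: "open U" "S \<subseteq> U"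
  obtains A where "clp K A" "S \<subseteq> A" "A \<subseteq> U"
proof -
  let ?X = "top_of_set K"
  have "separated_between ?X S (K - U)"
  proof (rule cut_wire_fence_theorem)
    show "compact_space ?X" using K by (simp add: cantor_set_def compact_space_subtopology)
    show "Hausdorff_space ?X" by (simp add: Hausdorff_space_subtopology)
    show "closedin ?X S" using S by (simp add: closed_subset)
    show "closedin ?X (K - U)" using U(1) by (simp add: Diff_eq closedin_closed_Int closed_Compl)
    fix C assume C: "connectedin ?X C"
    then have CK: "C \<subseteq> K" "connected C" by (auto simp: connectedin_subtopology connectedin_iff_connected)
    have "x = y" if "x \<in> C" "y \<in> C" for x y
    proof -
      have "connected_component K x y" using CK that by (auto simp: connected_component_def)
      moreover have "connected_component_set K x = {x}"
        using K CK that by (auto simp: cantor_set_def totally_disconnected_def)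
      ultimately show ?thesis by (metis mem_Collect_eq singletonD)
    qed
    then show "disjnt C S \<or> disjnt C (K - U)" using U by (auto simp: disjnt_iff)
  qed
  then obtain A B where "openin ?X A" "openin ?X B" "A \<union> B = K" "disjnt A B" "S \<subseteq> A" "K - U \<subseteq> B"
    by (auto simp: separated_between_def)
  moreover have "K - A = B" using calculation by (auto simp: disjnt_iff)
  ultimately show ?thesis by (intro that[of A]) (auto simp: clp_iff disjnt_iff)
qed

lemma clp_nbhd:
  fixes K :: "'a::metric_space set"
  assumes K: "cantor_set K" and "x \<in> K" "open U" "x \<in> U"
  obtains A where "clp K A" "x \<in> A" "A \<subseteq> U"
  using clp_separate[OF K, of "{x}" U] assms by auto

lemma cantor_other_point:
  fixes K :: "'a::metric_space set"
  assumes K: "cantor_set K" and x: "x \<in> K"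
  obtains y where "y \<in> K" "y \<noteq> x"
proof -
  have "\<not> (open UNIV \<and> UNIV \<inter> K = {x})" using K x by (auto simp: cantor_set_def isolated_in_def)
  then show ?thesis using that x by auto
qed

lemma cantor_infinite:
  fixes K :: "'a::metric_space set"
  assumes K: "cantor_set K" and "K \<noteq> {}"
  shows "infinite K"
proof
  assume fin: "finite K"
  obtain x where x: "x \<in> K" using assms by blast
  have "open (- (K - {x}))" by (intro open_Compl finite_imp_closed) (use fin in simp)
  moreover have "- (K - {x}) \<inter> K = {x}" using x by auto
  ultimately show False using K x by (auto simp: cantor_set_def isolated_in_def)
qed

text \<open>Finite clopen partitions are encoded by locally constant functions.\<close>

definition locconst :: "'a::topological_space set \<Rightarrow> ('a \<Rightarrow> 'b) \<Rightarrow> bool" where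
  "locconst K \<alpha> \<longleftrightarrow> (\<forall>x\<in>K. \<forall>\<^sub>F y in at x within K. \<alpha> y = \<alpha> x)"

definition meshed :: "'a::metric_space set \<Rightarrow> real \<Rightarrow> ('a \<Rightarrow> 'b) \<Rightarrow> bool" where
  "meshed K e \<alpha> \<longleftrightarrow> (\<forall>x\<in>K. \<forall>y\<in>K. \<alpha> x = \<alpha> y \<longrightarrow> dist x y < e)"

lemma locconst_fibre: "locconst K \<alpha> \<Longrightarrow> clp K {x \<in> K. \<alpha> x = i}"
proof -
  assume \<alpha>: "locconst K \<alpha>"
  have "\<forall>\<^sub>F y in at x within K. y \<in> {x \<in> K. \<alpha> x = i} \<longleftrightarrow> x \<in> {x \<in> K. \<alpha> x = i}" if "x \<in> K" for x
  proof -
    have "\<forall>\<^sub>F y in at x within K. \<alpha> y = \<alpha> x" using \<alpha> that by (auto simp: locconst_def)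
    moreover have "\<forall>\<^sub>F y in at x within K. y \<in> K" unfolding eventually_at_topological by blast
    ultimately show ?thesis by eventually_elim (use that in auto)
  qed
  then show ?thesis by (auto simp: clp_def)
qed

lemma locconst_comp: "locconst K \<alpha> \<Longrightarrow> locconst K (\<lambda>x. h (\<alpha> x))"
  unfolding locconst_def by (auto elim!: eventually_mono)

text \<open>The label of a point records which members of a finite clopen cover by small sets
  contain it, so the fibres are the atoms of the cover; the labels are then renumbered.\<close>

lemma fine_partition:
  fixes K :: "'a::metric_space set"
  assumes K: "cantor_set K" and "e > 0"
  obtains \<alpha> :: "'a \<Rightarrow> nat" and m where "locconst K \<alpha>" "meshed K e \<alpha>" "\<alpha> ` K = {..<m}"
proof -
  have "\<exists>A. clp K A \<and> x \<in> A \<and> A \<subseteq> ball x (e / 2)" if "x \<in> K" for x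
    using clp_nbhd[OF K that, of "ball x (e / 2)"] \<open>e > 0\<close> by auto
  then obtain C where C: "\<And>x. x \<in> K \<Longrightarrow> clp K (C x)" "\<And>x. x \<in> K \<Longrightarrow> x \<in> C x"
    "\<And>x. x \<in> K \<Longrightarrow> C x \<subseteq> ball x (e / 2)" by metis
  then have "\<forall>x\<in>K. \<exists>T. open T \<and> C x = K \<inter> T" by (metis (full_types) clp_openin openin_open)
  then obtain T where T: "\<And>x. x \<in> K \<Longrightarrow> open (T x)" "\<And>x. x \<in> K \<Longrightarrow> C x = K \<inter> T x" by metis
  have "K \<subseteq> (\<Union>x\<in>K. T x)" using C(2) T(2) by blast
  then obtain D where D: "D \<subseteq> K" "finite D" "K \<subseteq> (\<Union>x\<in>D. T x)"
    using compactE_image[of K K T] K T(1) by (auto simp: cantor_set_def)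
  define a where "a x = {d \<in> D. x \<in> C d}" for x
  have lc: "locconst K a"
    unfolding locconst_def
  proof
    fix x assume x: "x \<in> K"
    have "\<forall>\<^sub>F y in at x within K. \<forall>d\<in>D. y \<in> C d \<longleftrightarrow> x \<in> C d"
      using C(1) D x by (intro eventually_ball_finite) (auto simp: clp_def)
    then show "\<forall>\<^sub>F y in at x within K. a y = a x"
      by eventually_elim (auto simp: a_def)
  qed
  have meshed: "dist x y < e" if xy: "x \<in> K" "y \<in> K" "a x = a y" for x y
  proof -
    obtain d where d: "d \<in> D" "x \<in> C d" using D(3) xy(1) T(2) D(1) by blast
    then have "y \<in> C d" using xy(3) by (auto simp: a_def)
    moreover have "d \<in> K" using d(1) D(1) by blast
    ultimately have "x \<in> ball d (e / 2)" "y \<in> ball d (e / 2)" using C(3) d(2) by blast+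
    then show ?thesis using dist_triangle_half_r[of d x e y] by (simp del: less_divide_eq_numeral1)
  qed
  have "finite (a ` K)" by (rule finite_subset[of _ "Pow D"]) (auto simp: a_def D(2))
  then obtain h where h: "bij_betw h (a ` K) {0..<card (a ` K)}" using ex_bij_betw_finite_nat by blast
  show ?thesis
  proof (rule that)
    show "locconst K (\<lambda>x. h (a x))" by (rule locconst_comp[OF lc])
    show "meshed K e (\<lambda>x. h (a x))" unfolding meshed_def
      using meshed h by (auto simp: bij_betw_def inj_on_def)
    show "(\<lambda>x. h (a x)) ` K = {..<card (a ` K)}"
      using h by (auto simp: bij_betw_def image_image lessThan_atLeast0)
  qed
qed

text \<open>Perfectness lets one fibre be cut in two without spoiling the mesh. Iteration equalises
  the numbers of pieces of two Cantor sets.\<close>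

lemma fine_partition_split:
  fixes K :: "'a::metric_space set" and \<alpha> :: "'a \<Rightarrow> nat"
  assumes K: "cantor_set K" "K \<noteq> {}" and \<alpha>: "locconst K \<alpha>" "meshed K e \<alpha>" "\<alpha> ` K = {..<m}"
  obtains \<alpha>' :: "'a \<Rightarrow> nat" where "locconst K \<alpha>'" "meshed K e \<alpha>'" "\<alpha>' ` K = {..<Suc m}"
proof -
  obtain x where x: "x \<in> K" using K by blast
  define F where "F = {y \<in> K. \<alpha> y = \<alpha> x}"
  have F: "clp K F" "x \<in> F" using locconst_fibre[OF \<alpha>(1)] x by (auto simp: F_def)
  obtain y where y: "y \<in> F" "y \<noteq> x" using cantor_other_point[OF clp_cantor[OF K(1) F(1)] F(2)] .
  obtain A where A: "clp F A" "x \<in> A" "A \<subseteq> - {y}"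
    using clp_nbhd[OF clp_cantor[OF K(1) F(1)] F(2), of "- {y}"] y by auto
  have A': "clp K A" by (rule clp_trans[OF F(1) A(1)])
  define \<alpha>' where "\<alpha>' z = (if z \<in> A then m else \<alpha> z)" for z
  have AF: "A \<subseteq> F" by (rule clp_subset[OF A(1)])
  have \<alpha>A: "\<alpha> z = \<alpha> x" if "z \<in> A" for z using AF that by (auto simp: F_def)
  have lt: "\<alpha> z < m" if "z \<in> K" for z using \<alpha>(3) that by auto
  show ?thesis
  proof (rule that[of \<alpha>'])
    show "locconst K \<alpha>'" unfolding locconst_def
    proof
      fix z assume "z \<in> K"
      then have "\<forall>\<^sub>F w in at z within K. \<alpha> w = \<alpha> z" "\<forall>\<^sub>F w in at z within K. w \<in> A \<longleftrightarrow> z \<in> A"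
        using \<alpha>(1) A' by (auto simp: locconst_def clp_def)
      then show "\<forall>\<^sub>F w in at z within K. \<alpha>' w = \<alpha>' z"
        by eventually_elim (auto simp: \<alpha>'_def)
    qed
    show "meshed K e \<alpha>'" unfolding meshed_def
    proof (intro ballI impI)
      fix z w assume zw: "z \<in> K" "w \<in> K" "\<alpha>' z = \<alpha>' w"
      then have "\<alpha> z = \<alpha> w"
        using lt[OF zw(1)] lt[OF zw(2)] \<alpha>A[of z] \<alpha>A[of w] by (auto simp: \<alpha>'_def split: if_splits)
      then show "dist z w < e" using zw \<alpha>(2) by (auto simp: meshed_def)
    qed
    have y': "\<alpha>' y = \<alpha> x" "y \<in> K" using y A(3) by (auto simp: \<alpha>'_def F_def)
    have x': "\<alpha>' x = m" using A(2) by (simp add: \<alpha>'_def)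
    show "\<alpha>' ` K = {..<Suc m}"
    proof (rule equalityI; rule subsetI)
      fix i assume "i \<in> \<alpha>' ` K"
      then show "i \<in> {..<Suc m}" using lt by (force simp: \<alpha>'_def)
    next
      fix i assume "i \<in> {..<Suc m}"
      then consider "i = m" | "i = \<alpha> x" | "i < m" "i \<noteq> \<alpha> x" by fastforce
      then show "i \<in> \<alpha>' ` K"
      proof cases
        case 3
        then obtain z where z: "z \<in> K" "\<alpha> z = i" using \<alpha>(3) by (metis imageE lessThan_iff)
        then have "z \<notin> A" using \<alpha>A 3(2) by blast
        then have "\<alpha>' z = i" using z(2) by (simp add: \<alpha>'_def)
        then show ?thesis using z(1) by blast
      qed (use x x' y' in \<open>metis imageI\<close>)+
    qed
  qed
qed

section \<open>Matched partitions and the homeomorphism of two Cantor sets\<close>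

definition matched :: "'a::metric_space set \<Rightarrow> 'b::metric_space set \<Rightarrow> real \<Rightarrow> ('a \<Rightarrow> nat) \<Rightarrow> ('b \<Rightarrow> nat) \<Rightarrow> bool" where
  "matched K L e \<alpha> \<beta> \<longleftrightarrow> locconst K \<alpha> \<and> meshed K e \<alpha> \<and> locconst L \<beta> \<and> meshed L e \<beta> \<and> \<alpha> ` K = \<beta> ` L"

lemma matched_partitions:
  fixes K :: "'a::metric_space set" and L :: "'b::metric_space set"
  assumes K: "cantor_set K" "K \<noteq> {}" and L: "cantor_set L" "L \<noteq> {}" and "e > 0"
  obtains \<alpha> \<beta> where "matched K L e \<alpha> \<beta>"
proof -
  have *: "\<exists>N. \<forall>m\<ge>N. \<exists>\<alpha>::_ \<Rightarrow> nat. locconst K \<alpha> \<and> meshed K e \<alpha> \<and> \<alpha> ` K = {..<m}"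
    if K: "cantor_set K" "K \<noteq> {}" for K :: "'c::metric_space set"
  proof -
    obtain \<alpha> :: "'c \<Rightarrow> nat" and N where \<alpha>: "locconst K \<alpha>" "meshed K e \<alpha>" "\<alpha> ` K = {..<N}"
      using fine_partition[OF K(1) \<open>e > 0\<close>] .
    have "\<exists>\<alpha>::_ \<Rightarrow> nat. locconst K \<alpha> \<and> meshed K e \<alpha> \<and> \<alpha> ` K = {..<m}" if "N \<le> m" for m
      using that
    proof (induction m rule: dec_induct)
      case base
      show ?case using \<alpha> by blast
    next
      case (step m)
      then obtain \<alpha> :: "'c \<Rightarrow> nat" where "locconst K \<alpha>" "meshed K e \<alpha>" "\<alpha> ` K = {..<m}" by blast
      from fine_partition_split[OF K this] show ?case by metis
    qed
    then show ?thesis by blast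
  qed
  obtain N N' where "\<forall>m\<ge>N. \<exists>\<alpha>::_ \<Rightarrow> nat. locconst K \<alpha> \<and> meshed K e \<alpha> \<and> \<alpha> ` K = {..<m}"
    "\<forall>m\<ge>N'. \<exists>\<alpha>::_ \<Rightarrow> nat. locconst L \<alpha> \<and> meshed L e \<alpha> \<and> \<alpha> ` L = {..<m}"
    using *[OF K] *[OF L] by blast
  then obtain \<alpha> \<beta> where "locconst K \<alpha> \<and> meshed K e \<alpha> \<and> \<alpha> ` K = {..<max N N'}"
    "locconst L \<beta> \<and> meshed L e \<beta> \<and> \<beta> ` L = {..<max N N'}"
    by (meson max.cobounded1 max.cobounded2)
  then show ?thesis by (intro that[of \<alpha> \<beta>]) (simp add: matched_def)
qed

text \<open>Corresponding pieces are Cantor sets and are matched separately. Encoding the old label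
  into the new one ensures that new partners are old partners.\<close>

lemma matched_refine:
  fixes K :: "'a::metric_space set" and L :: "'b::metric_space set"
  assumes K: "cantor_set K" and L: "cantor_set L" and "e' > 0" and m: "matched K L e \<alpha> \<beta>"
  obtains \<alpha>' \<beta>' where "matched K L e' \<alpha>' \<beta>'" "\<And>x y. \<alpha>' x = \<beta>' y \<Longrightarrow> \<alpha> x = \<beta> y"
proof -
  let ?K = "\<lambda>i. {x \<in> K. \<alpha> x = i}" and ?L = "\<lambda>i. {y \<in> L. \<beta> y = i}"
  have m': "locconst K \<alpha>" "locconst L \<beta>" "\<alpha> ` K = \<beta> ` L" using m by (auto simp: matched_def)
  have clpK: "clp K (?K i)" and clpL: "clp L (?L i)" for i using m' by (auto intro: locconst_fibre)
  have "\<exists>a b. matched (?K i) (?L i) e' a b" for i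
  proof (cases "i \<in> \<alpha> ` K")
    case True
    moreover have "i \<in> \<beta> ` L" using True m'(3) by simp
    ultimately have "?K i \<noteq> {}" "?L i \<noteq> {}" by auto
    then obtain a b where "matched (?K i) (?L i) e' a b"
      by (rule matched_partitions[OF clp_cantor[OF K clpK] _ clp_cantor[OF L clpL] _ \<open>e' > 0\<close>])
    then show ?thesis by blast
  next
    case False
    moreover have "i \<notin> \<beta> ` L" using False m'(3) by simp
    ultimately have eq: "?K i = {}" "?L i = {}" by auto
    show ?thesis unfolding eq matched_def locconst_def meshed_def by simp
  qed
  then obtain a b where ab: "\<And>i. matched (?K i) (?L i) e' (a i) (b i)" by metis
  define \<alpha>' where "\<alpha>' x = prod_encode (\<alpha> x, a (\<alpha> x) x)" for x
  define \<beta>' where "\<beta>' y = prod_encode (\<beta> y, b (\<beta> y) y)" for y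
  have lc: "locconst K (\<lambda>x. prod_encode (\<alpha> x, a (\<alpha> x) x))"
    if \<alpha>: "locconst K \<alpha>" and a: "\<And>i. locconst {x \<in> K. \<alpha> x = i} (a i)"
    for K :: "'c::metric_space set" and \<alpha> :: "'c \<Rightarrow> nat" and a
    unfolding locconst_def
  proof
    fix x assume x: "x \<in> K"
    have 1: "\<forall>\<^sub>F y in at x within K. \<alpha> y = \<alpha> x" using \<alpha> x by (auto simp: locconst_def)
    have "\<forall>\<^sub>F y in at x within {y \<in> K. \<alpha> y = \<alpha> x}. a (\<alpha> x) y = a (\<alpha> x) x"
      using a[of "\<alpha> x"] x by (auto simp: locconst_def)
    then have 2: "\<forall>\<^sub>F y in at x within K. \<alpha> y = \<alpha> x \<longrightarrow> a (\<alpha> x) y = a (\<alpha> x) x"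
      unfolding eventually_at_topological by blast
    show "\<forall>\<^sub>F y in at x within K. prod_encode (\<alpha> y, a (\<alpha> y) y) = prod_encode (\<alpha> x, a (\<alpha> x) x)"
      using 1 2 by eventually_elim simp
  qed
  show ?thesis
  proof (rule that[of \<alpha>' \<beta>'])
    show "matched K L e' \<alpha>' \<beta>'"
      unfolding matched_def
    proof (intro conjI)
      show "locconst K \<alpha>'" unfolding \<alpha>'_def[abs_def] using ab m' by (intro lc) (auto simp: matched_def)
      show "locconst L \<beta>'" unfolding \<beta>'_def[abs_def] using ab m' by (intro lc) (auto simp: matched_def)
      show "meshed K e' \<alpha>'" using ab by (auto simp: meshed_def \<alpha>'_def matched_def)
      show "meshed L e' \<beta>'" using ab by (auto simp: meshed_def \<beta>'_def matched_def)
      show "\<alpha>' ` K = \<beta>' ` L"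
      proof (rule equalityI; rule subsetI)
        fix i assume "i \<in> \<alpha>' ` K"
        then obtain x where x: "x \<in> K" "i = \<alpha>' x" by blast
        have "a (\<alpha> x) x \<in> b (\<alpha> x) ` ?L (\<alpha> x)" using ab[of "\<alpha> x"] x by (auto simp: matched_def)
        then obtain y where "y \<in> L" "\<beta> y = \<alpha> x" "b (\<alpha> x) y = a (\<alpha> x) x" by auto
        then show "i \<in> \<beta>' ` L" using x by (intro image_eqI[of _ _ y]) (auto simp: \<alpha>'_def \<beta>'_def)
      next
        fix i assume "i \<in> \<beta>' ` L"
        then obtain y where y: "y \<in> L" "i = \<beta>' y" by blast
        have "b (\<beta> y) y \<in> a (\<beta> y) ` ?K (\<beta> y)" using ab[of "\<beta> y"] y by (auto simp: matched_def)
        then obtain x where "x \<in> K" "\<alpha> x = \<beta> y" "a (\<beta> y) x = b (\<beta> y) y" by auto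
        then show "i \<in> \<alpha>' ` K" using y by (intro image_eqI[of _ _ x]) (auto simp: \<alpha>'_def \<beta>'_def)
      qed
    qed
  qed (simp add: \<alpha>'_def \<beta>'_def)
qed

text \<open>The pieces of \<open>L\<close> that carry the labels of \<open>x\<close> are nonempty,
  closed and nested, so compactness gives a common point.\<close>

lemma matched_partner:
  fixes L :: "'b::metric_space set" and \<alpha> :: "nat \<Rightarrow> 'a \<Rightarrow> nat" and \<beta> :: "nat \<Rightarrow> 'b \<Rightarrow> nat"
  assumes L: "cantor_set L" and lc: "\<And>n. locconst L (\<beta> n)" and im: "\<And>n. \<alpha> n x \<in> \<beta> n ` L"
    and nest: "\<And>n y. \<alpha> (Suc n) x = \<beta> (Suc n) y \<Longrightarrow> \<alpha> n x = \<beta> n y"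
  shows "\<exists>y\<in>L. \<forall>n. \<alpha> n x = \<beta> n y"
proof -
  let ?F = "\<lambda>n. {y \<in> L. \<beta> n y = \<alpha> n x}"
  have mono: "?F j \<subseteq> ?F i" if "i \<le> j" for i j
  proof -
    have "\<alpha> j x = \<beta> j y \<Longrightarrow> \<alpha> i x = \<beta> i y" for y
      using that by (induction j rule: dec_induct) (auto dest: nest)
    then show ?thesis by (auto dest: sym)
  qed
  have "L \<inter> (\<Inter>n\<in>UNIV. ?F n) \<noteq> {}"
  proof (rule compact_imp_fip_image)
    show "compact L" using L by (simp add: cantor_set_def)
    then show "closed (?F n)" for n by (rule clp_closed(1)[OF _ locconst_fibre[OF lc]])
    fix I :: "nat set" assume "finite I"
    then have "?F (Max (insert 0 I)) \<subseteq> L \<inter> (\<Inter>n\<in>I. ?F n)"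
      using mono by (intro Int_greatest INT_greatest) auto
    moreover have "?F (Max (insert 0 I)) \<noteq> {}" using im[of "Max (insert 0 I)"] by auto
    ultimately show "L \<inter> (\<Inter>n\<in>I. ?F n) \<noteq> {}" by blast
  qed
  then show ?thesis by force
qed

text \<open>Points of \<open>K\<close> near \<open>x\<close> share its label at level
  \<open>n\<close>, so their images lie in one piece of small mesh.\<close>

lemma matched_continuous:
  fixes K :: "'a::metric_space set" and L :: "'b::metric_space set"
    and \<alpha> :: "nat \<Rightarrow> 'a \<Rightarrow> nat" and \<beta> :: "nat \<Rightarrow> 'b \<Rightarrow> nat"
  assumes lc: "\<And>n. locconst K (\<alpha> n)" and meshed: "\<And>n. meshed L (inverse (real (Suc n))) (\<beta> n)"
    and f: "\<And>x. x \<in> K \<Longrightarrow> f x \<in> L" "\<And>x n. x \<in> K \<Longrightarrow> \<alpha> n x = \<beta> n (f x)"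
  shows "continuous_on K f"
  unfolding continuous_on
proof (intro ballI tendstoI)
  fix x and e :: real assume x: "x \<in> K" and "e > 0"
  obtain n where n: "inverse (real (Suc n)) < e" using reals_Archimedean[OF \<open>e > 0\<close>] by auto
  have "\<forall>\<^sub>F y in at x within K. \<alpha> n y = \<alpha> n x" using lc x by (auto simp: locconst_def)
  moreover have "\<forall>\<^sub>F y in at x within K. y \<in> K" unfolding eventually_at_topological by blast
  ultimately show "\<forall>\<^sub>F y in at x within K. dist (f y) (f x) < e"
  proof eventually_elim
    case (elim y)
    then have "dist (f y) (f x) < inverse (real (Suc n))" using meshed[of n] f x by (auto simp: meshed_def)
    then show ?case using n by simp
  qed
qed

theorem cantor_sets_homeomorphic:
  fixes K :: "'a::metric_space set" and L :: "'b::metric_space set"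
  assumes K: "cantor_set K" "K \<noteq> {}" and L: "cantor_set L" "L \<noteq> {}"
  obtains f g where "homeomorphism K L f g"
proof -
  let ?e = "\<lambda>n. inverse (real (Suc n))"
  have "\<exists>s. \<forall>n. matched K L (?e n) (fst (s n)) (snd (s n)) \<and>
      (\<forall>x y. fst (s (Suc n)) x = snd (s (Suc n)) y \<longrightarrow> fst (s n) x = snd (s n) y)"
  proof (rule dependent_nat_choice)
    obtain \<alpha> \<beta> where "matched K L (?e 0) \<alpha> \<beta>" using matched_partitions[OF K L] by (metis inverse_positive_iff_positive of_nat_0_less_iff zero_less_Suc)
    then show "\<exists>s. matched K L (?e 0) (fst s) (snd s)" by (intro exI[of _ "(\<alpha>, \<beta>)"]) simp
  next
    fix s :: "('a \<Rightarrow> nat) \<times> ('b \<Rightarrow> nat)" and n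
    assume s: "matched K L (?e n) (fst s) (snd s)"
    have "0 < ?e (Suc n)" by simp
    from matched_refine[OF K(1) L(1) this s] obtain \<alpha>' \<beta>' where
      "matched K L (?e (Suc n)) \<alpha>' \<beta>'" "\<And>x y. \<alpha>' x = \<beta>' y \<Longrightarrow> fst s x = snd s y" by metis
    then show "\<exists>t. matched K L (?e (Suc n)) (fst t) (snd t) \<and> (\<forall>x y. fst t x = snd t y \<longrightarrow> fst s x = snd s y)"
      by (intro exI[of _ "(\<alpha>', \<beta>')"]) auto
  qed
  then obtain s where s: "\<And>n. matched K L (?e n) (fst (s n)) (snd (s n))"
    "\<And>n x y. fst (s (Suc n)) x = snd (s (Suc n)) y \<Longrightarrow> fst (s n) x = snd (s n) y" by blast
  define \<alpha> \<beta> where "\<alpha> n = fst (s n)" and "\<beta> n = snd (s n)" for n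
  have m: "locconst K (\<alpha> n)" "meshed K (?e n) (\<alpha> n)" "locconst L (\<beta> n)" "meshed L (?e n) (\<beta> n)"
    "\<alpha> n ` K = \<beta> n ` L" for n using s(1)[of n] by (auto simp: matched_def \<alpha>_def \<beta>_def)
  have nest: "\<alpha> (Suc n) x = \<beta> (Suc n) y \<Longrightarrow> \<alpha> n x = \<beta> n y" for n x y
    unfolding \<alpha>_def \<beta>_def by (rule s(2))
  have "\<forall>x\<in>K. \<exists>y\<in>L. \<forall>n. \<alpha> n x = \<beta> n y"
    by (rule ballI, rule matched_partner[where \<alpha> = \<alpha> and \<beta> = \<beta>, OF L(1) m(3) _ nest]) (use m(5) in blast)
  then obtain f where f: "\<And>x. x \<in> K \<Longrightarrow> f x \<in> L" "\<And>x n. x \<in> K \<Longrightarrow> \<alpha> n x = \<beta> n (f x)" by metis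
  have "\<forall>y\<in>L. \<exists>x\<in>K. \<forall>n. \<beta> n y = \<alpha> n x"
    by (rule ballI, rule matched_partner[where \<alpha> = \<beta> and \<beta> = \<alpha>, OF K(1) m(1) _ nest[THEN sym, OF sym]]) (use m(5) in \<open>blast+\<close>)
  then obtain g where g: "\<And>y. y \<in> L \<Longrightarrow> g y \<in> K" "\<And>y n. y \<in> L \<Longrightarrow> \<beta> n y = \<alpha> n (g y)" by metis
  \<comment> \<open>Points that agree in all labels coincide, as the mesh tends to 0; this makes the
    two partner maps inverse to each other.\<close>
  have eqI: "x = y" if "\<And>n. dist x y < ?e n" for x y :: "'c::metric_space"
  proof (rule ccontr)
    assume "x \<noteq> y"
    then obtain n where "?e n < dist x y" using reals_Archimedean[of "dist x y"] by auto
    then show False using that[of n] by simp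
  qed
  have gf: "g (f x) = x" if "x \<in> K" for x
    by (rule eqI) (use m(2) f g that in \<open>metis meshed_def\<close>)
  have fg: "f (g y) = y" if "y \<in> L" for y
    by (rule eqI) (use m(4) f g that in \<open>metis meshed_def\<close>)
  have "homeomorphism K L f g"
    unfolding homeomorphism_def
  proof (intro conjI)
    show "continuous_on K f" by (rule matched_continuous[OF m(1) m(4) f])
    show "continuous_on L g" by (rule matched_continuous[OF m(3) m(2) g])
    show "f ` K = L" using f(1) g(1) fg by (auto simp: image_iff) (metis g(1))
    show "g ` L = K" using f(1) g(1) gf by (auto simp: image_iff) (metis f(1))
  qed (use gf fg in auto)
  then show ?thesis by (rule that)
qed

section \<open>Groups of homeomorphisms\<close>

text \<open>All the groups involved are realised inside the group of bijections of the ambient type,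
  by extending homeomorphisms of a subset by the identity.\<close>

typedef 'a perm = "{f :: 'a \<Rightarrow> 'a. bij f}" morphisms app Perm
  by (rule exI[of _ id]) simp

lemma bij_app: "bij (app f)"
  using app[of f] by simp

lemma perm_eqI: "(\<And>x. app f x = app g x) \<Longrightarrow> f = g"
  by (simp add: app_inject[symmetric] fun_eq_iff)

instantiation perm :: (type) group_add
begin

definition zero_perm :: "'a perm" where "0 = Perm id"
definition plus_perm :: "'a perm \<Rightarrow> 'a perm \<Rightarrow> 'a perm" where "f + g = Perm (app f \<circ> app g)"
definition uminus_perm :: "'a perm \<Rightarrow> 'a perm" where "- f = Perm (inv_into UNIV (app f))"
definition minus_perm :: "'a perm \<Rightarrow> 'a perm \<Rightarrow> 'a perm" where "f - g = Perm (app f \<circ> inv_into UNIV (app g))"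

lemma app_0 [simp]: "app 0 x = x"
  by (simp add: zero_perm_def Perm_inverse)

lemma app_add [simp]: "app (f + g) x = app f (app g x)"
  by (simp add: plus_perm_def Perm_inverse bij_comp bij_app)

lemma app_uminus: "app (- f) = inv_into UNIV (app f)"
  by (simp add: uminus_perm_def Perm_inverse bij_app bij_imp_bij_inv)

lemma app_minus_app [simp]: "app (- f) (app f x) = x"
  and app_app_minus [simp]: "app f (app (- f) x) = x"
  by (simp_all add: app_uminus bij_app bij_is_inj bij_is_surj surj_f_inv_f)

instance
proof
  show "f + - g = f - g" for f g :: "'a perm"
    by (simp add: minus_perm_def plus_perm_def app_uminus)
qed (auto intro: perm_eqI)

end

lemma app_diff [simp]: "app (f - g) x = app f (app (- g) x)"
  by (simp only: diff_conv_add_uminus app_add)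

lemma app_eq_iff [simp]: "app f x = app f y \<longleftrightarrow> x = y"
  by (metis app_minus_app)

section \<open>Homeomorphisms supported in a subset\<close>

text \<open>Continuity is demanded on \<open>K\<close> only; on the ambient space the extension by
  the identity need not be continuous.\<close>

definition HS :: "'a::topological_space set \<Rightarrow> 'a perm set" where
  "HS K = {f. (\<forall>x. x \<notin> K \<longrightarrow> app f x = x) \<and> continuous_on K (app f) \<and> continuous_on K (app (- f))}"

lemma HS_id: "f \<in> HS K \<Longrightarrow> x \<notin> K \<Longrightarrow> app f x = x"
  and HS_continuous: "f \<in> HS K \<Longrightarrow> continuous_on K (app f)"
  by (simp_all add: HS_def)

lemma HS_mem: "f \<in> HS K \<Longrightarrow> app f x \<in> K \<longleftrightarrow> x \<in> K"
  by (metis HS_id app_eq_iff)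

lemma HS_image: "f \<in> HS K \<Longrightarrow> app f ` K = K"
proof -
  assume f: "f \<in> HS K"
  have "y \<in> app f ` K" if "y \<in> K" for y
    using HS_mem[OF f, of "app (- f) y"] that by (metis app_app_minus imageI)
  then show ?thesis using HS_mem[OF f] by auto
qed

lemma HS_minus: "f \<in> HS K \<Longrightarrow> - f \<in> HS K"
proof -
  assume f: "f \<in> HS K"
  then have "app (- f) x = x" if "x \<notin> K" for x using that by (metis HS_id app_minus_app)
  then show ?thesis using f by (simp add: HS_def)
qed

lemma HS_add: "f \<in> HS K \<Longrightarrow> g \<in> HS K \<Longrightarrow> f + g \<in> HS K"
proof -
  assume f: "f \<in> HS K" and g: "g \<in> HS K"
  have c: "continuous_on K (app (f + g))" if "f \<in> HS K" "g \<in> HS K" for f g :: "'a perm"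
    using continuous_on_compose[of K "app g" "app f"] that
    by (auto simp: HS_image HS_continuous comp_def app_add[abs_def] cong: continuous_on_cong)
  have "continuous_on K (app (- (f + g)))"
    using c[OF HS_minus[OF g] HS_minus[OF f]] by (simp add: minus_add)
  then show ?thesis using c[OF f g] f g by (auto simp: HS_def)
qed

lemma subgrp_HS: "subgrp (HS K)"
proof (rule subgrpI)
  have "app 0 = (\<lambda>x. x)" by (simp add: fun_eq_iff)
  then show "0 \<in> HS K" by (simp add: HS_def)
qed (auto simp: HS_add HS_minus)

lemma HS_of_homeomorphism:
  assumes h: "homeomorphism K K f g"
  obtains h where "h \<in> HS K" "\<And>x. x \<in> K \<Longrightarrow> app h x = f x"
proof -
  let ?f = "\<lambda>x. if x \<in> K then f x else x" and ?g = "\<lambda>x. if x \<in> K then g x else x"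
  have fg: "f x \<in> K" "g x \<in> K" "f (g x) = x" "g (f x) = x" if "x \<in> K" for x
    using h that by (auto simp: homeomorphism_def)
  have "?g \<circ> ?f = id" "?f \<circ> ?g = id" using fg by (auto simp: fun_eq_iff)
  then have bij: "bij ?f" and inv: "inv_into UNIV ?f = ?g"
    using o_bij inv_unique_comp by blast+
  define h where "h = Perm ?f"
  have app: "app h = ?f" "app (- h) = ?g"
    using bij inv by (simp_all add: h_def Perm_inverse app_uminus)
  show ?thesis
  proof (rule that[of h])
    show "h \<in> HS K"
      using assms by (auto simp: HS_def app homeomorphism_def cong: continuous_on_cong)
  qed (simp add: app)
qed

text \<open>\<open>A\<close> and its complement in \<open>K\<close> are both closed, so a
  homeomorphism of \<open>A\<close> and the identity paste continuously.\<close>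

lemma HS_mono:
  fixes K :: "'a::metric_space set"
  assumes K: "compact K" and A: "clp K A"
  shows "HS A \<subseteq> HS K"
proof
  fix f assume f: "f \<in> HS A"
  have AK: "A \<union> (K - A) = K" using clp_subset[OF A] by auto
  have "clp K (K - A)" using clp_Diff[OF clp_self A] .
  then have cl: "closed A" "closed (K - A)" using clp_closed(1)[OF K] A by auto
  have "continuous_on K (app f)" if "f \<in> HS A" for f
  proof -
    have "continuous_on (A \<union> (K - A)) (app f)"
      by (rule continuous_on_closed_Un[OF cl HS_continuous[OF that]],
          rule continuous_on_eq[of _ "\<lambda>x. x"]) (simp_all add: HS_id[OF that])
    then show ?thesis by (simp only: AK)
  qed
  then show "f \<in> HS K"
    using f HS_minus[OF f] clp_subset[OF A] by (auto simp: HS_def)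
qed

lemma clp_vimage:
  assumes "f \<in> HS K" "clp K A"
  shows "clp K {x \<in> K. app f x \<in> A}"
proof -
  have "openin (top_of_set K) (K \<inter> app f -` B)" if "openin (top_of_set K) B" for B
    using that assms by (intro continuous_openin_preimage[of K _ K]) (auto simp: HS_continuous HS_mem)
  moreover have "K \<inter> app f -` A = {x \<in> K. app f x \<in> A}"
    "K \<inter> app f -` (K - A) = K - {x \<in> K. app f x \<in> A}"
    using HS_mem[OF assms(1)] by auto
  ultimately show ?thesis using assms(2) unfolding clp_iff by (metis (no_types, lifting) mem_Collect_eq subsetI)
qed

section \<open>Gluing homeomorphisms\<close>

lemma homeomorphism_glue:
  fixes K :: "'a::metric_space set"
  assumes K: "compact K" and A: "clp K A" "clp K B"
    and f: "homeomorphism A B f f'" and g: "homeomorphism (K - A) (K - B) g g'"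
  obtains h where "h \<in> HS K" "\<And>x. x \<in> A \<Longrightarrow> app h x = f x" "\<And>x. x \<in> K - A \<Longrightarrow> app h x = g x"
proof -
  have glue: "continuous_on K (\<lambda>x. if x \<in> A then f x else g x)"
    if "clp K A" "continuous_on A f" "continuous_on (K - A) g" for A and f g :: "'a \<Rightarrow> 'a"
  proof -
    have "continuous_on (A \<union> (K - A)) (\<lambda>x. if x \<in> A then f x else g x)"
      using that clp_closed(1)[OF K] clp_Diff[OF clp_self] by (intro continuous_on_cases) auto
    moreover have "A \<union> (K - A) = K" using clp_subset[OF that(1)] by auto
    ultimately show ?thesis by simp
  qed
  have AK: "A \<subseteq> K" "B \<subseteq> K" using A clp_subset by auto
  have f': "f x \<in> B" "f' (f x) = x" if "x \<in> A" for x using f that by (auto simp: homeomorphism_def)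
  have f'': "f' x \<in> A" "f (f' x) = x" if "x \<in> B" for x using f that by (auto simp: homeomorphism_def)
  have g': "g x \<in> K - B" "g' (g x) = x" if "x \<in> K - A" for x using g that by (auto simp: homeomorphism_def)
  have g'': "g' x \<in> K - A" "g (g' x) = x" if "x \<in> K - B" for x using g that by (auto simp: homeomorphism_def)
  have "homeomorphism K K (\<lambda>x. if x \<in> A then f x else g x) (\<lambda>x. if x \<in> B then f' x else g' x)"
  proof (rule homeomorphismI)
    show "continuous_on K (\<lambda>x. if x \<in> A then f x else g x)"
      using f g by (intro glue A) (auto simp: homeomorphism_def)
    show "continuous_on K (\<lambda>x. if x \<in> B then f' x else g' x)"
      using f g by (intro glue A) (auto simp: homeomorphism_def)
  qed (use f' f'' g' g'' AK in auto)
  then obtain h where "h \<in> HS K" "\<And>x. x \<in> K \<Longrightarrow> app h x = (if x \<in> A then f x else g x)"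
    by (rule HS_of_homeomorphism) (rule that)
  then show ?thesis using AK by (intro that[of h]) auto
qed

text \<open>The sets \<open>E i\<close> accumulate only at \<open>p\<close>.\<close>

lemma continuous_on_glue_null_family:
  fixes W :: "'a::metric_space set" and E :: "'i \<Rightarrow> 'a set"
  assumes W: "compact W" and E: "\<And>i. clp W (E i)"
    and null: "\<And>V. open V \<Longrightarrow> p \<in> V \<Longrightarrow> finite {i. \<not> E i \<subseteq> V}" and p: "\<And>i. p \<notin> E i"
    and \<sigma>: "inj \<sigma>"
    and F: "\<And>i. continuous_on (E i) F" "\<And>i. F ` E i \<subseteq> E (\<sigma> i)" "\<And>x. (\<And>i. x \<notin> E i) \<Longrightarrow> F x = x"
  shows "continuous_on W F"
  unfolding continuous_on_def
proof
  fix x assume x: "x \<in> W"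
  have closed: "closed (\<Union>i\<in>I. E i)" if "finite I" for I
    using that clp_closed(1)[OF W E] by blast
  consider i where "x \<in> E i" | "\<And>i. x \<notin> E i" "x \<noteq> p" | "x = p" by blast
  then show "(F \<longlongrightarrow> F x) (at x within W)"
  proof cases
    case (1 i)
    obtain T where T: "open T" "E i = W \<inter> T" using clp_openin[OF E[of i]] by (auto simp: openin_open)
    have "at x within W = at x within E i"
      by (rule at_within_nhd[of _ T]) (use T 1 in auto)
    then show ?thesis using F(1)[of i] 1 by (simp add: continuous_on_def)
  next
    case 2
    obtain T V where OV: "open T" "open V" "x \<in> T" "p \<in> V" "T \<inter> V = {}"
      using hausdorff[OF 2(2)] by blast
    \<comment> \<open>Only the finitely many \<open>E i\<close> not contained in \<open>V\<close>
      can meet \<open>T\<close>; removing them leaves a neighbourhood of \<open>x\<close> on which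
      \<open>F\<close> is the identity.\<close>
    let ?O = "T - (\<Union>i\<in>{i. \<not> E i \<subseteq> V}. E i)"
    have "open ?O" using OV closed[OF null[OF OV(2,4)]] by (intro open_Diff)
    moreover have "x \<in> ?O" using 2 OV(3) by auto
    moreover have "F y = y" if "y \<in> ?O" for y using that OV(5) by (intro F(3)) auto
    ultimately have ev: "eventually (\<lambda>y. y = F y) (at x within W)"
      unfolding eventually_at_topological by (intro exI[of _ ?O]) simp
    have "F x = x" using 2 by (intro F(3)) auto
    then show ?thesis using Lim_transform_eventually[OF tendsto_ident_at ev] by simp
  next
    case 3
    have Fp: "F p = p" using p by (intro F(3)) auto
    show ?thesis unfolding 3 Fp
    proof (rule topological_tendstoI)
      fix V assume V: "open V" "p \<in> V"
      \<comment> \<open>Injectivity of \<open>\<sigma>\<close> keeps finite the set of indices whose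
        target \<open>E (\<sigma> i)\<close> leaves \<open>V\<close>.\<close>
      let ?O = "V - (\<Union>i\<in>\<sigma> -` {i. \<not> E i \<subseteq> V}. E i)"
      have "open ?O" using V(1) closed[OF finite_vimageI[OF null[OF V] \<sigma>]] by (intro open_Diff)
      moreover have "p \<in> ?O" using p V(2) by auto
      moreover have "F y \<in> V" if "y \<in> ?O" for y
      proof (cases "\<exists>i. y \<in> E i")
        case True
        then obtain i where i: "y \<in> E i" by blast
        then have "E (\<sigma> i) \<subseteq> V" using that by auto
        then show ?thesis using F(2)[of i] i by blast
      next
        case False
        then show ?thesis using F(3)[of y] that by auto
      qed
      ultimately show "eventually (\<lambda>y. F y \<in> V) (at p within W)"
        unfolding eventually_at_topological by (intro exI[of _ ?O]) simp
    qed
  qed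
qed

text \<open>The inverse is glued from the inverse pieces over the inverse index permutation, so the
  same continuity criterion applies to both maps.\<close>

lemma HS_glue_null_family:
  fixes W :: "'a::metric_space set" and E :: "'i \<Rightarrow> 'a set"
  assumes W: "compact W" and E: "\<And>i. clp W (E i)" "\<And>i j x. x \<in> E i \<Longrightarrow> x \<in> E j \<Longrightarrow> i = j"
    and null: "\<And>V. open V \<Longrightarrow> p \<in> V \<Longrightarrow> finite {i. \<not> E i \<subseteq> V}" and p: "\<And>i. p \<notin> E i"
    and \<sigma>: "bij \<sigma>" and f: "\<And>i. homeomorphism (E i) (E (\<sigma> i)) (f i) (g i)"
  obtains h where "h \<in> HS W" "\<And>i x. x \<in> E i \<Longrightarrow> app h x = f i x" "\<And>x. \<forall>i. x \<notin> E i \<Longrightarrow> app h x = x"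
proof -
  let ?ix = "\<lambda>x. THE i. x \<in> E i" and ?\<tau> = "inv_into UNIV \<sigma>"
  have ix: "?ix x = i" if "x \<in> E i" for x i using that E(2) by blast
  define F where "F x = (if \<exists>i. x \<in> E i then f (?ix x) x else x)" for x
  define G where "G x = (if \<exists>i. x \<in> E i then g (?\<tau> (?ix x)) x else x)" for x
  have F: "F x = f i x" if "x \<in> E i" for x i using ix[OF that] that by (auto simp: F_def)
  have G: "G x = g (?\<tau> i) x" if "x \<in> E i" for x i using ix[OF that] that by (auto simp: G_def)
  have f': "f i x \<in> E (\<sigma> i)" "g i (f i x) = x" if "x \<in> E i" for i x
    using f[of i] that by (auto simp: homeomorphism_def)
  have g': "g i x \<in> E i" "f i (g i x) = x" if "x \<in> E (\<sigma> i)" for i x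
    using f[of i] that by (auto simp: homeomorphism_def)
  have st: "\<sigma> (?\<tau> i) = i" "?\<tau> (\<sigma> i) = i" for i
    using \<sigma> by (simp_all add: bij_is_surj surj_f_inv_f bij_is_inj)
  have FE: "F x \<in> E (\<sigma> i)" "G (F x) = x" if "x \<in> E i" for x i
    using that f' F[OF that] G[of "F x" "\<sigma> i"] st by auto
  have GE: "G x \<in> E (?\<tau> i)" "F (G x) = x" if "x \<in> E i" for x i
    using that g'[of x "?\<tau> i"] G[OF that] F[of "G x" "?\<tau> i"] st by auto
  have out: "F x = x" "G x = x" if "\<And>i. x \<notin> E i" for x using that by (auto simp: F_def G_def)
  have cF: "continuous_on (E i) F" for i
    using f[of i] F by (auto simp: homeomorphism_def cong: continuous_on_cong)
  have cG: "continuous_on (E i) G" for i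
    using f[of "?\<tau> i"] G st by (auto simp: homeomorphism_def cong: continuous_on_cong)
  have EW: "E i \<subseteq> W" for i by (rule clp_subset[OF E(1)])
  have GF: "F x \<in> W \<and> G (F x) = x" "G x \<in> W \<and> F (G x) = x" if "x \<in> W" for x
    by (cases "\<exists>i. x \<in> E i"; use FE GE EW out that in \<open>metis subsetD\<close>)+
  have "homeomorphism W W F G"
  proof (rule homeomorphismI)
    show "continuous_on W F"
      by (rule continuous_on_glue_null_family[OF W E(1) null p bij_is_inj[OF \<sigma>] cF])
        (use FE out in auto)
    show "continuous_on W G"
      by (rule continuous_on_glue_null_family[OF W E(1) null p bij_is_inj[OF bij_imp_bij_inv[OF \<sigma>]] cG])
        (use GE out in auto)
  qed (use GF in auto)
  then obtain h where h: "h \<in> HS W" "\<And>x. x \<in> W \<Longrightarrow> app h x = F x"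
    by (rule HS_of_homeomorphism) (rule that)
  show ?thesis
  proof (rule that[OF h(1)])
    show "app h x = f i x" if "x \<in> E i" for i x using h(2)[of x] F[OF that] EW[of i] that by auto
    show "app h x = x" if "\<forall>i. x \<notin> E i" for x
      using h(2)[of x] out(1)[of x] HS_id[OF h(1), of x] that by metis
  qed
qed

text \<open>Strictness, obtained by cutting off a second point at each stage, makes the differences
  of consecutive sets nonempty; being clopen, they are Cantor sets.\<close>

lemma shrinking_clopen_sets:
  fixes W :: "'a::metric_space set"
  assumes W: "cantor_set W" and p: "p \<in> W"
  obtains U where "U 0 = W" "\<And>k::nat. clp W (U k)" "\<And>k. p \<in> U k" "\<And>k. U (Suc k) \<subset> U k"
    "\<And>V. open V \<Longrightarrow> p \<in> V \<Longrightarrow> \<forall>\<^sub>F k in sequentially. U k \<subseteq> V"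
proof -
  let ?e = "\<lambda>k. inverse (real k)"
  have "\<exists>U. \<forall>k. (clp W (U k) \<and> p \<in> U k \<and> (k = 0 \<longrightarrow> U k = W)) \<and>
      (U (Suc k) \<subset> U k \<and> U (Suc k) \<subseteq> ball p (?e (Suc k)))"
  proof (rule dependent_nat_choice)
    show "\<exists>U. clp W U \<and> p \<in> U \<and> (0 = (0::nat) \<longrightarrow> U = W)" using p by auto
  next
    fix U and k :: nat assume U: "clp W U \<and> p \<in> U \<and> (k = 0 \<longrightarrow> U = W)"
    then have cU: "cantor_set U" using clp_cantor[OF W] by blast
    obtain q where q: "q \<in> U" "q \<noteq> p" using cantor_other_point[OF cU] U by blast
    obtain V where V: "clp U V" "p \<in> V" "V \<subseteq> ball p (?e (Suc k)) - {q}"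
      by (rule clp_nbhd[OF cU, of p "ball p (?e (Suc k)) - {q}"]) (use U q in \<open>auto intro: open_Diff\<close>)
    have "clp W V" using U V(1) clp_trans by blast
    moreover have "V \<subset> U" using clp_subset[OF V(1)] V(3) q(1) by blast
    moreover have "V \<subseteq> ball p (?e (Suc k))" using V(3) by blast
    ultimately show "\<exists>V. (clp W V \<and> p \<in> V \<and> (Suc k = 0 \<longrightarrow> V = W)) \<and> V \<subset> U \<and> V \<subseteq> ball p (?e (Suc k))"
      using V(2) nat.distinct(2) by metis
  qed
  then obtain U where *: "\<And>k::nat. (clp W (U k) \<and> p \<in> U k \<and> (k = 0 \<longrightarrow> U k = W)) \<and>
      (U (Suc k) \<subset> U k \<and> U (Suc k) \<subseteq> ball p (?e (Suc k)))" by blast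
  have U: "clp W (U k)" "p \<in> U k" "U 0 = W" "U (Suc k) \<subset> U k"
    "U (Suc k) \<subseteq> ball p (?e (Suc k))" for k using *[of k] *[of 0] by auto
  show ?thesis
  proof (rule that[OF U(3,1,2,4)])
    fix V assume "open V" "p \<in> V"
    then obtain e where e: "e > 0" "ball p e \<subseteq> V" by (meson open_contains_ball)
    obtain N where N: "?e (Suc N) < e" using reals_Archimedean[OF e(1)] by blast
    have "U k \<subseteq> V" if k: "Suc N \<le> k" for k
    proof -
      obtain j where j: "k = Suc j" "N \<le> j" using k by (cases k) auto
      have "?e (Suc j) \<le> ?e (Suc N)" using j by (intro le_imp_inverse_le) auto
      then have "?e (Suc j) < e" using N by linarith
      then have "ball p (?e (Suc j)) \<subseteq> ball p e" by (rule subset_ball[OF less_imp_le])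
      then show ?thesis using U(5)[of j] e(2) j(1) by blast
    qed
    then show "\<forall>\<^sub>F k in sequentially. U k \<subseteq> V" by (auto simp: eventually_sequentially)
  qed
qed

text \<open>Disjoint copies \<open>E i\<close> of \<open>A = E 0\<close>, indexed by the integers, are shifted by \<open>t\<close>, and \<open>d h\<close> acts as a copy
  of \<open>h\<close> on each \<open>E i\<close> with \<open>i\<close> positive.\<close>

lemma mitosis_data:
  fixes W :: "'a::metric_space set"
  assumes W: "cantor_set W" and A: "clp W A" "A \<noteq> {}" "A \<noteq> W"
  obtains t d where "t \<in> HS W" "\<And>h. h \<in> HS A \<Longrightarrow> d h \<in> HS W"
    "\<And>h k. h \<in> HS A \<Longrightarrow> k \<in> HS A \<Longrightarrow> d (h + k) = d h + d k"
    "\<And>h k. h \<in> HS A \<Longrightarrow> k \<in> HS A \<Longrightarrow> d k + h = h + d k"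
    "\<And>h. h \<in> HS A \<Longrightarrow> - t + d h + t = h + d h"
proof -
  have cW: "compact W" using W by (simp add: cantor_set_def)
  have AW: "A \<subseteq> W" by (rule clp_subset[OF A(1)])
  have WA: "clp W (W - A)" by (rule clp_Diff[OF clp_self A(1)])
  obtain p where p: "p \<in> W - A" using A AW by blast
  obtain U where U: "U 0 = W - A" "\<And>k::nat. clp (W - A) (U k)" "\<And>k. p \<in> U k" "\<And>k. U (Suc k) \<subset> U k"
    "\<And>V. open V \<Longrightarrow> p \<in> V \<Longrightarrow> \<forall>\<^sub>F k in sequentially. U k \<subseteq> V"
    by (rule shrinking_clopen_sets[OF clp_cantor[OF W WA] p]) (rule that)
  have U_mono: "U j \<subseteq> U i" if "i \<le> j" for i j
    using that by (induction j rule: dec_induct) (use U(4) in blast)+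
  \<comment> \<open>The copies other than \<open>A\<close> are rings between consecutive
    neighbourhoods of \<open>p\<close>, listed without repetition by
    \<open>int_encode\<close>.\<close>
  define E where "E i = (if i = 0 then A else U (int_encode i) - U (Suc (int_encode i)))" for i :: int
  have E0: "E 0 = A" by (simp add: E_def)
  have EU: "E i \<subseteq> U (int_encode i)" if "i \<noteq> 0" for i using that by (auto simp: E_def)
  have UWA: "U k \<subseteq> W - A" for k by (rule clp_subset[OF U(2)])
  have E_clp: "clp W (E i)" for i
    using A(1) clp_Diff[OF clp_trans[OF WA U(2)] clp_trans[OF WA U(2)]] by (simp add: E_def)
  have E_ne: "E i \<noteq> {}" for i using A(2) U(4)[of "int_encode i"] by (auto simp: E_def)
  have E_disj: "i = j" if x: "x \<in> E i" "x \<in> E j" for i j x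
  proof (rule ccontr)
    assume "i \<noteq> j"
    have *: False if "i \<noteq> 0" "j \<noteq> 0" "int_encode i < int_encode j" "x \<in> E i" "x \<in> E j" for i j
    proof -
      have "U (int_encode j) \<subseteq> U (Suc (int_encode i))" using that by (intro U_mono) simp
      then show False using that EU[of j] by (auto simp: E_def)
    qed
    have 0: False if "i \<noteq> 0" "x \<in> E i" "x \<in> A" for i using that EU[of i] UWA by blast
    show False
    proof (cases "i = 0 \<or> j = 0")
      case True
      then show False using 0 x \<open>i \<noteq> j\<close> E0 by metis
    next
      case False
      moreover have "int_encode i \<noteq> int_encode j" using \<open>i \<noteq> j\<close> by (simp add: int_encode_eq)
      ultimately show False using * x by (metis linorder_neqE_nat)
    qed
  qed
  have null: "finite {i. \<not> E i \<subseteq> V}" if V: "open V" "p \<in> V" for V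
  proof -
    obtain N where N: "\<And>k. N \<le> k \<Longrightarrow> U k \<subseteq> V"
      using U(5)[OF V] by (auto simp: eventually_sequentially)
    have "{i. \<not> E i \<subseteq> V} \<subseteq> insert 0 (int_encode -` {..<N})"
    proof
      fix i assume "i \<in> {i. \<not> E i \<subseteq> V}"
      then have "i = 0 \<or> \<not> N \<le> int_encode i" using N[of "int_encode i"] EU[of i] by blast
      then show "i \<in> insert 0 (int_encode -` {..<N})" by auto
    qed
    moreover have "finite (int_encode -` {..<N})" by (intro finite_vimageI) (auto simp: inj_int_encode)
    ultimately show ?thesis using finite_subset by blast
  qed
  have pE: "p \<notin> E i" for i using p U(3) by (auto simp: E_def)
  have "\<exists>f g. homeomorphism A (E i) f g" for i
    using cantor_sets_homeomorphic[OF clp_cantor[OF W A(1)] A(2) clp_cantor[OF W E_clp] E_ne] by metis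
  then obtain \<theta>' \<phi>' where \<theta>': "\<And>i. homeomorphism A (E i) (\<theta>' i) (\<phi>' i)" by metis
  \<comment> \<open>\<open>E 0\<close> is identified with \<open>A\<close> by the identity, so that
    the copy of \<open>h\<close> on \<open>E 0\<close> is \<open>h\<close> itself.\<close>
  define \<theta> where "\<theta> i = (if i = 0 then (\<lambda>x. x) else \<theta>' i)" for i
  define \<phi> where "\<phi> i = (if i = 0 then (\<lambda>x. x) else \<phi>' i)" for i
  have \<theta>: "homeomorphism A (E i) (\<theta> i) (\<phi> i)" for i
    using \<theta>' by (simp add: \<theta>_def \<phi>_def E0 homeomorphism_ident)
  have \<theta>E: "\<theta> i a \<in> E i" "\<phi> i (\<theta> i a) = a" if "a \<in> A" for i a
    using \<theta>[of i] that by (auto simp: homeomorphism_def)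
  have E\<theta>: "\<exists>a\<in>A. x = \<theta> i a" if "x \<in> E i" for i x
    using \<theta>[of i] that by (auto simp: homeomorphism_def)
  have \<theta>0: "\<theta> 0 a = a" for a by (simp add: \<theta>_def)
  have "homeomorphism (E i) (E (i + 1)) (\<theta> (i + 1) \<circ> \<phi> i) (\<theta> i \<circ> \<phi> (i + 1))" for i
    by (rule homeomorphism_compose[OF homeomorphism_symD[OF \<theta>] \<theta>])
  moreover have "bij (\<lambda>i::int. i + 1)" by (rule bij_betw_byWitness[of _ "\<lambda>i. i - 1"]) auto
  ultimately obtain t where t: "t \<in> HS W" "\<And>i x. x \<in> E i \<Longrightarrow> app t x = (\<theta> (i + 1) \<circ> \<phi> i) x"
    "\<And>x. \<forall>i. x \<notin> E i \<Longrightarrow> app t x = x"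
    by - (rule HS_glue_null_family[OF cW E_clp E_disj null pE, where \<sigma> = "\<lambda>i. i + 1"], assumption+, rule that)
  have t\<theta>: "app t (\<theta> i a) = \<theta> (i + 1) a" if "a \<in> A" for i a
    using t(2)[of "\<theta> i a" i] \<theta>E[OF that] by simp
  have "\<exists>e\<in>HS W. (\<forall>i a. 1 \<le> i \<longrightarrow> a \<in> A \<longrightarrow> app e (\<theta> i a) = \<theta> i (app h a)) \<and>
      (\<forall>x. (\<forall>i\<ge>1. x \<notin> E i) \<longrightarrow> app e x = x)" if h: "h \<in> HS A" for h
  proof -
    let ?f = "\<lambda>i. if 1 \<le> i then \<theta> i \<circ> (app h \<circ> \<phi> i) else (\<lambda>x. x)"
    let ?g = "\<lambda>i. if 1 \<le> i then \<theta> i \<circ> (app (- h) \<circ> \<phi> i) else (\<lambda>x. x)"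
    have hA: "homeomorphism A A (app h) (app (- h))"
      using h HS_minus[OF h] by (auto simp: homeomorphism_def HS_image HS_continuous)
    have hE: "homeomorphism (E i) (E (id i)) (?f i) (?g i)" for i
    proof -
      have "homeomorphism (E i) (E i) (\<theta> i \<circ> (app h \<circ> \<phi> i)) (\<theta> i \<circ> app (- h) \<circ> \<phi> i)"
        by (rule homeomorphism_compose[OF homeomorphism_compose[OF homeomorphism_symD[OF \<theta>] hA] \<theta>])
      then show ?thesis by (simp add: homeomorphism_ident comp_assoc)
    qed
    from hE bij_id obtain e where e: "e \<in> HS W" "\<And>i x. x \<in> E i \<Longrightarrow> app e x = ?f i x"
      "\<And>x. \<forall>i. x \<notin> E i \<Longrightarrow> app e x = x"
      by - (rule HS_glue_null_family[OF cW E_clp E_disj null pE, where \<sigma> = id], assumption+, rule that)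
    have "app e (\<theta> i a) = \<theta> i (app h a)" if "1 \<le> i" "a \<in> A" for i a
      using e(2)[of "\<theta> i a" i] \<theta>E[OF that(2)] that by simp
    moreover have "app e x = x" if "\<forall>i\<ge>1. x \<notin> E i" for x
    proof (cases "\<exists>i. x \<in> E i")
      case True
      then obtain i where i: "x \<in> E i" by blast
      then have "\<not> 1 \<le> i" using that by blast
      then show ?thesis using e(2)[OF i] by simp
    qed (use e(3) in blast)
    ultimately show ?thesis using e(1) by blast
  qed
  then obtain d where d: "\<And>h. h \<in> HS A \<Longrightarrow> d h \<in> HS W"
    "\<And>h i a. h \<in> HS A \<Longrightarrow> 1 \<le> i \<Longrightarrow> a \<in> A \<Longrightarrow> app (d h) (\<theta> i a) = \<theta> i (app h a)"
    "\<And>h x. h \<in> HS A \<Longrightarrow> (\<And>i. 1 \<le> i \<Longrightarrow> x \<notin> E i) \<Longrightarrow> app (d h) x = x" by metis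
  have h\<theta>: "app h (\<theta> i a) = \<theta> i a" if "h \<in> HS A" "i \<noteq> 0" "a \<in> A" for h i a
    using that E_disj[OF \<theta>E(1)[OF that(3)], of i 0] by (intro HS_id[OF that(1)]) (auto simp: E0)
  have d\<theta>: "app (d h) (\<theta> i a) = \<theta> i a" if "h \<in> HS A" "i \<le> 0" "a \<in> A" for h i a
    using that E_disj[OF \<theta>E(1)[OF that(3)], of i] by (intro d(3)[OF that(1)]) fastforce
  have cases: "(\<exists>a\<in>A. x = a) \<or> (\<exists>i a. 1 \<le> i \<and> a \<in> A \<and> x = \<theta> i a) \<or> (\<exists>i a. i < 0 \<and> a \<in> A \<and> x = \<theta> i a)
      \<or> (\<forall>i. x \<notin> E i)" for x
  proof -
    have "(\<exists>i a. a \<in> A \<and> x = \<theta> i a) \<or> (\<forall>i. x \<notin> E i)" using E\<theta> by blast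
    then consider i a where "a \<in> A" "x = \<theta> i a" | "\<forall>i. x \<notin> E i" by blast
    then show ?thesis
    proof cases
      case (1 i a)
      consider "i = 0" | "1 \<le> i" | "i < 0" by linarith
      then show ?thesis by cases (use 1 \<theta>0 in blast)+
    qed blast
  qed
  have hA: "app h a \<in> A" if "h \<in> HS A" "a \<in> A" for h a using that HS_mem by blast
  have dA: "app (d h) a = a" if "h \<in> HS A" "a \<in> A" for h a
    using d\<theta>[of h 0 a] that \<theta>0 by simp
  have out: "app h x = x" "app (d h) x = x" if "h \<in> HS A" "\<forall>i. x \<notin> E i" for h x
    using that HS_id[OF that(1), of x] d(3)[OF that(1), of x] E0 by auto
  show ?thesis
  proof (rule that[OF t(1) d(1)])
    fix h k assume h: "h \<in> HS A" and k: "k \<in> HS A"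
    have hk: "h + k \<in> HS A" by (rule HS_add[OF h k])
    show "d (h + k) = d h + d k"
    proof (rule perm_eqI)
      fix x show "app (d (h + k)) x = app (d h + d k) x"
        using cases[of x] h k hk by (auto simp: dA hA d(2) d\<theta> out)
    qed
    show "d k + h = h + d k"
    proof (rule perm_eqI)
      fix x show "app (d k + h) x = app (h + d k) x"
        using cases[of x] h k by (auto simp: dA hA d(2) d\<theta> h\<theta> out)
    qed
  next
    fix h assume h: "h \<in> HS A"
    \<comment> \<open>Conjugation by the shift moves the copies on positive indices to the
      nonnegative ones, and the copy gained on \<open>E 0\<close> is \<open>h\<close>.\<close>
    have "d h + t = t + (h + d h)"
    proof (rule perm_eqI)
      fix x
      have t0: "app t a = \<theta> 1 a" if "a \<in> A" for a using t\<theta>[OF that, of 0] \<theta>0 by simp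
      consider "x \<in> A" | i a where "1 \<le> i" "a \<in> A" "x = \<theta> i a" | i a where "i < 0" "a \<in> A" "x = \<theta> i a"
        | "\<forall>i. x \<notin> E i" using cases[of x] by blast
      then show "app (d h + t) x = app (t + (h + d h)) x"
      proof cases
        case 1
        then show ?thesis using h by (simp add: t0 d(2) dA hA)
      next
        case (2 i a)
        then show ?thesis using h by (simp add: t\<theta> d(2) h\<theta> hA)
      next
        case (3 i a)
        then show ?thesis using h by (simp add: t\<theta> d\<theta> h\<theta>)
      next
        case 4
        then show ?thesis using h t(3)[of x] by (simp add: out)
      qed
    qed
    then show "- t + d h + t = h + d h" by (simp add: add.assoc)
  qed
qed

section \<open>Homeomorphisms with trivial germs along a set\<close>

text \<open>The neighbourhood is open in the ambient space. As the elements are the identity off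
  \<open>K\<close>, neighbourhoods in \<open>K\<close> give the same group
  (\<open>DS_I_openin\<close>).\<close>

definition DS :: "'a::topological_space set \<Rightarrow> 'a set \<Rightarrow> 'a perm set" where
  "DS K F = {f \<in> HS K. \<exists>U. open U \<and> F \<subseteq> U \<and> (\<forall>x\<in>U. app f x = x)}"

lemma DS_subset_HS: "DS K F \<subseteq> HS K"
  by (auto simp: DS_def)

lemma DS_fix: "f \<in> DS K F \<Longrightarrow> x \<in> F \<Longrightarrow> app f x = x"
  by (auto simp: DS_def)

lemma DS_iff_points: "f \<in> DS K F \<longleftrightarrow> f \<in> HS K \<and> (\<forall>x\<in>F. f \<in> DS K {x})"
proof (intro iffI conjI)
  assume *: "f \<in> HS K \<and> (\<forall>x\<in>F. f \<in> DS K {x})"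
  let ?U = "\<Union>{U. open U \<and> (\<forall>x\<in>U. app f x = x)}"
  have "open ?U" by blast
  moreover have "F \<subseteq> ?U"
  proof
    fix x assume "x \<in> F"
    then obtain U where "open U" "x \<in> U" "\<forall>x\<in>U. app f x = x" using * by (auto simp: DS_def)
    then show "x \<in> ?U" by blast
  qed
  moreover have "\<forall>x\<in>?U. app f x = x" by blast
  ultimately show "f \<in> DS K F" using * unfolding DS_def by blast
qed (auto simp: DS_def)

lemma DS_I_openin:
  assumes f: "f \<in> HS K" and V: "openin (top_of_set K) V" "F \<subseteq> V" "\<And>x. x \<in> V \<Longrightarrow> app f x = x"
  shows "f \<in> DS K F"
proof -
  obtain O' where O': "open O'" "V = K \<inter> O'" using V(1) by (auto simp: openin_open)
  have "app f x = x" if "x \<in> O'" for x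
    using that V(3) O'(2) HS_id[OF f] by (cases "x \<in> K") auto
  then show ?thesis using f O' V(2) unfolding DS_def by blast
qed

lemma openin_HS_vimage:
  assumes "f \<in> HS K" "open U"
  shows "openin (top_of_set K) {x \<in> K. app f x \<in> U}"
proof -
  have "openin (top_of_set K) (K \<inter> app f -` U)"
    using HS_continuous[OF assms(1)] assms(2) by (rule continuous_openin_preimage_gen)
  moreover have "K \<inter> app f -` U = {x \<in> K. app f x \<in> U}" by auto
  ultimately show ?thesis by simp
qed

lemma subgrp_DS: "subgrp (DS K F)"
proof (rule subgrpI)
  show "0 \<in> DS K F" using subgrp_0[OF subgrp_HS] by (auto simp: DS_def)
next
  fix f g assume fg: "f \<in> DS K F" "g \<in> DS K F"
  then obtain U V where UV: "open U" "F \<subseteq> U" "\<forall>x\<in>U. app f x = x" "open V" "F \<subseteq> V" "\<forall>x\<in>V. app g x = x"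
    by (auto simp: DS_def)
  then have "open (U \<inter> V)" "F \<subseteq> U \<inter> V" "\<forall>x\<in>U \<inter> V. app (f + g) x = x" by auto
  then show "f + g \<in> DS K F" using fg HS_add unfolding DS_def by blast
next
  fix f assume "f \<in> DS K F"
  then obtain U where U: "f \<in> HS K" "open U" "F \<subseteq> U" "\<forall>x\<in>U. app f x = x" by (auto simp: DS_def)
  moreover have "\<forall>x\<in>U. app (- f) x = x" using U(4) by (metis app_minus_app)
  ultimately show "- f \<in> DS K F" unfolding DS_def using HS_minus by blast
qed

lemma DS_conj:
  assumes g: "g \<in> HS K" and f: "f \<in> DS K F" and F: "F \<subseteq> K"
  shows "g + f - g \<in> DS K (app g ` F)"
proof -
  obtain U where U: "open U" "F \<subseteq> U" "\<forall>x\<in>U. app f x = x" using f by (auto simp: DS_def)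
  have app: "app (g + f - g) x = app g (app f (app (- g) x))" for x
    by simp
  show ?thesis
  proof (rule DS_I_openin)
    show "g + f - g \<in> HS K"
      using g f DS_subset_HS unfolding diff_conv_add_uminus by (blast intro: HS_add HS_minus)
    show "openin (top_of_set K) {x \<in> K. app (- g) x \<in> U}"
      by (rule openin_HS_vimage[OF HS_minus[OF g] U(1)])
    show "app g ` F \<subseteq> {x \<in> K. app (- g) x \<in> U}"
      using U(2) F HS_mem[OF g] by auto
  qed (use U(3) in \<open>simp add: app\<close>)
qed

lemma HS_subset_DS:
  fixes K :: "'a::metric_space set"
  assumes K: "compact K" and A: "clp K A" "A \<inter> F = {}"
  shows "HS A \<subseteq> DS K F"
proof
  fix f assume f: "f \<in> HS A"
  have "open (- A)" using clp_closed(1)[OF K A(1)] by (rule open_Compl)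
  moreover have "F \<subseteq> - A" "\<forall>x\<in>- A. app f x = x" using A(2) HS_id[OF f] by auto
  ultimately show "f \<in> DS K F" using f HS_mono[OF K A(1)] unfolding DS_def by blast
qed

text \<open>\<open>A k\<close> is the complement of a small clopen neighbourhood of
  \<open>F\<close>. A clopen piece of that neighbourhood missing \<open>F\<close> is added to form
  \<open>W k\<close>: it is the room that mitosis needs, and \<open>HS (W k)\<close> still lies in
  \<open>DS K F\<close>.\<close>

lemma DS_exhaustion:
  fixes K :: "'a::metric_space set"
  assumes K: "cantor_set K" and F: "finite F" "F \<noteq> {}" "F \<subseteq> K"
  obtains A W :: "nat \<Rightarrow> 'a set" where
    "\<And>f. f \<in> DS K F \<Longrightarrow> \<forall>\<^sub>F k in sequentially. f \<in> HS (A k)"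
    "\<And>k. clp K (W k)" "\<And>k. W k \<inter> F = {}" "\<And>k. clp (W k) (A k)" "\<And>k. A k \<noteq> W k"
proof -
  have cK: "compact K" using K by (simp add: cantor_set_def)
  let ?B = "\<lambda>k. \<Union>x\<in>F. ball x (inverse (real (Suc k)))"
  have "\<exists>U. clp K U \<and> F \<subseteq> U \<and> U \<subseteq> ?B k" for k
  proof -
    have "F \<subseteq> ?B k" by auto
    then show ?thesis
      using clp_separate[OF K finite_imp_closed[OF F(1)] F(3), of "?B k"] by blast
  qed
  then obtain U where U: "\<And>k. clp K (U k)" "\<And>k. F \<subseteq> U k" "\<And>k. U k \<subseteq> ?B k" by metis
  have "\<exists>V. clp K V \<and> V \<noteq> {} \<and> V \<subseteq> U k - F" for k
  proof -
    have cU: "cantor_set (U k)" by (rule clp_cantor[OF K U(1)])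
    have "infinite (U k)" using cantor_infinite[OF cU] U(2) F(2) by blast
    then obtain p where p: "p \<in> U k" "p \<notin> F" using F(1) by (meson finite_subset subsetI)
    obtain V where "clp (U k) V" "p \<in> V" "V \<subseteq> - F"
      using clp_nbhd[OF cU p(1), of "- F"] p(2) finite_imp_closed[OF F(1)] by blast
    then show ?thesis using clp_trans[OF U(1)] clp_subset by blast
  qed
  then obtain V where V: "\<And>k. clp K (V k)" "\<And>k. V k \<noteq> {}" "\<And>k. V k \<subseteq> U k - F" by metis
  define A W where "A k = K - U k" and "W k = A k \<union> V k" for k
  have clpA: "clp K (A k)" for k unfolding A_def by (rule clp_Diff[OF clp_self U(1)])
  show ?thesis
  proof (rule that[of A W])
    fix f assume f: "f \<in> DS K F"
    then obtain T where T: "open T" "F \<subseteq> T" "\<forall>x\<in>T. app f x = x" by (auto simp: DS_def)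
    have "\<forall>x\<in>F. \<exists>e>0. ball x e \<subseteq> T" using T by (meson open_contains_ball subsetD)
    then obtain e where e: "\<And>x. x \<in> F \<Longrightarrow> e x > 0" "\<And>x. x \<in> F \<Longrightarrow> ball x (e x) \<subseteq> T" by metis
    have "\<forall>\<^sub>F k in sequentially. \<forall>x\<in>F. inverse (real (Suc k)) < e x"
    proof (intro eventually_ball_finite F(1) ballI)
      fix x assume "x \<in> F"
      then show "\<forall>\<^sub>F k in sequentially. inverse (real (Suc k)) < e x"
        using order_tendstoD(2)[OF LIMSEQ_inverse_real_of_nat e(1)] by blast
    qed
    then show "\<forall>\<^sub>F k in sequentially. f \<in> HS (A k)"
    proof eventually_elim
      case (elim k)
      have "U k \<subseteq> T"
      proof
        fix y assume "y \<in> U k"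
        then obtain x where x: "x \<in> F" "y \<in> ball x (inverse (real (Suc k)))" using U(3) by blast
        then have "y \<in> ball x (e x)" using elim by fastforce
        then show "y \<in> T" using e(2) x(1) by blast
      qed
      then have "app f x = x" if "x \<notin> A k" for x
        using that T(3) HS_id[of f K x] f DS_subset_HS[of K F] by (cases "x \<in> K") (auto simp: A_def)
      moreover have "continuous_on (A k) (app f)" "continuous_on (A k) (app (- f))"
        using f DS_subset_HS HS_minus HS_continuous continuous_on_subset[OF _ clp_subset[OF clpA]] by blast+
      ultimately show ?case by (simp add: HS_def)
    qed
  next
    fix k
    show W: "clp K (W k)" unfolding W_def by (rule clp_Un[OF clpA V(1)])
    show "W k \<inter> F = {}" using U(2)[of k] V(3)[of k] by (auto simp: W_def A_def)
    have "W k \<inter> A k = A k" by (auto simp: W_def)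
    then show "clp (W k) (A k)" using clp_restrict[OF clpA clp_subset[OF W]] by metis
    show "A k \<noteq> W k" using V(2,3)[of k] by (auto simp: W_def A_def)
  qed
qed

text \<open>\<open>k\<close> is kept on a small clopen set around \<open>x\<close>, and the
  complements of this set and of its image are matched by Brouwer's theorem; all this happens inside
  a clopen set disjoint from \<open>F\<close>.\<close>

lemma extend_germ:
  fixes K :: "'a::metric_space set"
  assumes K: "cantor_set K" and F: "finite F" "F \<subseteq> K" and k: "k \<in> HS K"
    and x: "x \<in> K" "x \<notin> F" "app k x \<notin> F"
  obtains s U where "s \<in> DS K F" "open U" "x \<in> U" "\<And>y. y \<in> U \<Longrightarrow> app s y = app k y"
proof -
  have cK: "compact K" using K by (simp add: cantor_set_def)
  obtain V where V: "clp K V" "F \<subseteq> V" "V \<subseteq> - {x, app k x}"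
  proof (rule clp_separate[OF K finite_imp_closed[OF F(1)] F(2), of "- {x, app k x}"])
    show "open (- {x, app k x})" by (intro open_Compl finite_imp_closed) simp
  qed (use x in auto)
  define W where "W = K - V"
  have W: "clp K W" unfolding W_def by (rule clp_Diff[OF clp_self V(1)])
  have xW: "x \<in> W" "app k x \<in> W" using x V(3) HS_mem[OF k] by (auto simp: W_def)
  have cW: "cantor_set W" by (rule clp_cantor[OF K W])
  have "infinite W" using cantor_infinite[OF cW] xW by blast
  \<comment> \<open>\<open>q\<close> will lie outside both the small set and its image, so that the
    two complements in \<open>W\<close> are nonempty.\<close>
  then obtain q where q: "q \<in> W" "q \<noteq> x" "q \<noteq> app k x"
    using infinite_imp_nonempty[of "W - {x, app k x}"] by auto
  \<comment> \<open>On \<open>N\<close> both a point and its image under \<open>k\<close> stay in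
    \<open>W\<close>, hence away from \<open>F\<close>.\<close>
  define N where "N = W \<inter> {z \<in> K. app k z \<in> W}"
  have N: "clp K N" unfolding N_def by (rule clp_Int[OF W clp_vimage[OF k W]])
  have xN: "x \<in> N" using x xW by (simp add: N_def)
  have "x \<noteq> app (- k) q" using q(3) by auto
  obtain U where U: "clp N U" "x \<in> U" "U \<subseteq> - {q, app (- k) q}"
  proof (rule clp_nbhd[OF clp_cantor[OF K N], of x "- {q, app (- k) q}"])
    show "open (- {q, app (- k) q})" by (intro open_Compl finite_imp_closed) simp
  qed (use q(2) xN \<open>x \<noteq> app (- k) q\<close> in auto)
  have UK: "clp K U" by (rule clp_trans[OF N U(1)])
  have UW: "U \<subseteq> W" using clp_subset[OF U(1)] by (auto simp: N_def)
  define U' where "U' = {z \<in> K. app (- k) z \<in> U}"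
  have U'K: "clp K U'" unfolding U'_def by (rule clp_vimage[OF HS_minus[OF k] UK])
  have U'W: "U' \<subseteq> W"
  proof
    fix z assume "z \<in> U'"
    then have "app (- k) z \<in> N" using clp_subset[OF U(1)] by (auto simp: U'_def)
    then have "app k (app (- k) z) \<in> W" unfolding N_def by blast
    then show "z \<in> W" by simp
  qed
  have WU: "clp W U" "clp W U'"
    using clp_restrict[OF UK clp_subset[OF W]] clp_restrict[OF U'K clp_subset[OF W]] UW U'W
    by (simp_all add: Int_absorb1)
  have q': "q \<in> W - U" "q \<in> W - U'" using q(1) U(3) by (auto simp: U'_def)
  have img: "app k ` U = U'"
    using clp_subset[OF UK] HS_mem[OF k] unfolding U'_def by (auto simp: image_iff) (metis app_app_minus)
  have hU: "homeomorphism U U' (app k) (app (- k))"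
  proof (rule homeomorphismI)
    show "continuous_on U (app k)" using HS_continuous[OF k] continuous_on_subset clp_subset[OF UK] by blast
    show "continuous_on U' (app (- k))"
      using HS_continuous[OF HS_minus[OF k]] continuous_on_subset clp_subset[OF U'K] by blast
  qed (use img in \<open>auto simp: U'_def\<close>)
  obtain f g where fg: "homeomorphism (W - U) (W - U') f g"
    using cantor_sets_homeomorphic[OF clp_cantor[OF cW clp_Diff[OF clp_self WU(1)]] _
        clp_cantor[OF cW clp_Diff[OF clp_self WU(2)]]] q' by blast
  have "compact W" using cW by (simp add: cantor_set_def)
  then obtain s where s: "s \<in> HS W" "\<And>z. z \<in> U \<Longrightarrow> app s z = app k z"
      "\<And>z. z \<in> W - U \<Longrightarrow> app s z = f z"
    by (rule homeomorphism_glue[OF _ WU hU fg]) (rule that)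
  obtain T where T: "open T" "U = K \<inter> T" using clp_openin[OF UK] by (auto simp: openin_open)
  have "HS W \<subseteq> DS K F" using V(2) by (intro HS_subset_DS[OF cK W]) (auto simp: W_def)
  then have sD: "s \<in> DS K F" using s(1) by blast
  show ?thesis
  proof (rule that[OF sD T(1)])
    show "x \<in> T" using U(2) T(2) by blast
    show "app s y = app k y" if "y \<in> T" for y
    proof (cases "y \<in> K")
      case True
      then show ?thesis using s(2) T(2) that by blast
    next
      case False
      then show ?thesis using HS_id[OF k] HS_id[of s K y] sD DS_subset_HS[of K F] by auto
    qed
  qed
qed

text \<open>Were the orbit finite, a clopen set missing it could be exchanged with its complement,
  carrying \<open>a\<close> off its orbit. The elements found supply the cone vertices in general
  position.\<close>

lemma infinite_orbit:
  fixes K :: "'a::metric_space set"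
  assumes K: "cantor_set K" and a: "a \<in> K"
  obtains g :: "nat \<Rightarrow> 'a perm" where "\<And>k. g k \<in> HS K" "inj (\<lambda>k. app (g k) a)"
proof -
  have cK: "compact K" using K by (simp add: cantor_set_def)
  let ?O = "(\<lambda>g. app g a) ` HS K"
  have "infinite ?O"
  proof
    assume fin: "finite ?O"
    have "infinite K" using cantor_infinite[OF K] a by blast
    then obtain z where z: "z \<in> K" "z \<notin> ?O" using fin by (meson finite_subset subsetI)
    have aO: "a \<in> ?O" using subgrp_0[OF subgrp_HS] by (metis (no_types) app_0 imageI)
    have "open (- ?O)" using finite_imp_closed[OF fin] by (rule open_Compl)
    then obtain V where V: "clp K V" "z \<in> V" "V \<subseteq> - ?O"
      using clp_nbhd[OF K z(1), of "- ?O"] z(2) by auto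
    have aV: "a \<in> K - V" using a aO V(3) by blast
    have clpV: "clp K (K - V)" by (rule clp_Diff[OF clp_self V(1)])
    obtain f g where fg: "homeomorphism V (K - V) f g"
      using cantor_sets_homeomorphic[OF clp_cantor[OF K V(1)] _ clp_cantor[OF K clpV]] V(2) aV by blast
    have "K - (K - V) = V" using clp_subset[OF V(1)] by auto
    then have "homeomorphism (K - V) (K - (K - V)) g f" using homeomorphism_symD[OF fg] by simp
    then obtain h where h: "h \<in> HS K" "\<And>x. x \<in> K - V \<Longrightarrow> app h x = g x"
      using homeomorphism_glue[OF cK V(1) clpV fg] by metis
    have "app h a \<in> V" using h(2)[OF aV] aV fg by (auto simp: homeomorphism_def)
    then show False using V(3) h(1) by blast
  qed
  then obtain f :: "nat \<Rightarrow> 'a" where f: "inj f" "range f \<subseteq> ?O"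
    using infinite_countable_subset by blast
  then have "\<forall>k. \<exists>g. g \<in> HS K \<and> f k = app g a" by blast
  then obtain g where g: "\<And>k. g k \<in> HS K" "\<And>k. f k = app (g k) a" by metis
  have "(\<lambda>k. app (g k) a) = f" using g(2) by auto
  then show ?thesis using that[of g] g(1) f(1) by simp
qed

section \<open>Bounded acyclicity\<close>

lemma exact_at_mono: "exact_at G S p M R \<Longrightarrow> R \<le> R' \<Longrightarrow> exact_at G S p M R'"
  unfolding exact_at_def by (blast intro: cochain_mono)

text \<open>The cone with apex 0 is a primitive, since invariance under the trivial group is no
  condition. This covers the empty Cantor set.\<close>

lemma exact_at_trivial: "exact_at {0::'g::group_add} {0} p M M"
  unfolding exact_at_def
proof (intro allI impI)
  fix f :: "'g list \<Rightarrow> real"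
  assume f: "cochain {0} {0} (Suc p) M f" and c: "cocycle {0} (Suc p) f"
  have "cochain {0} {0} p M (\<lambda>xs. f (0 # xs))"
    using cochain_le[OF f] by (intro cochainI) auto
  moreover have "primitive {0} p f (\<lambda>xs. f (0 # xs))"
  proof (rule primitiveI)
    fix xs :: "'g list" assume "xs \<in> tups {0} (Suc p)"
    then show "cobd (\<lambda>xs. f (0 # xs)) xs = f xs" using cocycleD[OF c, of "0 # xs"] by simp
  qed
  ultimately show "\<exists>b. cochain {0} {0} p M b \<and> primitive {0} p f b" by blast
qed

lemma HS_empty: "HS {} = {0}"
  by (auto simp: HS_def intro: perm_eqI)

section \<open>Acyclicity of the groups with trivial germs\<close>

lemma exact_at_DS:
  fixes K :: "'a::metric_space set"
  assumes ex: "\<And>(A::'a set) p M. cantor_set A \<Longrightarrow> 1 \<le> p \<Longrightarrow> p < n \<Longrightarrow> exact_at (HS A) (HS A) p M (\<rho> p M)"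
    and K: "cantor_set K" and F: "finite F" "F \<noteq> {}" "F \<subseteq> K"
  shows "exact_at (DS K F) (DS K F) n M (mitosis_bound \<rho> n M)"
  unfolding exact_at_def
proof (intro allI impI)
  fix c assume c: "cochain (DS K F) (DS K F) (Suc n) M c" "cocycle (DS K F) (Suc n) c"
  have cK: "compact K" using K by (simp add: cantor_set_def)
  obtain A W :: "nat \<Rightarrow> 'a set" where AW:
    "\<And>f. f \<in> DS K F \<Longrightarrow> \<forall>\<^sub>F k in sequentially. f \<in> HS (A k)"
    "\<And>k. clp K (W k)" "\<And>k. W k \<inter> F = {}" "\<And>k. clp (W k) (A k)" "\<And>k. A k \<noteq> W k"
    by (rule DS_exhaustion[OF K F]) (rule that)
  have "\<exists>b. cochain (HS (A k)) (HS (A k)) n (mitosis_bound \<rho> n M) b \<and> primitive (HS (A k)) n c b" for k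
  proof -
    have W: "cantor_set (W k)" by (rule clp_cantor[OF K AW(2)])
    have A: "cantor_set (A k)" by (rule clp_cantor[OF W AW(4)])
    have HSW: "HS (W k) \<subseteq> DS K F" by (rule HS_subset_DS[OF cK AW(2,3)])
    have HSA: "HS (A k) \<subseteq> HS (W k)" using W by (intro HS_mono AW(4)) (simp add: cantor_set_def)
    have "\<exists>t d. t \<in> HS (W k) \<and> (\<forall>h\<in>HS (A k). d h \<in> HS (W k)) \<and>
      (\<forall>h\<in>HS (A k). \<forall>k'\<in>HS (A k). d (h + k') = d h + d k') \<and>
      (\<forall>h\<in>HS (A k). \<forall>k'\<in>HS (A k). d k' + h = h + d k') \<and>
      (\<forall>h\<in>HS (A k). - t + d h + t = h + d h)"
    \<comment> \<open>If the neighbourhood of \<open>F\<close> is all of \<open>K\<close>, then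
      \<open>A k\<close> is empty and its group is trivial, so \<open>t\<close> and \<open>d\<close>
      can be taken trivial.\<close>
    proof (cases "A k = {}")
      case True
      then show ?thesis using subgrp_0[OF subgrp_HS]
        by (intro exI[of _ 0] exI[of _ "\<lambda>_. 0"]) (simp add: HS_empty)
    next
      case False
      obtain t d where "t \<in> HS (W k)" "\<And>h. h \<in> HS (A k) \<Longrightarrow> d h \<in> HS (W k)"
        "\<And>h k'. h \<in> HS (A k) \<Longrightarrow> k' \<in> HS (A k) \<Longrightarrow> d (h + k') = d h + d k'"
        "\<And>h k'. h \<in> HS (A k) \<Longrightarrow> k' \<in> HS (A k) \<Longrightarrow> d k' + h = h + d k'"
        "\<And>h. h \<in> HS (A k) \<Longrightarrow> - t + d h + t = h + d h"
        by (rule mitosis_data[OF W AW(4) False AW(5)]) (rule that)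
      then show ?thesis by (intro exI[of _ t] exI[of _ d]) simp
    qed
    then obtain t d where td: "t \<in> HS (W k)" "\<forall>h\<in>HS (A k). d h \<in> HS (W k)"
      "\<forall>h\<in>HS (A k). \<forall>k'\<in>HS (A k). d (h + k') = d h + d k'"
      "\<forall>h\<in>HS (A k). \<forall>k'\<in>HS (A k). d k' + h = h + d k'"
      "\<forall>h\<in>HS (A k). - t + d h + t = h + d h" by blast
    obtain b where "cochain (HS (A k)) (HS (A k)) n (mitosis_bound \<rho> n M) b" "primitive (HS (A k)) n c b"
    proof (rule mitosis[OF subgrp_HS subgrp_HS HSA, of d t n \<rho> M c])
      show "cochain (HS (W k)) (HS (W k)) (Suc n) M c" by (rule cochain_subset[OF c(1) HSW HSW])
      show "cocycle (HS (W k)) (Suc n) c" by (rule cocycle_subset[OF c(2) HSW])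
    qed (use td ex[OF A] in blast)+
    then show ?thesis by blast
  qed
  then obtain b where "cochain (DS K F) (DS K F) n (mitosis_bound \<rho> n M) b" "primitive (DS K F) n c b"
    using primitive_exhaustion[where H = "\<lambda>k. HS (A k)" and D = "DS K F"] subgrp_DS AW(1) by metis
  then show "\<exists>b. cochain (DS K F) (DS K F) n (mitosis_bound \<rho> n M) b \<and> primitive (DS K F) n c b" by blast
qed

text \<open>The group acts on tuples of germs of homeomorphisms at \<open>a\<close>, represented as cosets, with
  pairwise distinct image points.\<close>

definition germ :: "'a::topological_space set \<Rightarrow> 'a \<Rightarrow> 'a perm \<Rightarrow> 'a perm set" where
  "germ K a g = (+) g ` DS K {a}"

definition generic_germs :: "'a::topological_space set \<Rightarrow> 'a \<Rightarrow> 'a perm set list set" where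
  "generic_germs K a = {map (germ K a) gs | gs. set gs \<subseteq> HS K \<and> distinct (map (\<lambda>g. app g a) gs)}"

lemma germ_eq_iff: "germ K a g = germ K a h \<longleftrightarrow> - h + g \<in> DS K {a}"
proof
  assume "germ K a g = germ K a h"
  moreover have "g \<in> germ K a g"
    unfolding germ_def using subgrp_0[OF subgrp_DS, of K "{a}"] by (intro image_eqI[of _ _ 0]) auto
  ultimately have "g \<in> germ K a h" by simp
  then obtain d where "d \<in> DS K {a}" "g = h + d" by (auto simp: germ_def)
  then show "- h + g \<in> DS K {a}" by (simp add: add.assoc[symmetric])
next
  assume d: "- h + g \<in> DS K {a}"
  have "germ K a h' \<subseteq> germ K a g'" if "- g' + h' \<in> DS K {a}" for g' h'
  proof
    fix x assume "x \<in> germ K a h'"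
    then obtain e where e: "e \<in> DS K {a}" "x = h' + e" by (auto simp: germ_def)
    then have "x = g' + ((- g' + h') + e)" by (simp add: add.assoc[symmetric])
    then show "x \<in> germ K a g'" unfolding germ_def using subgrp_add[OF subgrp_DS that e(1)] by blast
  qed
  moreover have "- g + h \<in> DS K {a}"
    using subgrp_minus[OF subgrp_DS d] by (simp add: minus_add)
  ultimately show "germ K a g = germ K a h" using d by blast
qed

lemma germ_act: "(+) f ` germ K a g = germ K a (f + g)"
  by (simp add: germ_def image_image add.assoc)

lemma germ_eq_app: "germ K a g = germ K a h \<Longrightarrow> app g a = app h a"
proof -
  assume "germ K a g = germ K a h"
  then have "app (- h + g) a = a" by (intro DS_fix[of _ K "{a}"]) (simp_all add: germ_eq_iff)
  then show ?thesis by (metis app_add app_app_minus)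
qed

text \<open>Conjugation by \<open>g\<close> carries trivial germs at \<open>a\<close> to trivial
  germs at the image point. This identifies the stabiliser of a germ.\<close>

lemma germ_fixed_iff:
  assumes a: "a \<in> K" and g: "g \<in> HS K" and f: "f \<in> HS K"
  shows "germ K a (f + g) = germ K a g \<longleftrightarrow> f \<in> DS K {app g a}"
proof
  assume "germ K a (f + g) = germ K a g"
  then have "g + (- g + (f + g)) - g \<in> DS K (app g ` {a})"
    by (intro DS_conj[OF g]) (use a in \<open>simp_all add: germ_eq_iff\<close>)
  moreover have "g + (- g + (f + g)) - g = f" by (metis add_diff_cancel add_minus_cancel)
  ultimately show "f \<in> DS K {app g a}" by simp
next
  assume "f \<in> DS K {app g a}"
  then have "- g + f - (- g) \<in> DS K (app (- g) ` {app g a})"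
    using DS_conj[OF HS_minus[OF g]] HS_mem[OF g] a by blast
  then show "germ K a (f + g) = germ K a g" by (simp add: germ_eq_iff add.assoc)
qed

text \<open>Once the tail is matched by \<open>f\<close>, the head is adjusted by an element with
  trivial germs at the image points of \<open>hs\<close>, which leaves the tail alone. Distinct
  image points are what permits this adjustment.\<close>

lemma generic_germs_transitive:
  fixes K :: "'a::metric_space set"
  assumes K: "cantor_set K" and a: "a \<in> K"
    and "length gs = length hs" "set gs \<subseteq> HS K" "distinct (map (\<lambda>g. app g a) gs)"
    "set hs \<subseteq> HS K" "distinct (map (\<lambda>g. app g a) hs)"
  shows "\<exists>f\<in>HS K. map (\<lambda>g. germ K a (f + g)) gs = map (germ K a) hs"
  using assms(3-)
proof (induction gs hs rule: list_induct2)
  case Nil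
  then show ?case using subgrp_0[OF subgrp_HS] by auto
next
  case (Cons g gs h hs)
  then obtain f where f: "f \<in> HS K" "map (\<lambda>g. germ K a (f + g)) gs = map (germ K a) hs" by auto
  have g: "g \<in> HS K" and h: "h \<in> HS K" and hs: "set hs \<subseteq> HS K" using Cons.prems by auto
  \<comment> \<open>\<open>?k\<close> carries the germ of \<open>f + g\<close> at \<open>a\<close>
    to that of \<open>h\<close>. Only its germ at \<open>?x\<close> matters, and \<open>s\<close>
    will realise that germ while fixing those at \<open>?F\<close>.\<close>
  let ?F = "(\<lambda>h. app h a) ` set hs" and ?x = "app (f + g) a" and ?k = "h + (- g + - f)"
  have k: "?k \<in> HS K" by (intro HS_add HS_minus f(1) g h)
  have kx: "app ?k ?x = app h a" by simp
  have "map (\<lambda>g. app (f + g) a) gs = map (\<lambda>h. app h a) hs"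
  proof (rule nth_equalityI)
    fix i assume "i < length (map (\<lambda>g. app (f + g) a) gs)"
    then have i: "i < length gs" by simp
    have "germ K a (f + gs ! i) = germ K a (hs ! i)"
      using arg_cong[OF f(2), of "\<lambda>xs. xs ! i"] i Cons.hyps by simp
    from germ_eq_app[OF this] show "map (\<lambda>g. app (f + g) a) gs ! i = map (\<lambda>h. app h a) hs ! i"
      using i Cons.hyps by simp
  qed (use Cons.hyps in simp)
  then have F: "?F = (\<lambda>g. app (f + g) a) ` set gs" by (metis image_set)
  have "app g a \<notin> (\<lambda>g. app g a) ` set gs" "app h a \<notin> ?F" using Cons.prems by auto
  then have xF: "?x \<notin> ?F" "app ?k ?x \<notin> ?F" unfolding kx unfolding F by auto
  have "?F \<subseteq> K" using hs HS_mem a by auto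
  moreover have xK: "?x \<in> K" using HS_mem[OF HS_add[OF f(1) g]] a by simp
  ultimately obtain s U where s: "s \<in> DS K ?F" "open U" "?x \<in> U" "\<And>y. y \<in> U \<Longrightarrow> app s y = app ?k y"
    using extend_germ[OF K _ _ k _ xF] by (metis finite_imageI finite_set)
  have sHS: "s \<in> HS K" using s(1) DS_subset_HS by blast
  have 1: "germ K a (s + f + g) = germ K a h"
    unfolding germ_eq_iff
  proof (rule DS_I_openin)
    show "- h + (s + f + g) \<in> HS K" by (intro HS_add HS_minus sHS f(1) g h)
    show "openin (top_of_set K) {x \<in> K. app (f + g) x \<in> U}"
      by (rule openin_HS_vimage[OF HS_add[OF f(1) g] s(2)])
    show "{a} \<subseteq> {x \<in> K. app (f + g) x \<in> U}" using a s(3) by simp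
    fix x assume "x \<in> {x \<in> K. app (f + g) x \<in> U}"
    then have "app s (app f (app g x)) = app ?k (app f (app g x))" using s(4) by simp
    then show "app (- h + (s + f + g)) x = x" by simp
  qed
  have "germ K a (s + f + g') = germ K a h'" if "germ K a (f + g') = germ K a h'" "h' \<in> set hs" for g' h'
  proof -
    have "germ K a (s + f + g') = (+) s ` germ K a (f + g')" by (simp add: germ_act add.assoc)
    also have "\<dots> = germ K a (s + h')" by (simp add: that germ_act)
    also have "\<dots> = germ K a h'"
      using germ_fixed_iff[OF a _ sHS, of h'] that(2) hs s(1) DS_iff_points[of s K ?F] by blast
    finally show ?thesis .
  qed
  then have "map (\<lambda>g. germ K a (s + f + g)) gs = map (germ K a) hs"
    using f(2) Cons.hyps by (auto simp: list_eq_iff_nth_eq)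
  then show ?case using 1 HS_add[OF sHS f(1)] by (intro bexI[of _ "s + f"]) auto
qed

section \<open>Acyclicity of the full homeomorphism group\<close>

lemma exact_at_HS:
  fixes K :: "'a::metric_space set"
  assumes K: "cantor_set K" "K \<noteq> {}"
    and ex: "\<And>F p M. finite F \<Longrightarrow> F \<noteq> {} \<Longrightarrow> F \<subseteq> K \<Longrightarrow> p \<le> n \<Longrightarrow> exact_at (DS K F) (DS K F) p M (\<rho> p M)"
  shows "exact_at (HS K) (HS K) n M (generic_bound (\<lambda>p M. \<rho> p M + real p * M) n M)"
proof -
  obtain a where a: "a \<in> K" using K(2) by blast
  obtain v where v: "\<And>k::nat. v k \<in> HS K" "inj (\<lambda>k. app (v k) a)"
    by (rule infinite_orbit[OF K(1) a]) (rule that)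
  let ?X = "generic_germs K a"
  have X_map: "map (germ K a) gs \<in> ?X" if "set gs \<subseteq> HS K" "distinct (map (\<lambda>g. app g a) gs)" for gs
    using that by (auto simp: generic_germs_def)
  have X_E: "\<exists>gs. ys = map (germ K a) gs \<and> set gs \<subseteq> HS K \<and> distinct (map (\<lambda>g. app g a) gs)" if "ys \<in> ?X" for ys
    using that by (auto simp: generic_germs_def)
  have acts: "map ((`) ((+) f)) (map (germ K a) gs) = map (germ K a) (translate f gs)" for f gs
    by (simp add: germ_act)
  interpret complex_action "HS K" ?X "\<lambda>f. (`) ((+) f)"
  proof
    show "subgrp (HS K)" by (rule subgrp_HS)
    show "(+) 0 ` y = y" for y :: "'a perm set" by simp
    show "(+) (g + h) ` y = (+) g ` (+) h ` y" for g h and y :: "'a perm set"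
      by (simp add: image_image add.assoc)
    show "[] \<in> ?X" using X_map[of "[]"] by simp
    fix ys assume "ys \<in> ?X"
    then obtain gs where gs: "ys = map (germ K a) gs" "set gs \<subseteq> HS K" "distinct (map (\<lambda>g. app g a) gs)"
      using X_E by blast
    show "map ((`) ((+) g)) ys \<in> ?X" if g: "g \<in> HS K" for g
      unfolding gs(1) acts
    proof (rule X_map)
      show "set (translate g gs) \<subseteq> HS K" using gs(2) g HS_add by auto
      show "distinct (map (\<lambda>g. app g a) (translate g gs))"
        using gs(3) by (simp add: distinct_map inj_on_def)
    qed
    fix zs assume "zs \<in> faces ys"
    then obtain hs where hs: "zs = map (germ K a) hs" "hs \<in> faces gs" by (auto simp: gs(1) faces_map)
    have "map (\<lambda>g. app g a) hs \<in> faces (map (\<lambda>g. app g a) gs)" using hs(2) by (simp add: faces_map)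
    then show "zs \<in> ?X"
      unfolding hs(1) using gs(2,3) set_faces[OF hs(2)] by (intro X_map) (auto intro: distinct_faces)
  qed
  show ?thesis
  proof (rule generic_action)
    fix ys zs assume "ys \<in> ?X" "zs \<in> ?X" and len: "length ys = length zs"
    then obtain gs hs where gs: "ys = map (germ K a) gs" "set gs \<subseteq> HS K" "distinct (map (\<lambda>g. app g a) gs)"
      and hs: "zs = map (germ K a) hs" "set hs \<subseteq> HS K" "distinct (map (\<lambda>g. app g a) hs)"
      using X_E by metis
    obtain f where "f \<in> HS K" "map (\<lambda>g. germ K a (f + g)) gs = map (germ K a) hs"
      using generic_germs_transitive[OF K(1) a _ gs(2,3) hs(2,3)] len gs(1) hs(1) by auto
    then show "\<exists>f\<in>HS K. zs = map ((`) ((+) f)) ys"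
      by (intro bexI[of _ f]) (simp_all add: gs(1) hs(1) germ_act comp_def)
  next
    fix ys and p :: nat and M :: real
    assume "ys \<in> ?X" and ys: "ys \<noteq> []" "p + length ys = Suc n"
    then obtain gs where gs: "ys = map (germ K a) gs" "set gs \<subseteq> HS K" "distinct (map (\<lambda>g. app g a) gs)"
      using X_E by blast
    let ?F = "(\<lambda>g. app g a) ` set gs"
    have "stab ys = DS K ?F"
    proof (rule equalityI; rule subsetI)
      fix f assume "f \<in> stab ys"
      then have f: "f \<in> HS K" "\<forall>g\<in>set gs. germ K a (f + g) = germ K a g"
        by (auto simp: stab_def gs(1) germ_act)
      then have "f \<in> DS K {app g a}" if "g \<in> set gs" for g
        using germ_fixed_iff[OF a _ f(1)] gs(2) that by blast
      then show "f \<in> DS K ?F" using f(1) DS_iff_points[of f K ?F] by blast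
    next
      fix f assume f: "f \<in> DS K ?F"
      then have fH: "f \<in> HS K" using DS_subset_HS by blast
      have "germ K a (f + g) = germ K a g" if "g \<in> set gs" for g
        using f germ_fixed_iff[OF a _ fH] gs(2) that DS_iff_points[of f K ?F] by blast
      then show "f \<in> stab ys" using fH by (simp add: stab_def gs(1) germ_act)
    qed
    \<comment> \<open>The term \<open>real p * M\<close> pays for passing from tuples over the
      stabiliser to tuples over the whole group.\<close>
    moreover have "exact_at (HS K) (DS K ?F) p M (\<rho> p M + real p * M)"
    proof (rule exact_at_extend[OF subgrp_DS subgrp_HS DS_subset_HS], rule ex)
      show "?F \<subseteq> K" using gs(2) HS_mem a by auto
      have "length ys \<noteq> 0" using ys(1) by simp
      then show "p \<le> n" using ys(2) by linarith
    qed (use ys gs(1) in auto)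
    ultimately show "exact_at (HS K) (stab ys) p M (\<rho> p M + real p * M)" by simp
  next
    fix ys g assume "ys \<in> ?X" and g: "g \<in> HS K"
    then obtain gs where gs: "ys = map (germ K a) gs" "set gs \<subseteq> HS K" "distinct (map (\<lambda>g. app g a) gs)"
      using X_E by blast
    \<comment> \<open>The points of the translated sequence are distinct, so they hit the finitely
      many image points of \<open>ys\<close> for finitely many \<open>k\<close> only.\<close>
    have "inj (\<lambda>k. app (g + v k) a)" using v(2) by (simp add: inj_def)
    then have "finite ((\<lambda>k. app (g + v k) a) -` ((\<lambda>g. app g a) ` set gs))" by (intro finite_vimageI) auto
    then have "\<forall>\<^sub>F k in sequentially. k \<notin> (\<lambda>k. app (g + v k) a) -` ((\<lambda>g. app g a) ` set gs)"
      by (simp add: cofinite_eq_sequentially[symmetric] eventually_cofinite vimage_def)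
    then show "\<forall>\<^sub>F k in sequentially. (+) g ` germ K a (v k) # ys \<in> ?X"
    proof eventually_elim
      case (elim k)
      have "map (germ K a) ((g + v k) # gs) \<in> ?X"
        by (rule X_map) (use elim gs(2,3) HS_add[OF g v(1)] in auto)
      then show ?case by (simp add: gs(1) germ_act)
    qed
  qed
qed

text \<open>The bounds have to be uniform over all Cantor sets in the ambient space, as the group
  \<^term>\<open>DS K F\<close> is treated by exhausting it with groups \<^term>\<open>HS A\<close>.\<close>

theorem exact_at_Cantor:
  "\<exists>\<rho>. \<forall>(K::'a::metric_space set) M. cantor_set K \<longrightarrow> exact_at (HS K) (HS K) n M (\<rho> M)"
proof (induction n rule: less_induct)
  case (less n)
  then obtain \<rho> where \<rho>: "\<And>p (K::'a set) M. p < n \<Longrightarrow> cantor_set K \<Longrightarrow> exact_at (HS K) (HS K) p M (\<rho> p M)"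
    by metis
  let ?\<sigma> = "\<lambda>p M. mitosis_bound \<rho> p M"
  \<comment> \<open>The maximum takes in the empty Cantor set, where the cone has the bound
    \<open>M\<close>.\<close>
  let ?r = "\<lambda>M. max M (generic_bound (\<lambda>p M. ?\<sigma> p M + real p * M) n M)"
  have "exact_at (HS K) (HS K) n M (?r M)" if K: "cantor_set K" for K :: "'a set" and M
  proof (cases "K = {}")
    case True
    show ?thesis unfolding True HS_empty by (rule exact_at_mono[OF exact_at_trivial]) simp
  next
    case False
    have "exact_at (HS K) (HS K) n M (generic_bound (\<lambda>p M. ?\<sigma> p M + real p * M) n M)"
      by (rule exact_at_HS[OF K False], rule exact_at_DS[OF \<rho> K]) auto
    then show ?thesis by (rule exact_at_mono) simp
  qed
  then show ?case by (intro exI[of _ ?r]) blast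
qed

section \<open>From the augmented complex to the quotient groups\<close>

lemma tuples_eq_tups: "tuples G n = tups (carrier G) (Suc n)"
  by (simp add: tuples_def tups_def)

lemma coboundary_eq_cobd: "xs \<in> tuples G (Suc n) \<Longrightarrow> coboundary G n f xs = cobd f xs"
  by (simp add: coboundary_def cobd_eq_sum tuples_def lessThan_Suc_atMost)

context group
begin

lemma tuples_translate:
  assumes "g \<in> carrier G" "xs \<in> tuples G n"
  shows "map (\<lambda>x. inv g \<otimes> x) xs \<in> tuples G n"
  using assms by (auto simp: tuples_def)

lemma invariant_cochain_iff:
  "f \<in> carrier (invariant_cochain_group G n) \<longleftrightarrow>
    f \<in> extensional (tuples G n) \<and> (\<exists>M. \<forall>xs\<in>tuples G n. \<bar>f xs\<bar> \<le> M) \<and>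
    (\<forall>g\<in>carrier G. \<forall>xs\<in>tuples G n. f (map (\<lambda>x. inv g \<otimes> x) xs) = f xs)"
proof (cases "f \<in> extensional (tuples G n)")
  case True
  have "cochain_act G n g f = f \<longleftrightarrow> (\<forall>xs\<in>tuples G n. f (map (\<lambda>x. inv g \<otimes> x) xs) = f xs)" for g
  proof
    assume "cochain_act G n g f = f"
    then show "\<forall>xs\<in>tuples G n. f (map (\<lambda>x. inv g \<otimes> x) xs) = f xs"
      unfolding cochain_act_def by (metis restrict_apply')
  next
    assume "\<forall>xs\<in>tuples G n. f (map (\<lambda>x. inv g \<otimes> x) xs) = f xs"
    then show "cochain_act G n g f = f"
      using True unfolding cochain_act_def by (intro extensionalityI[of _ "tuples G n"]) auto
  qed
  then show ?thesis
    using True by (simp add: invariant_cochain_group_def bounded_cochains_def bounded_iff)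
qed (simp add: invariant_cochain_group_def bounded_cochains_def)

lemma cocycle_iff:
  "f \<in> bounded_cocycles G n \<longleftrightarrow>
    f \<in> carrier (invariant_cochain_group G n) \<and> (\<forall>xs\<in>tuples G (Suc n). cobd f xs = 0)"
proof -
  have "coboundary G n f = \<one>\<^bsub>invariant_cochain_group G (Suc n)\<^esub> \<longleftrightarrow> (\<forall>xs\<in>tuples G (Suc n). cobd f xs = 0)"
    (is "_ = ?Z \<longleftrightarrow> _")
  proof
    assume "coboundary G n f = ?Z"
    then have "coboundary G n f xs = 0" if "xs \<in> tuples G (Suc n)" for xs
      using that by (simp add: invariant_cochain_group_def)
    then show "\<forall>xs\<in>tuples G (Suc n). cobd f xs = 0" by (simp add: coboundary_eq_cobd)
  next
    assume "\<forall>xs\<in>tuples G (Suc n). cobd f xs = 0"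
    then show "coboundary G n f = ?Z"
      by (intro extensionalityI[of _ "tuples G (Suc n)"])
        (auto simp: coboundary_eq_cobd invariant_cochain_group_def, simp add: coboundary_def)
  qed
  then show ?thesis by (auto simp: bounded_cocycles_def kernel_def)
qed

lemma coboundary_cocycle:
  assumes f: "f \<in> carrier (invariant_cochain_group G n)"
  shows "coboundary G n f \<in> bounded_cocycles G (Suc n)"
proof -
  obtain M where M: "\<And>xs. xs \<in> tuples G n \<Longrightarrow> \<bar>f xs\<bar> \<le> M"
    and inv: "\<And>g xs. g \<in> carrier G \<Longrightarrow> xs \<in> tuples G n \<Longrightarrow> f (map (\<lambda>x. inv g \<otimes> x) xs) = f xs"
    using f by (auto simp: invariant_cochain_iff)
  have face: "ys \<in> tuples G n" if "xs \<in> tuples G (Suc n)" "ys \<in> faces xs" for xs ys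
    using faces_tups that unfolding tuples_eq_tups by blast
  have "\<bar>coboundary G n f xs\<bar> \<le> real (Suc (Suc n)) * M" if xs: "xs \<in> tuples G (Suc n)" for xs
    using abs_cobd_le[of xs f M, OF M[OF face[OF xs]]] xs by (simp add: coboundary_eq_cobd tuples_def)
  moreover have "coboundary G n f (map (\<lambda>x. inv g \<otimes> x) xs) = coboundary G n f xs"
    if g: "g \<in> carrier G" and xs: "xs \<in> tuples G (Suc n)" for g xs
  proof -
    have "cobd (\<lambda>ys. f (map (\<lambda>x. inv g \<otimes> x) ys)) xs = cobd f xs"
      by (rule cobd_cong) (rule inv[OF g face[OF xs]])
    then show ?thesis
      using xs tuples_translate[OF g xs] by (simp add: coboundary_eq_cobd cobd_map)
  qed
  moreover have "coboundary G n f \<in> extensional (tuples G (Suc n))" by (simp add: coboundary_def)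
  moreover have "cobd (coboundary G n f) xs = 0" if xs: "xs \<in> tuples G (Suc (Suc n))" for xs
  proof -
    have "cobd (coboundary G n f) xs = cobd (cobd f) xs"
    proof (rule cobd_cong)
      fix ys assume "ys \<in> faces xs"
      then have "ys \<in> tuples G (Suc n)" using faces_tups xs unfolding tuples_eq_tups by blast
      then show "coboundary G n f ys = cobd f ys" by (rule coboundary_eq_cobd)
    qed
    then show ?thesis by (simp add: cobd_cobd)
  qed
  ultimately show ?thesis by (auto simp: cocycle_iff invariant_cochain_iff)
qed

lemma comm_group_cocycles: "comm_group ((invariant_cochain_group G n)\<lparr>carrier := bounded_cocycles G n\<rparr>)"
proof (rule comm_groupI, simp_all)
  let ?Z = "bounded_cocycles G n" and ?E = "invariant_cochain_group G n"
  have mult: "f \<otimes>\<^bsub>?E\<^esub> h = (\<lambda>xs\<in>tuples G n. f xs + h xs)" for f h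
    by (simp add: invariant_cochain_group_def)
  have one: "\<one>\<^bsub>?E\<^esub> = (\<lambda>xs\<in>tuples G n. 0)" by (simp add: invariant_cochain_group_def)
  have Z: "(\<lambda>xs\<in>tuples G n. F xs) \<in> ?Z"
    if M: "\<And>xs. xs \<in> tuples G n \<Longrightarrow> \<bar>F xs\<bar> \<le> M"
      and inv: "\<And>g xs. g \<in> carrier G \<Longrightarrow> xs \<in> tuples G n \<Longrightarrow> F (map (\<lambda>x. inv g \<otimes> x) xs) = F xs"
      and c: "\<And>xs. xs \<in> tuples G (Suc n) \<Longrightarrow> cobd F xs = 0" for F M
  proof -
    have "cobd (\<lambda>xs\<in>tuples G n. F xs) xs = cobd F xs" if xs: "xs \<in> tuples G (Suc n)" for xs
    proof (rule cobd_cong)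
      fix ys assume "ys \<in> faces xs"
      then have "ys \<in> tuples G n" using faces_tups xs unfolding tuples_eq_tups by blast
      then show "(\<lambda>xs\<in>tuples G n. F xs) ys = F ys" by simp
    qed
    then show ?thesis
      using M inv c tuples_translate by (auto simp: cocycle_iff invariant_cochain_iff)
  qed
  have ZE: "f \<in> extensional (tuples G n)" if "f \<in> ?Z" for f
    using that by (simp add: cocycle_iff invariant_cochain_iff)
  show "f \<otimes>\<^bsub>?E\<^esub> h \<in> ?Z" if f: "f \<in> ?Z" and h: "h \<in> ?Z" for f h
  proof -
    obtain M where M: "\<And>xs. xs \<in> tuples G n \<Longrightarrow> \<bar>f xs\<bar> \<le> M"
      using f by (auto simp: cocycle_iff invariant_cochain_iff)
    obtain M' where M': "\<And>xs. xs \<in> tuples G n \<Longrightarrow> \<bar>h xs\<bar> \<le> M'"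
      using h by (auto simp: cocycle_iff invariant_cochain_iff)
    have "\<bar>f xs + h xs\<bar> \<le> M + M'" if "xs \<in> tuples G n" for xs
      using M[OF that] M'[OF that] by linarith
    then show ?thesis unfolding mult
      by (rule Z) (use f h in \<open>auto simp: cocycle_iff invariant_cochain_iff cobd_add\<close>)
  qed
  show "\<one>\<^bsub>?E\<^esub> \<in> ?Z" unfolding one by (rule Z[of _ 0]) auto
  show "f \<otimes>\<^bsub>?E\<^esub> h \<otimes>\<^bsub>?E\<^esub> k = f \<otimes>\<^bsub>?E\<^esub> (h \<otimes>\<^bsub>?E\<^esub> k)" for f h k
    unfolding mult by (rule ext) simp
  show "f \<otimes>\<^bsub>?E\<^esub> h = h \<otimes>\<^bsub>?E\<^esub> f" for f h
    unfolding mult by (rule ext) simp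
  show "\<one>\<^bsub>?E\<^esub> \<otimes>\<^bsub>?E\<^esub> f = f" if "f \<in> ?Z" for f
    unfolding mult one using ZE[OF that] by (intro extensionalityI[of _ "tuples G n"]) auto
  show "\<exists>h\<in>?Z. h \<otimes>\<^bsub>?E\<^esub> f = \<one>\<^bsub>?E\<^esub>" if f: "f \<in> ?Z" for f
  proof
    show "(\<lambda>xs\<in>tuples G n. - f xs) \<otimes>\<^bsub>?E\<^esub> f = \<one>\<^bsub>?E\<^esub>"
      unfolding mult one by (rule ext) simp
    obtain M where M: "\<And>xs. xs \<in> tuples G n \<Longrightarrow> \<bar>f xs\<bar> \<le> M"
      using f by (auto simp: cocycle_iff invariant_cochain_iff)
    show "(\<lambda>xs\<in>tuples G n. - f xs) \<in> ?Z"
      by (rule Z[of _ M]) (use f M in \<open>auto simp: cocycle_iff invariant_cochain_iff cobd_minus\<close>)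
  qed
qed

text \<open>Coboundaries are cocycles, so under the assumption the subgroup divided out is the whole
  group and there is a single coset.\<close>

lemma trivial_bounded_cohomology:
  assumes "bounded_cocycles G (Suc n) \<subseteq> bounded_coboundaries G (Suc n)"
  shows "trivial_group (bounded_cohomology G (Suc n))"
proof -
  let ?Z = "bounded_cocycles G (Suc n)"
  let ?Q = "(invariant_cochain_group G (Suc n))\<lparr>carrier := ?Z\<rparr>"
  interpret Q: comm_group ?Q by (rule comm_group_cocycles)
  have eq: "bounded_coboundaries G (Suc n) = carrier ?Q"
    using assms coboundary_cocycle by auto
  have "normal (carrier ?Q) ?Q"
    using Q.normal_iff_subgroup Q.subgroup_self by blast
  then have grp: "group (?Q Mod carrier ?Q)" by (rule normal.factorgroup_is_group)
  have "carrier (?Q Mod carrier ?Q) = {carrier ?Q}"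
  proof -
    have "carrier ?Q #>\<^bsub>?Q\<^esub> x = carrier ?Q" if "x \<in> carrier ?Q" for x
      using Q.coset_join2[OF that Q.subgroup_self that] .
    moreover have "carrier ?Q \<noteq> {}" using Q.one_closed by blast
    ultimately show ?thesis by (auto simp: FactGroup_def RCOSETS_def)
  qed
  then show ?thesis
    using grp unfolding bounded_cohomology_def eq trivial_group_def by (simp add: FactGroup_def)
qed

end

section \<open>The isomorphism with the concrete homeomorphism group\<close>

definition to_Homeo :: "'a::topological_space set \<Rightarrow> 'a perm \<Rightarrow> 'a \<Rightarrow> 'a" where
  "to_Homeo K f = restrict (app f) K"

lemma to_Homeo_closed:
  assumes f: "f \<in> HS K"
  shows "to_Homeo K f \<in> carrier (Homeo K)"
proof -
  have hom: "homeomorphism K K (app f) (app (- f))"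
    using f HS_minus[OF f] by (auto simp: homeomorphism_def HS_image HS_continuous)
  have "bij_betw (app f) K K"
    using HS_image[OF f] by (auto simp: bij_betw_def inj_on_def)
  then have "to_Homeo K f \<in> Bij K"
    by (simp add: Bij_def to_Homeo_def)
  moreover have "homeomorphism K K (to_Homeo K f) (app (- f))"
    by (rule homeomorphism_cong[OF hom]) (auto simp: to_Homeo_def)
  ultimately show ?thesis by (auto simp: Homeo_def)
qed

lemma Homeo_mult:
  "g \<in> carrier (Homeo K) \<Longrightarrow> h \<in> carrier (Homeo K) \<Longrightarrow> g \<otimes>\<^bsub>Homeo K\<^esub> h = compose K g h"
  by (simp add: Homeo_def BijGroup_def)

lemma to_Homeo_add:
  assumes f: "f \<in> HS K" and g: "g \<in> HS K"
  shows "to_Homeo K (f + g) = to_Homeo K f \<otimes>\<^bsub>Homeo K\<^esub> to_Homeo K g"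
  unfolding Homeo_mult[OF to_Homeo_closed[OF f] to_Homeo_closed[OF g]]
  using HS_mem[OF g] by (auto simp: to_Homeo_def compose_def fun_eq_iff)

lemma to_Homeo_inj: "f \<in> HS K \<Longrightarrow> g \<in> HS K \<Longrightarrow> to_Homeo K f = to_Homeo K g \<Longrightarrow> f = g"
  by (rule perm_eqI) (metis HS_id restrict_apply' to_Homeo_def)

lemma to_Homeo_surj:
  assumes "h \<in> carrier (Homeo K)"
  shows "\<exists>f\<in>HS K. to_Homeo K f = h"
proof -
  obtain g where "homeomorphism K K h g" using assms by (auto simp: Homeo_def)
  then obtain f where f: "f \<in> HS K" "\<And>x. x \<in> K \<Longrightarrow> app f x = h x" by (rule HS_of_homeomorphism) (rule that)
  have "h \<in> extensional K" using assms by (auto simp: Homeo_def Bij_def)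
  then have "to_Homeo K f = h"
    unfolding to_Homeo_def using f(2) by (intro extensionalityI[of _ K]) auto
  then show ?thesis using f(1) by blast
qed

theorem theorem1p13:
  fixes K :: "'a::metric_space set"
  assumes "cantor_set K"
  shows "boundedly_acyclic (Homeo K)"
proof -
  let ?G = "Homeo K" and ?\<phi> = "to_Homeo K"
  interpret group ?G by (rule group_Homeo)
  define \<psi> where "\<psi> h = (SOME f. f \<in> HS K \<and> ?\<phi> f = h)" for h
  have \<psi>: "\<psi> h \<in> HS K" "?\<phi> (\<psi> h) = h" if "h \<in> carrier ?G" for h
  proof -
    have "\<exists>f. f \<in> HS K \<and> ?\<phi> f = h" using to_Homeo_surj[OF that] by blast
    from someI_ex[OF this] show "\<psi> h \<in> HS K" "?\<phi> (\<psi> h) = h" by (simp_all add: \<psi>_def)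
  qed
  have \<psi>_mult: "\<psi> (g \<otimes>\<^bsub>?G\<^esub> h) = \<psi> g + \<psi> h" if "g \<in> carrier ?G" "h \<in> carrier ?G" for g h
    by (rule to_Homeo_inj[of _ K])
      (use that in \<open>simp_all add: \<psi> HS_add to_Homeo_add\<close>)
  \<comment> \<open>The action on cochains is written with inverses, so a translation by
    \<open>?\<phi> f\<close> is read as the action of \<open>?\<phi> (- f)\<close>.\<close>
  have inv\<phi>: "inv\<^bsub>?G\<^esub> (?\<phi> (- f)) = ?\<phi> f" if f: "f \<in> HS K" for f
  proof (rule inv_equality)
    have id: "?\<phi> 0 = \<one>\<^bsub>?G\<^esub>" by (simp add: to_Homeo_def Homeo_def BijGroup_def fun_eq_iff)
    show "?\<phi> f \<otimes>\<^bsub>?G\<^esub> ?\<phi> (- f) = \<one>\<^bsub>?G\<^esub>"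
      using to_Homeo_add[OF f HS_minus[OF f]] id by simp
  qed (use f HS_minus to_Homeo_closed in blast)+
  \<comment> \<open>Degree \<open>Suc n\<close> means tuples of length n + 2, hence n + 3 entries in
    the cocycle condition and n + 1 for the primitive.\<close>
  have "bounded_cocycles ?G (Suc n) \<subseteq> bounded_coboundaries ?G (Suc n)" for n
  proof
    fix f assume "f \<in> bounded_cocycles ?G (Suc n)"
    then obtain M where M: "\<And>xs. xs \<in> tups (carrier ?G) (Suc (Suc n)) \<Longrightarrow> \<bar>f xs\<bar> \<le> M"
      and inv: "\<And>g xs. g \<in> carrier ?G \<Longrightarrow> xs \<in> tups (carrier ?G) (Suc (Suc n))
        \<Longrightarrow> f (map (\<lambda>x. inv\<^bsub>?G\<^esub> g \<otimes>\<^bsub>?G\<^esub> x) xs) = f xs"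
      and c: "\<And>xs. xs \<in> tups (carrier ?G) (Suc (Suc (Suc n))) \<Longrightarrow> cobd f xs = 0"
      and ext: "f \<in> extensional (tuples ?G (Suc n))"
      by (auto simp: cocycle_iff invariant_cochain_iff tuples_eq_tups)
    obtain \<rho> where "exact_at (HS K) (HS K) (Suc n) M (\<rho> M)"
      using exact_at_Cantor assms by blast
    moreover have "cochain (HS K) (HS K) (Suc (Suc n)) M (\<lambda>xs. f (map ?\<phi> xs))"
    proof (rule cochainI)
      fix xs assume xs: "xs \<in> tups (HS K) (Suc (Suc n))"
      have \<phi>xs: "map ?\<phi> xs \<in> tups (carrier ?G) (Suc (Suc n))" by (rule map_tups[OF xs to_Homeo_closed])
      show "\<bar>f (map ?\<phi> xs)\<bar> \<le> M" by (rule M[OF \<phi>xs])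
      fix g assume g: "g \<in> HS K"
      have "map ?\<phi> (translate g xs) = map (\<lambda>x. inv\<^bsub>?G\<^esub> (?\<phi> (- g)) \<otimes>\<^bsub>?G\<^esub> x) (map ?\<phi> xs)"
        using xs to_Homeo_add[OF g] by (auto simp: tups_def inv\<phi>[OF g])
      then show "f (map ?\<phi> (translate g xs)) = f (map ?\<phi> xs)"
        by (simp only: inv[OF to_Homeo_closed[OF HS_minus[OF g]] \<phi>xs])
    qed
    moreover have "cocycle (HS K) (Suc (Suc n)) (\<lambda>xs. f (map ?\<phi> xs))"
      unfolding cocycle_def
    proof
      fix xs assume "xs \<in> tups (HS K) (Suc (Suc (Suc n)))"
      then have "map ?\<phi> xs \<in> tups (carrier ?G) (Suc (Suc (Suc n)))" by (rule map_tups[OF _ to_Homeo_closed])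
      then show "cobd (\<lambda>xs. f (map ?\<phi> xs)) xs = 0" unfolding cobd_map[symmetric] by (rule c)
    qed
    ultimately obtain b where b: "cochain (HS K) (HS K) (Suc n) (\<rho> M) b"
      "primitive (HS K) (Suc n) (\<lambda>xs. f (map ?\<phi> xs)) b" by (rule exact_atE)
    define b' where "b' = (\<lambda>xs\<in>tuples ?G n. b (map \<psi> xs))"
    have \<psi>_tups: "map \<psi> xs \<in> tups (HS K) m" if "xs \<in> tups (carrier ?G) m" for xs m
      by (rule map_tups[OF that \<psi>(1)])
    have "b' \<in> carrier (invariant_cochain_group ?G n)"
      unfolding invariant_cochain_iff
    proof (intro conjI ballI)
      show "b' \<in> extensional (tuples ?G n)" by (simp add: b'_def)
      show "\<exists>M. \<forall>xs\<in>tuples ?G n. \<bar>b' xs\<bar> \<le> M"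
        using cochain_le[OF b(1) \<psi>_tups] by (auto simp: b'_def tuples_eq_tups)
      fix g xs assume g: "g \<in> carrier ?G" and xs: "xs \<in> tuples ?G n"
      have "map \<psi> (map (\<lambda>x. inv\<^bsub>?G\<^esub> g \<otimes>\<^bsub>?G\<^esub> x) xs) = translate (\<psi> (inv\<^bsub>?G\<^esub> g)) (map \<psi> xs)"
        using xs g \<psi>_mult by (auto simp: tuples_def)
      moreover have "b (translate (\<psi> (inv\<^bsub>?G\<^esub> g)) (map \<psi> xs)) = b (map \<psi> xs)"
        using xs g by (intro cochain_inv[OF b(1)] \<psi> \<psi>_tups) (auto simp: tuples_eq_tups)
      ultimately show "b' (map (\<lambda>x. inv\<^bsub>?G\<^esub> g \<otimes>\<^bsub>?G\<^esub> x) xs) = b' xs"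
        using xs tuples_translate[OF g xs] by (simp add: b'_def del: map_map)
    qed
    moreover have "coboundary ?G n b' = f"
    proof (rule extensionalityI[of _ "tuples ?G (Suc n)"])
      show "coboundary ?G n b' \<in> extensional (tuples ?G (Suc n))" by (simp add: coboundary_def)
      fix xs assume xs: "xs \<in> tuples ?G (Suc n)"
      have "coboundary ?G n b' xs = cobd b' xs" by (rule coboundary_eq_cobd[OF xs])
      also have "\<dots> = cobd (\<lambda>xs. b (map \<psi> xs)) xs"
      proof (rule cobd_cong)
        fix ys assume "ys \<in> faces xs"
        then have "ys \<in> tuples ?G n" using faces_tups xs unfolding tuples_eq_tups by blast
        then show "b' ys = b (map \<psi> ys)" by (simp add: b'_def)
      qed
      also have "\<dots> = cobd b (map \<psi> xs)" by (rule cobd_map[symmetric])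
      also have "\<dots> = f (map ?\<phi> (map \<psi> xs))"
        by (rule primitiveD[OF b(2) \<psi>_tups]) (use xs in \<open>simp add: tuples_eq_tups\<close>)
      also have "map ?\<phi> (map \<psi> xs) = xs"
        using xs \<psi>(2) by (auto simp: tuples_def intro!: map_idI)
      finally show "coboundary ?G n b' xs = f xs" .
    qed (rule ext)
    ultimately show "f \<in> bounded_coboundaries ?G (Suc n)" by auto
  qed
  then have "trivial_group (bounded_cohomology ?G (Suc n))" for n
    by (rule trivial_bounded_cohomology)
  then show ?thesis
    unfolding boundedly_acyclic_def by (metis One_nat_def Suc_le_D)
qed

end
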